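(* Let $S_1,S_2\subset\mathbb{R}^{N+1}$ be non-degenerate locally convex hypersurfaces such that every tangent space of $S_1$ is transversal to every tangent space of $S_2$. Then the set of centers of conics that make contact of order $\geq 3$ with $S_1$ at a point $p_1\in S_1$ and with $S_2$ at a point $p_2\in S_2$, in directions $Y_1\in T_{p_1}S_1$ and $Y_2\in T_{p_2}S_2$ respectively, where $Y_i$ is $h_i$-orthogonal to the intersection of $T_{p_1}S_1$ and $T_{p_2}S_2$ ($i=1,2$), coincides with the set EMH of the pair $(S_1,S_2)$.
   Context: $h_i$ denotes the Blaschke metric of $S_i$: if $\xi_i$ is the affine normal field of $S_i$ and $D$ the canonical connection, $h_i$ is defined by $D_XY=\nabla_XY+h_i(X,Y)\xi_i$ with $X,Y$ tangent and $\nabla_XY$ tangent. The hypersurface is non-degenerate if $h_i$ is non-degenerate; local convexity makes $h_i$ definite. The conormal $\nu_i(p)$ is the linear functional on $\mathbb{R}^{N+1}$ with $\nu_i(p)(\xi_i)=1$ and $\nu_i(p)|_{T_pS_i}=0$. For $(p_1,p_2)\in S_1\times S_2$ put $M=\frac{p_1+p_2}{2}$, $C=\frac{p_1-p_2}{2}$. The mid-hyperplane of $(p_1,p_2)$ is the affine hyperplane containing $M$ and the intersection (of codimension 2) of the affine tangent spaces at $p_1$ and $p_2$; it has equation $F(p_1,p_2,X)=0$, where $F(p_1,p_2,X)=(\nu_2(C)\nu_1+\nu_1(C)\nu_2)(X-M)$. The Envelope of Mid-Hyperplanes (EMH) of $(S_1,S_2)$ is the set of $X\in\mathbb{R}^{N+1}$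 for which there is $(p_1,p_2)\in S_1\times S_2$ with $F=0$, $F_{p_1}=0$ and $F_{p_2}=0$ at $(p_1,p_2,X)$, where $F_{p_i}$ is the differential of $F$ with respect to $p_i\in S_i$ with the other variables fixed. In statements of orthogonality, the intersection of the tangent spaces is identified with its $(N-1)$-dimensional direction space, contained in both $T_{p_1}S_1$ and $T_{p_2}S_2$ as vector spaces. A conic (a planar conic in some affine 2-plane, having a center) makes contact of order $\geq3$ with $S_i$ at $p_i$ in the direction $Y_i$ if it passes through $p_i$, is tangent there to $Y_i\neq 0$, and, for a regular parameterization $c$ of the conic with $c(0)=p_i$ and a local defining function $g$ of $S_i$ with $dg\ne0$, one has $g(c(t))=O(t^3)$.
   Formalization: The EMH is taken only over pairs (p1,p2) that have a mid-hyperplane, i.e. whose midpoint M is not in the intersection of the two affine tangent spaces; for other pairs (e.g. p1=p2) F vanishes identically and the stated equality can fail. *)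

theory Defs
  imports "HOL-Analysis.Analysis" "HOL-Library.Landau_Symbols"
begin

section \<open>Smooth maps\<close>

primrec Ck_on :: "nat \<Rightarrow> ('a::real_normed_vector \<Rightarrow> 'b::real_normed_vector) \<Rightarrow> 'a set \<Rightarrow> bool" where
  "Ck_on 0 f U \<longleftrightarrow> continuous_on U f"
| "Ck_on (Suc k) f U \<longleftrightarrow>
     (\<forall>x\<in>U. f differentiable (at x)) \<and>
     (\<forall>v. Ck_on k (\<lambda>x. frechet_derivative f (at x) v) U)"

text \<open>Meant for open \<open>U\<close>.\<close>

definition smooth_on :: "'a::real_normed_vector set \<Rightarrow> ('a \<Rightarrow> 'b::real_normed_vector) \<Rightarrow> bool" where
  "smooth_on U f \<longleftrightarrow> (\<forall>k. Ck_on k f U)"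

text \<open>Smoothness of a map that matters only on a subset \<open>A\<close> (in use: a hypersurface): locally it
  is the restriction of a smooth map of the ambient space.\<close>

definition smooth_along :: "'a::real_normed_vector set \<Rightarrow> ('a \<Rightarrow> 'b::real_normed_vector) \<Rightarrow> bool" where
  "smooth_along A f \<longleftrightarrow>
     (\<forall>p\<in>A. \<exists>U f'. open U \<and> p \<in> U \<and> smooth_on U f' \<and> (\<forall>x\<in>A \<inter> U. f' x = f x))"


section \<open>Hypersurfaces\<close>

definition local_defining_function ::
    "(real^'n) set \<Rightarrow> real^'n \<Rightarrow> (real^'n) set \<Rightarrow> (real^'n \<Rightarrow> real) \<Rightarrow> bool" where
  "local_defining_function S p U g \<longleftrightarrow>
     open U \<and> p \<in> U \<and> smooth_on U g \<and> S \<inter> U = {x\<in>U. g x = 0} \<and>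
     (\<forall>x\<in>U. \<exists>v. frechet_derivative g (at x) v \<noteq> 0)"

definition hypersurface :: "(real^'n) set \<Rightarrow> bool" where
  "hypersurface S \<longleftrightarrow> (\<forall>p\<in>S. \<exists>U g. local_defining_function S p U g)"

text \<open>The direction space of the tangent hyperplane. For a hypersurface and \<open>p \<in> S\<close> the kernel does
  not depend on the choice of \<open>g\<close>.\<close>

definition tangent_space :: "(real^'n) set \<Rightarrow> real^'n \<Rightarrow> (real^'n) set" where
  "tangent_space S p =
     {v. \<exists>U g. local_defining_function S p U g \<and> frechet_derivative g (at p) v = 0}"

definition affine_tangent_space :: "(real^'n) set \<Rightarrow> real^'n \<Rightarrow> (real^'n) set" where
  "affine_tangent_space S p = {p + v | v. v \<in> tangent_space S p}"

text \<open>Locally, \<open>S\<close> lies on one side of its tangent hyperplane.\<close>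

definition locally_convex_hypersurface :: "(real^'n) set \<Rightarrow> bool" where
  "locally_convex_hypersurface S \<longleftrightarrow> hypersurface S \<and>
     (\<forall>p\<in>S. \<exists>V n. open V \<and> p \<in> V \<and> n \<noteq> 0 \<and> tangent_space S p = {v. n \<bullet> v = 0} \<and>
        (\<forall>q\<in>S \<inter> V. n \<bullet> (q - p) \<ge> 0))"

definition transversal_hypersurfaces :: "(real^'n) set \<Rightarrow> (real^'n) set \<Rightarrow> bool" where
  "transversal_hypersurfaces S1 S2 \<longleftrightarrow>
     (\<forall>p1\<in>S1. \<forall>p2\<in>S2. {u + v | u v. u \<in> tangent_space S1 p1 \<and> v \<in> tangent_space S2 p2} = UNIV)"

text \<open>The derivative at \<open>p\<close> in the direction \<open>u \<in> tangent_space S p\<close> of a map \<open>f\<close> given on \<open>S\<close>, that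
  is, \<open>D\<^sub>u f\<close> for the canonical connection \<open>D\<close>. A derivative of \<open>f\<close> within \<open>S\<close> is not unique as a
  linear map of the ambient space, but its values on tangent vectors are.\<close>

definition deriv_along ::
    "(real^'n) set \<Rightarrow> (real^'n \<Rightarrow> 'b::real_normed_vector) \<Rightarrow> real^'n \<Rightarrow> real^'n \<Rightarrow> 'b" where
  "deriv_along S f p u = (THE w. \<exists>D. (f has_derivative D) (at p within S) \<and> w = D u)"


section \<open>Affine normal, Blaschke metric, conormal\<close>

text \<open>The component along \<open>\<xi>\<close> in the Gauss formula
  \<open>D\<^sub>X Y = \<nabla>\<^sub>X Y + h(X, Y) \<xi>\<close>, where \<open>u\<close> and \<open>w\<close> are the values at \<open>p\<close> of \<open>X\<close> and \<open>Y\<close>.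
  The result does not depend on the tangent field \<open>Y\<close> extending \<open>w\<close> to a neighbourhood of \<open>p\<close>
  in \<open>S\<close>.\<close>

definition affine_metric ::
    "(real^'n) set \<Rightarrow> (real^'n \<Rightarrow> real^'n) \<Rightarrow> real^'n \<Rightarrow> real^'n \<Rightarrow> real^'n \<Rightarrow> real" where
  "affine_metric S \<xi> p u w =
     (THE r. \<exists>V Y. open V \<and> p \<in> V \<and> smooth_along (S \<inter> V) Y \<and>
        (\<forall>q\<in>S \<inter> V. Y q \<in> tangent_space S q) \<and> Y p = w \<and>
        deriv_along S Y p u - r *\<^sub>R \<xi> p \<in> tangent_space S p)"

definition transversal_field :: "(real^'n) set \<Rightarrow> (real^'n \<Rightarrow> real^'n) \<Rightarrow> bool" where
  "transversal_field S \<xi> \<longleftrightarrow> smooth_along S \<xi> \<and> (\<forall>p\<in>S. \<xi> p \<notin> tangent_space S p)"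

text \<open>The affine normal (Blaschke) field: \<open>D\<^sub>X \<xi>\<close> is tangent, and the induced volume
  \<open>\<theta>(X\<^sub>1, \<dots>, X\<^sub>N) = det (X\<^sub>1, \<dots>, X\<^sub>N, \<xi>)\<close> is the volume of the metric, i.e.
  \<open>\<theta>(X\<^sub>1, \<dots>, X\<^sub>N)\<^sup>2 = \<bar>det (h(X\<^sub>i, X\<^sub>j))\<bar>\<close>. The \<open>N = CARD('n) - 1\<close> tangent vectors
  are indexed by the elements of \<open>'n\<close> other than \<open>k\<close>; on the right, row and column \<open>k\<close> are filled up
  with those of the identity matrix, which turns the \<open>N \<times> N\<close> determinant into one over \<open>'n\<close>.
  These conditions determine \<open>\<xi>\<close> up to sign (on each connected component); the sign is left free.\<close>

definition affine_normal_field :: "(real^'n) set \<Rightarrow> (real^'n \<Rightarrow> real^'n) \<Rightarrow> bool" where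
  "affine_normal_field S \<xi> \<longleftrightarrow> transversal_field S \<xi> \<and>
     (\<forall>p\<in>S. \<forall>u\<in>tangent_space S p. deriv_along S \<xi> p u \<in> tangent_space S p) \<and>
     (\<forall>p\<in>S. \<forall>k. \<forall>X :: 'n \<Rightarrow> real^'n. (\<forall>i. i \<noteq> k \<longrightarrow> X i \<in> tangent_space S p) \<longrightarrow>
        (det (\<chi> i. if i = k then \<xi> p else X i))\<^sup>2 =
        \<bar>det ((\<chi> i j. if i = k \<or> j = k then (if i = j then 1 else 0)
                       else affine_metric S \<xi> p (X i) (X j)) :: real^'n^'n)\<bar>)"

definition nondegenerate_hypersurface :: "(real^'n) set \<Rightarrow> (real^'n \<Rightarrow> real^'n) \<Rightarrow> bool" where
  "nondegenerate_hypersurface S \<xi> \<longleftrightarrow>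
     (\<forall>p\<in>S. \<forall>u\<in>tangent_space S p.
        (\<forall>w\<in>tangent_space S p. affine_metric S \<xi> p u w = 0) \<longrightarrow> u = 0)"

definition conormal ::
    "(real^'n) set \<Rightarrow> (real^'n \<Rightarrow> real^'n) \<Rightarrow> real^'n \<Rightarrow> real^'n \<Rightarrow> real" where
  "conormal S \<xi> p = (THE \<nu>. linear \<nu> \<and> \<nu> (\<xi> p) = 1 \<and> (\<forall>v\<in>tangent_space S p. \<nu> v = 0))"


section \<open>Envelope of mid-hyperplanes\<close>

definition mid_hyperplane_fun ::
    "(real^'n) set \<Rightarrow> (real^'n \<Rightarrow> real^'n) \<Rightarrow> (real^'n) set \<Rightarrow> (real^'n \<Rightarrow> real^'n) \<Rightarrow>
     real^'n \<Rightarrow> real^'n \<Rightarrow> real^'n \<Rightarrow> real" where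
  "mid_hyperplane_fun S1 \<xi>1 S2 \<xi>2 p1 p2 X =
     (let M = (1/2) *\<^sub>R (p1 + p2); C = (1/2) *\<^sub>R (p1 - p2);
          \<nu>1 = conormal S1 \<xi>1 p1; \<nu>2 = conormal S2 \<xi>2 p2
      in \<nu>2 C * \<nu>1 (X - M) + \<nu>1 C * \<nu>2 (X - M))"

text \<open>A pair has a mid-hyperplane only if its midpoint is not already in the intersection of the two
  affine tangent spaces. Otherwise (for instance if \<open>p1 = p2\<close>) the equation of the mid-hyperplane
  is \<open>0 = 0\<close>, and without this condition such a pair would contribute the whole intersection of the
  affine tangent spaces to the envelope.\<close>

definition has_mid_hyperplane ::
    "(real^'n) set \<Rightarrow> (real^'n) set \<Rightarrow> real^'n \<Rightarrow> real^'n \<Rightarrow> bool" where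
  "has_mid_hyperplane S1 S2 p1 p2 \<longleftrightarrow>
     (1/2) *\<^sub>R (p1 + p2) \<notin> affine_tangent_space S1 p1 \<inter> affine_tangent_space S2 p2"

definition EMH ::
    "(real^'n) set \<Rightarrow> (real^'n \<Rightarrow> real^'n) \<Rightarrow> (real^'n) set \<Rightarrow> (real^'n \<Rightarrow> real^'n) \<Rightarrow>
     (real^'n) set" where
  "EMH S1 \<xi>1 S2 \<xi>2 =
     {X. \<exists>p1\<in>S1. \<exists>p2\<in>S2. has_mid_hyperplane S1 S2 p1 p2 \<and>
        mid_hyperplane_fun S1 \<xi>1 S2 \<xi>2 p1 p2 X = 0 \<and>
        (\<forall>u\<in>tangent_space S1 p1.
           deriv_along S1 (\<lambda>q. mid_hyperplane_fun S1 \<xi>1 S2 \<xi>2 q p2 X) p1 u = 0) \<and>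
        (\<forall>u\<in>tangent_space S2 p2.
           deriv_along S2 (\<lambda>q. mid_hyperplane_fun S1 \<xi>1 S2 \<xi>2 p1 q X) p2 u = 0)}"


section \<open>Conics and their contact with a hypersurface\<close>

text \<open>A non-degenerate conic in the affine plane \<open>w + span {e1, e2}\<close>; the condition on the
  coefficients is that the symmetric matrix with rows \<open>(a, b, d)\<close>, \<open>(b, c, e)\<close>, \<open>(d, e, f)\<close>
  is regular.\<close>

definition planar_conic :: "(real^'n) set \<Rightarrow> bool" where
  "planar_conic \<Gamma> \<longleftrightarrow>
     (\<exists>w e1 e2 a b c d e f. e1 \<noteq> e2 \<and> independent {e1, e2} \<and>
        a * (c * f - e * e) - b * (b * f - e * d) + d * (b * e - c * d) \<noteq> 0 \<and>
        \<Gamma> = {w + x *\<^sub>R e1 + y *\<^sub>R e2 | x y.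
               a * x\<^sup>2 + 2 * b * x * y + c * y\<^sup>2 + 2 * d * x + 2 * e * y + f = 0})"

definition conic_center :: "(real^'n) set \<Rightarrow> real^'n \<Rightarrow> bool" where
  "conic_center \<Gamma> X \<longleftrightarrow> (\<forall>q\<in>\<Gamma>. 2 *\<^sub>R X - q \<in> \<Gamma>)"

text \<open>Contact of order at least 3 of \<open>\<Gamma>\<close> with \<open>S\<close> at \<open>p\<close> in the direction \<open>Y\<close>. The condition does
  not depend on the parameterization or the defining function.\<close>

definition contact3 :: "(real^'n) set \<Rightarrow> (real^'n) set \<Rightarrow> real^'n \<Rightarrow> real^'n \<Rightarrow> bool" where
  "contact3 \<Gamma> S p Y \<longleftrightarrow> p \<in> \<Gamma> \<and> Y \<noteq> 0 \<and>
     (\<exists>\<epsilon>>0. \<exists>c. smooth_on {-\<epsilon><..<\<epsilon>} c \<and>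
        (\<forall>t\<in>{-\<epsilon><..<\<epsilon>}. c t \<in> \<Gamma> \<and> vector_derivative c (at t) \<noteq> 0) \<and>
        c 0 = p \<and> (\<exists>r. vector_derivative c (at 0) = r *\<^sub>R Y) \<and>
        (\<exists>U g. local_defining_function S p U g \<and>
           (\<lambda>t. g (c t)) \<in> O[at 0](\<lambda>t::real. t ^ 3)))"

definition h_orthogonal ::
    "(real^'n) set \<Rightarrow> (real^'n \<Rightarrow> real^'n) \<Rightarrow> real^'n \<Rightarrow> real^'n \<Rightarrow> (real^'n) set \<Rightarrow> bool" where
  "h_orthogonal S \<xi> p Y W \<longleftrightarrow> (\<forall>w\<in>W. affine_metric S \<xi> p Y w = 0)"

definition conic_centers ::
    "(real^'n) set \<Rightarrow> (real^'n \<Rightarrow> real^'n) \<Rightarrow> (real^'n) set \<Rightarrow> (real^'n \<Rightarrow> real^'n) \<Rightarrow>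
     (real^'n) set" where
  "conic_centers S1 \<xi>1 S2 \<xi>2 =
     {X. \<exists>\<Gamma>. planar_conic \<Gamma> \<and> conic_center \<Gamma> X \<and>
        (\<exists>p1\<in>S1. \<exists>p2\<in>S2. \<exists>Y1\<in>tangent_space S1 p1. \<exists>Y2\<in>tangent_space S2 p2.
           h_orthogonal S1 \<xi>1 p1 Y1 (tangent_space S1 p1 \<inter> tangent_space S2 p2) \<and>
           h_orthogonal S2 \<xi>2 p2 Y2 (tangent_space S1 p1 \<inter> tangent_space S2 p2) \<and>
           contact3 \<Gamma> S1 p1 Y1 \<and> contact3 \<Gamma> S2 p2 Y2)}"

end

theory Submission
  imports Defs
begin

text \<open>Fix \<open>p\<^sub>1\<close> and \<open>p\<^sub>2\<close>, and let \<open>g\<^sub>i\<close> be a local defining function of \<open>S\<^sub>i\<close> at \<open>p\<^sub>i\<close>, with first and second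
derivatives \<open>n\<^sub>i\<close> and \<open>B\<^sub>i\<close> at \<open>p\<^sub>i\<close>. Up to nonzero factors the conormal \<open>\<nu>\<^sub>i\<close> is \<open>n\<^sub>i\<close>
(\<open>conormal_eq\<close>) and the metric \<open>h\<^sub>i\<close> is \<open>B\<^sub>i\<close> on the tangent space \<open>ker n\<^sub>i\<close>
(\<open>affine_metric_eq\<close>), where \<open>B\<^sub>i\<close> is definite because \<open>S\<^sub>i\<close> is locally convex and
non-degenerate (\<open>second_form_definite\<close>). The statement thus becomes one about two linear functionals
and two symmetric forms.

Put \<open>C = (p\<^sub>1 - p\<^sub>2)/2\<close> and \<open>E = X - (p\<^sub>1 + p\<^sub>2)/2\<close>. The equation of the mid-hyperplane is
\<open>n\<^sub>2(C) n\<^sub>1(E) + n\<^sub>1(C) n\<^sub>2(E) = 0\<close>, and differentiating it along \<open>S\<^sub>1\<close> and \<open>S\<^sub>2\<close>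
(\<open>deriv_along_mid_hyperplane\<close>) gives, for \<open>u\<close> tangent to \<open>S\<^sub>1\<close> and \<open>v\<close> tangent to \<open>S\<^sub>2\<close>,

\<open>B\<^sub>1(u, n\<^sub>2(C) E + n\<^sub>2(E) C) + n\<^sub>2(u) (n\<^sub>1(E) - n\<^sub>1(C))/2 = 0\<close>,

\<open>B\<^sub>2(v, n\<^sub>1(C) E + n\<^sub>1(E) C) - n\<^sub>1(v) (n\<^sub>2(E) + n\<^sub>2(C))/2 = 0\<close>.

From these equations to a conic: definiteness forces \<open>n\<^sub>1(E) = l n\<^sub>1(C)\<close> and \<open>n\<^sub>2(E) = - l n\<^sub>2(C)\<close> with
\<open>l \<notin> {0, 1}\<close> (\<open>envelope_ratio\<close>). The conic \<open>{X + x C + y E | x\<^sup>2 - l y\<^sup>2 = 1 - l}\<close> passes through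
\<open>p\<^sub>1 = X + C - E\<close> and \<open>p\<^sub>2 = X - C - E\<close> with tangent directions \<open>E - l C\<close> and \<open>E + l C\<close>. For \<open>u\<close> in
the intersection of the two tangent spaces the displayed equations say that these directions are
orthogonal to the intersection; for the one remaining direction they say that the contact
has order 3 (\<open>envelope_direction\<close>, \<open>mid_conic_contact3\<close>).

From a conic to these equations: a conic with centre \<open>X\<close> is \<open>Q(q - X, q - X) = 1\<close> for a symmetric
bilinear form \<open>Q\<close> (\<open>infinite_central_conic_form\<close>). In the plane of the conic \<open>n\<^sub>i\<close> has the same
kernel as the polar form \<open>Q(p\<^sub>i - X, _)\<close>, hence is a multiple of it, so that all values that occur in
the equations are explicit in \<open>Q(p\<^sub>1 - X, p\<^sub>2 - X)\<close>, and contact of order 3 turns \<open>B\<^sub>i\<close> in the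
tangent direction into the same multiple of \<open>Q\<close> (locale \<open>two_conic_tangents\<close>).\<close>

section \<open>Calculus of smooth maps\<close>

text \<open>The point comes last, so that the partial application \<open>dird f v\<close> is again a function of the point and
second derivatives can be written \<open>dird (dird f v) w\<close>.\<close>

abbreviation dird :: "('a::real_normed_vector \<Rightarrow> 'b::real_normed_vector) \<Rightarrow> 'a \<Rightarrow> 'a \<Rightarrow> 'b"
  where "dird f v x \<equiv> frechet_derivative f (at x) v"

lemma Ck_on_subset: "Ck_on k f U \<Longrightarrow> V \<subseteq> U \<Longrightarrow> Ck_on k f V"
  by (induction k arbitrary: f) (auto intro: continuous_on_subset)

lemma smooth_on_subset: "smooth_on U f \<Longrightarrow> V \<subseteq> U \<Longrightarrow> smooth_on V f"
  unfolding smooth_on_def by (blast intro: Ck_on_subset)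

lemma frechet_derivative_cong_open:
  assumes "open U" "x \<in> U" "\<And>y. y \<in> U \<Longrightarrow> f y = g y"
  shows "frechet_derivative f (at x) = frechet_derivative g (at x)"
proof -
  have "(f has_derivative D) (at x) \<longleftrightarrow> (g has_derivative D) (at x)" for D
    using has_derivative_transform_within_open[of f D x UNIV U g]
      has_derivative_transform_within_open[of g D x UNIV U f] assms by auto
  then show ?thesis unfolding frechet_derivative_def by simp
qed

lemma Ck_on_cong:
  assumes "open U" "\<And>y. y \<in> U \<Longrightarrow> f y = g y"
  shows "Ck_on k f U \<longleftrightarrow> Ck_on k g U"
  using assms(2)
proof (induction k arbitrary: f g)
  case 0
  then show ?case by (simp cong: continuous_on_cong)
next
  case (Suc k)
  have D: "frechet_derivative f (at x) = frechet_derivative g (at x)" if "x \<in> U" for x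
    using frechet_derivative_cong_open[OF assms(1) that] Suc.prems by blast
  have "f differentiable (at x) \<longleftrightarrow> g differentiable (at x)" if "x \<in> U" for x
    using has_derivative_transform_within_open[of f _ x UNIV U g]
      has_derivative_transform_within_open[of g _ x UNIV U f] assms(1) that Suc.prems
    unfolding differentiable_def by metis
  moreover have "Ck_on k (dird f v) U \<longleftrightarrow> Ck_on k (dird g v) U" for v
    by (rule Suc.IH) (simp add: D)
  ultimately show ?case by simp
qed

text \<open>The recursion for \<open>Ck_on\<close> refers to the canonical derivative; here any explicit formula for the derivative
will do. All closure properties below are proved with it by induction on \<open>k\<close>.\<close>

lemma Ck_on_SucI:
  assumes "open U" "\<And>x. x \<in> U \<Longrightarrow> (f has_derivative f' x) (at x)"
    and "\<And>v. Ck_on k (\<lambda>x. f' x v) U"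
  shows "Ck_on (Suc k) f U"
proof -
  have "frechet_derivative f (at x) = f' x" if "x \<in> U" for x
    using frechet_derivative_at[OF assms(2)[OF that]] by simp
  then have "Ck_on k (dird f v) U" for v
    using Ck_on_cong[OF assms(1), of "dird f v" "\<lambda>x. f' x v" k] assms(3) by auto
  then show ?thesis using assms(2) by (auto simp: differentiable_def)
qed

lemma Ck_on_Suc_has_derivative:
  assumes "Ck_on (Suc k) f U" "x \<in> U"
  shows "(f has_derivative (\<lambda>v. dird f v x)) (at x)"
  using assms by (simp add: frechet_derivative_works[symmetric])

lemma Ck_on_SucD: "Ck_on (Suc k) f U \<Longrightarrow> Ck_on k f U"
proof (induction k arbitrary: f)
  case 0
  then show ?case
    by (auto intro!: continuous_at_imp_continuous_on differentiable_imp_continuous_within)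
qed auto

lemma smooth_on_has_derivative:
  "smooth_on U f \<Longrightarrow> x \<in> U \<Longrightarrow> (f has_derivative (\<lambda>v. dird f v x)) (at x)"
  unfolding smooth_on_def by (blast intro: Ck_on_Suc_has_derivative)

lemma smooth_on_dird: "smooth_on U f \<Longrightarrow> smooth_on U (dird f v)"
  unfolding smooth_on_def by (metis Ck_on.simps(2))

lemma smooth_on_continuous_on: "smooth_on U f \<Longrightarrow> continuous_on U f"
  unfolding smooth_on_def by (metis Ck_on.simps(1))

lemma dird_linear: "smooth_on U f \<Longrightarrow> x \<in> U \<Longrightarrow> linear (\<lambda>v. dird f v x)"
  using has_derivative_linear[OF smooth_on_has_derivative] .

lemma Ck_on_const: "open U \<Longrightarrow> Ck_on k (\<lambda>x. a) U"
proof (induction k arbitrary: a)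
  case (Suc k)
  show ?case by (rule Ck_on_SucI[OF Suc.prems, of _ "\<lambda>x v. 0"]) (auto intro: Suc)
qed simp

lemma Ck_on_add:
  "open U \<Longrightarrow> Ck_on k f U \<Longrightarrow> Ck_on k g U \<Longrightarrow> Ck_on k (\<lambda>x. f x + g x) U"
proof (induction k arbitrary: f g)
  case (Suc k)
  show ?case
    by (rule Ck_on_SucI[OF Suc.prems(1), of _ "\<lambda>x v. dird f v x + dird g v x"])
      (use Suc in \<open>auto intro!: has_derivative_add Ck_on_Suc_has_derivative[of k]\<close>)
qed (auto intro: continuous_intros)

lemma Ck_on_scaleR:
  "open U \<Longrightarrow> Ck_on k f U \<Longrightarrow> Ck_on k g U \<Longrightarrow> Ck_on k (\<lambda>x. f x *\<^sub>R g x) U"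
proof (induction k arbitrary: f g)
  case (Suc k)
  have "((\<lambda>x. f x *\<^sub>R g x) has_derivative (\<lambda>v. f x *\<^sub>R dird g v x + dird f v x *\<^sub>R g x)) (at x)"
    if "x \<in> U" for x
    using has_derivative_scaleR[OF Ck_on_Suc_has_derivative[OF Suc.prems(2) that]
        Ck_on_Suc_has_derivative[OF Suc.prems(3) that]] .
  moreover have "Ck_on k (\<lambda>x. f x *\<^sub>R dird g v x + dird f v x *\<^sub>R g x) U" for v
    using Suc.prems Ck_on_SucD[OF Suc.prems(2)] Ck_on_SucD[OF Suc.prems(3)]
    by (intro Ck_on_add Suc.IH) auto
  ultimately show ?case by (rule Ck_on_SucI[OF Suc.prems(1)])
qed (auto intro: continuous_intros)

lemma Ck_on_sum:
  assumes "open U" "\<And>i. i \<in> I \<Longrightarrow> Ck_on k (f i) U"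
  shows "Ck_on k (\<lambda>x. \<Sum>i\<in>I. f i x) U"
proof (cases "finite I")
  case True
  then show ?thesis using assms(2)
    by (induction I rule: finite_induct) (auto intro: Ck_on_const[OF assms(1)] Ck_on_add[OF assms(1)])
qed (simp add: Ck_on_const[OF assms(1)])

lemma Ck_on_bounded_linear:
  assumes "bounded_linear L"
  shows "open U \<Longrightarrow> Ck_on k f U \<Longrightarrow> Ck_on k (\<lambda>x. L (f x)) U"
proof (induction k arbitrary: f)
  case (Suc k)
  show ?case
    by (rule Ck_on_SucI[OF Suc.prems(1), of _ "\<lambda>x v. L (dird f v x)"])
      (use Suc in \<open>auto intro!: bounded_linear.has_derivative[OF assms] Ck_on_Suc_has_derivative[of k]\<close>)
qed (auto intro: continuous_on_compose2[OF linear_continuous_on[OF assms]])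

lemma dird_euclidean_sum:
  fixes f :: "'a::euclidean_space \<Rightarrow> 'b::real_normed_vector"
  assumes "smooth_on U f" "x \<in> U"
  shows "dird f v x = (\<Sum>b\<in>Basis. (v \<bullet> b) *\<^sub>R dird f b x)"
proof -
  interpret linear "\<lambda>v. dird f v x" by (rule dird_linear[OF assms])
  have "dird f (\<Sum>b\<in>Basis. (v \<bullet> b) *\<^sub>R b) x = (\<Sum>b\<in>Basis. (v \<bullet> b) *\<^sub>R dird f b x)"
    by (simp only: sum scale)
  then show ?thesis by (simp add: euclidean_representation)
qed

text \<open>Each further derivative of the composition is, by the chain rule, a sum of products of coordinates of the
inner derivative with compositions of partial derivatives, so the class of such compositions is
closed under differentiation.\<close>

lemma smooth_on_compose:
  fixes f :: "'a::euclidean_space \<Rightarrow> 'b::real_normed_vector" and c :: "'c::real_normed_vector \<Rightarrow> 'a"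
  assumes "open V" "smooth_on U f" "smooth_on V c" "c ` V \<subseteq> U"
  shows "smooth_on V (\<lambda>t. f (c t))"
proof -
  have "Ck_on k (\<lambda>t. f (c t)) V" for k
    using assms(2)
  proof (induction k arbitrary: f)
    case 0
    show ?case
      unfolding Ck_on.simps
      by (rule continuous_on_compose2[OF smooth_on_continuous_on[OF 0] smooth_on_continuous_on[OF assms(3)] assms(4)])
  next
    case (Suc k)
    have "((\<lambda>t. f (c t)) has_derivative (\<lambda>s. \<Sum>b\<in>Basis. (dird c s t \<bullet> b) *\<^sub>R dird f b (c t))) (at t)"
      if t: "t \<in> V" for t
    proof -
      have ct: "c t \<in> U" using t assms(4) by blast
      have "((\<lambda>t. f (c t)) has_derivative (\<lambda>s. dird f (dird c s t) (c t))) (at t)"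
        using has_derivative_compose[OF smooth_on_has_derivative[OF assms(3) t]
            smooth_on_has_derivative[OF Suc.prems ct]] .
      moreover have "dird f (dird c s t) (c t) = (\<Sum>b\<in>Basis. (dird c s t \<bullet> b) *\<^sub>R dird f b (c t))" for s
        by (rule dird_euclidean_sum[OF Suc.prems ct])
      ultimately show ?thesis by (simp only:)
    qed
    moreover have "Ck_on k (\<lambda>t. \<Sum>b\<in>Basis. (dird c s t \<bullet> b) *\<^sub>R dird f b (c t)) V" for s
      using Suc.IH[OF smooth_on_dird[OF Suc.prems]] smooth_on_dird[OF assms(3), of s] assms(1)
      by (intro Ck_on_sum Ck_on_scaleR Ck_on_bounded_linear[OF bounded_linear_inner_left])
        (auto simp: smooth_on_def)
    ultimately show ?case by (rule Ck_on_SucI[OF assms(1)])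
  qed
  then show ?thesis by (simp add: smooth_on_def)
qed

text \<open>Product rule for the pairing of the derivative of \<open>g\<close> at a moving point \<open>c y\<close> with a moving vector
\<open>w y\<close>. It yields the second derivative along curves as well as the derivatives of tangent fields and of
the conormal along a hypersurface.\<close>

lemma has_derivative_dird:
  fixes g :: "'a::euclidean_space \<Rightarrow> 'b::real_normed_vector" and c w :: "'c::real_normed_vector \<Rightarrow> 'a"
  assumes g: "smooth_on U g" and U: "open U" and cU: "c x \<in> U" and xA: "x \<in> A"
    and c: "(c has_derivative c') (at x within A)" and w: "(w has_derivative w') (at x within A)"
  shows "((\<lambda>y. dird g (w y) (c y)) has_derivative
           (\<lambda>h. dird (dird g (w x)) (c' h) (c x) + dird g (w' h) (c x))) (at x within A)"
proof -
  have ev: "\<forall>\<^sub>F y in at x within A. c y \<in> U"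
    using has_derivative_continuous[OF c] cU U
    unfolding continuous_within tendsto_def by blast
  have lin: "linear (\<lambda>v. dird g v y)" if "y \<in> U" for y by (rule dird_linear[OF g that])
  have D: "((\<lambda>y. dird g b (c y)) has_derivative (\<lambda>h. dird (dird g b) (c' h) (c x))) (at x within A)" for b
    using has_derivative_compose[OF c smooth_on_has_derivative[OF smooth_on_dird[OF g] cU]] .
  have sum: "((\<lambda>y. \<Sum>b\<in>Basis. (w y \<bullet> b) *\<^sub>R dird g b (c y)) has_derivative
           (\<lambda>h. \<Sum>b\<in>Basis. ((w x \<bullet> b) *\<^sub>R dird (dird g b) (c' h) (c x) + (w' h \<bullet> b) *\<^sub>R dird g b (c x))))
           (at x within A)"
  proof (rule has_derivative_sum)
    fix b
    have "((\<lambda>y. w y \<bullet> b) has_derivative (\<lambda>h. w' h \<bullet> b)) (at x within A)"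
      by (rule has_derivative_inner_left[OF w])
    from has_derivative_scaleR[OF this D]
    show "((\<lambda>y. (w y \<bullet> b) *\<^sub>R dird g b (c y)) has_derivative
       (\<lambda>h. (w x \<bullet> b) *\<^sub>R dird (dird g b) (c' h) (c x) + (w' h \<bullet> b) *\<^sub>R dird g b (c x))) (at x within A)" .
  qed
  have sec: "dird (dird g v) u p = (\<Sum>b\<in>Basis. (v \<bullet> b) *\<^sub>R dird (dird g b) u p)" if "p \<in> U" for p u v
  proof -
    have "((\<lambda>y. \<Sum>b\<in>Basis. (v \<bullet> b) *\<^sub>R dird g b y) has_derivative
           (\<lambda>h. \<Sum>b\<in>Basis. (v \<bullet> b) *\<^sub>R dird (dird g b) h p)) (at p)"
      by (rule has_derivative_sum, rule has_derivative_scaleR_right)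
        (rule smooth_on_has_derivative[OF smooth_on_dird[OF g] that])
    from fun_cong[OF frechet_derivative_at[OF this], of u]
    have "(\<Sum>b\<in>Basis. (v \<bullet> b) *\<^sub>R dird (dird g b) u p) = dird (\<lambda>y. \<Sum>b\<in>Basis. (v \<bullet> b) *\<^sub>R dird g b y) u p" .
    also have "\<dots> = dird (dird g v) u p"
      by (rule arg_cong[where f = "\<lambda>D. D u"],
          rule frechet_derivative_cong_open[OF U that, symmetric], rule dird_euclidean_sum[OF g])
    finally show ?thesis by simp
  qed
  have eq: "(\<lambda>h. \<Sum>b\<in>Basis. ((w x \<bullet> b) *\<^sub>R dird (dird g b) (c' h) (c x) + (w' h \<bullet> b) *\<^sub>R dird g b (c x)))
      = (\<lambda>h. dird (dird g (w x)) (c' h) (c x) + dird g (w' h) (c x))"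
  proof
    fix h
    have "dird (dird g (w x)) (c' h) (c x) = (\<Sum>b\<in>Basis. (w x \<bullet> b) *\<^sub>R dird (dird g b) (c' h) (c x))"
      by (rule sec[OF cU])
    moreover have "dird g (w' h) (c x) = (\<Sum>b\<in>Basis. (w' h \<bullet> b) *\<^sub>R dird g b (c x))"
      by (rule dird_euclidean_sum[OF g cU])
    ultimately show "(\<Sum>b\<in>Basis. ((w x \<bullet> b) *\<^sub>R dird (dird g b) (c' h) (c x) + (w' h \<bullet> b) *\<^sub>R dird g b (c x)))
      = dird (dird g (w x)) (c' h) (c x) + dird g (w' h) (c x)"
      by (simp only: sum.distrib)
  qed
  show ?thesis
  proof (rule has_derivative_transform_eventually[OF sum[unfolded eq] _ _ xA])
    show "\<forall>\<^sub>F y in at x within A. (\<Sum>b\<in>Basis. (w y \<bullet> b) *\<^sub>R dird g b (c y)) = dird g (w y) (c y)"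
      using ev by eventually_elim (rule dird_euclidean_sum[OF g, symmetric])
  qed (rule dird_euclidean_sum[OF g cU, symmetric])
qed

section \<open>Symmetry of second derivatives\<close>

lemma dird_line:
  assumes "smooth_on U g" "p + t *\<^sub>R u \<in> U"
  shows "((\<lambda>s. g (p + s *\<^sub>R u)) has_derivative (\<lambda>h. h *\<^sub>R dird g u (p + t *\<^sub>R u))) (at t)"
proof -
  have "((\<lambda>s. p + s *\<^sub>R u) has_derivative (\<lambda>h. h *\<^sub>R u)) (at t)"
    by (auto intro!: derivative_eq_intros)
  from has_derivative_compose[OF this smooth_on_has_derivative[OF assms]]
  show ?thesis using linear_scale[OF dird_linear[OF assms]] by simp
qed

lemma dird_line_real:
  fixes g :: "'a::real_normed_vector \<Rightarrow> real"
  assumes "smooth_on U g" "p + t *\<^sub>R u \<in> U"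
  shows "((\<lambda>s. g (p + s *\<^sub>R u)) has_real_derivative dird g u (p + t *\<^sub>R u)) (at t)"
proof -
  have "(*) (dird g u (p + t *\<^sub>R u)) = (\<lambda>h. h *\<^sub>R dird g u (p + t *\<^sub>R u))" by auto
  then show ?thesis using dird_line[OF assms] unfolding has_field_derivative_def by simp
qed

text \<open>Two applications of the mean value theorem, first in direction \<open>u\<close>, then in direction \<open>w\<close>. The left-hand
side is symmetric in \<open>u\<close> and \<open>w\<close>.\<close>

lemma second_difference_mean_value:
  fixes g :: "'a::real_normed_vector \<Rightarrow> real"
  assumes g: "smooth_on U g" and h: "h > 0"
    and box: "\<And>s t. 0 \<le> s \<Longrightarrow> s \<le> h \<Longrightarrow> 0 \<le> t \<Longrightarrow> t \<le> h \<Longrightarrow> p + s *\<^sub>R u + t *\<^sub>R w \<in> U"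
  obtains s t where "0 \<le> s" "s \<le> h" "0 \<le> t" "t \<le> h"
    "g (p + h *\<^sub>R u + h *\<^sub>R w) - g (p + h *\<^sub>R u) - g (p + h *\<^sub>R w) + g p
       = h * h * dird (dird g u) w (p + s *\<^sub>R u + t *\<^sub>R w)"
proof -
  define \<psi> where "\<psi> s = g (p + s *\<^sub>R u + h *\<^sub>R w) - g (p + s *\<^sub>R u)" for s
  have "(\<psi> has_real_derivative (dird g u (p + s *\<^sub>R u + h *\<^sub>R w) - dird g u (p + s *\<^sub>R u))) (at s)"
    if "0 \<le> s" "s \<le> h" for s
  proof -
    let ?A = "dird g u (p + s *\<^sub>R u + h *\<^sub>R w)" and ?B = "dird g u (p + s *\<^sub>R u)"
    have "(\<psi> has_derivative (\<lambda>v. v *\<^sub>R ?A - v *\<^sub>R ?B)) (at s)"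
      using has_derivative_diff[OF dird_line[OF g, of "p + h *\<^sub>R w" s u] dird_line[OF g, of p s u]]
        box[OF that, of h] box[OF that, of 0] h
      unfolding \<psi>_def by (simp add: add_ac)
    moreover have "(\<lambda>v. v *\<^sub>R ?A - v *\<^sub>R ?B) = (*) (?A - ?B)" by (auto simp: algebra_simps)
    ultimately show ?thesis unfolding has_field_derivative_def by simp
  qed
  from MVT2[OF h this] obtain s where s: "0 < s" "s < h"
    and es: "\<psi> h - \<psi> 0 = h * (dird g u (p + s *\<^sub>R u + h *\<^sub>R w) - dird g u (p + s *\<^sub>R u))"
    by auto
  have "((\<lambda>t. dird g u (p + s *\<^sub>R u + t *\<^sub>R w)) has_real_derivative
          dird (dird g u) w (p + s *\<^sub>R u + t *\<^sub>R w)) (at t)" if "0 \<le> t" "t \<le> h" for t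
    by (rule dird_line_real[OF smooth_on_dird[OF g]]) (use box[of s t] s that in auto)
  from MVT2[OF h this] obtain t where t: "0 < t" "t < h"
    and "dird g u (p + s *\<^sub>R u + h *\<^sub>R w) - dird g u (p + s *\<^sub>R u + 0 *\<^sub>R w)
      = (h - 0) * dird (dird g u) w (p + s *\<^sub>R u + t *\<^sub>R w)"
    by metis
  then have "\<psi> h - \<psi> 0 = h * h * dird (dird g u) w (p + s *\<^sub>R u + t *\<^sub>R w)"
    using es by simp
  then show ?thesis using that[of s t] s t by (simp add: \<psi>_def)
qed

text \<open>Both mixed derivatives, at points arbitrarily close to \<open>p\<close>, equal the same symmetric difference quotient;
continuity carries this over to \<open>p\<close>.\<close>

lemma second_derivative_symmetric:
  fixes g :: "'a::real_normed_vector \<Rightarrow> real"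
  assumes g: "smooth_on U g" and U: "open U" and p: "p \<in> U"
  shows "dird (dird g u) w p = dird (dird g w) u p"
proof (rule ccontr)
  assume ne: "\<not> ?thesis"
  define e where "e = \<bar>dird (dird g u) w p - dird (dird g w) u p\<bar> / 2"
  have e: "e > 0" using ne by (simp add: e_def)
  have cont: "isCont (dird (dird g a) b) p" for a b
    using smooth_on_continuous_on[OF smooth_on_dird[OF smooth_on_dird[OF g]]] U p
    by (simp add: continuous_on_eq_continuous_at)
  obtain d1 where d1: "d1 > 0" "\<And>x. dist x p < d1 \<Longrightarrow> dist (dird (dird g u) w x) (dird (dird g u) w p) < e"
    using cont[of u w] e unfolding continuous_at_eps_delta by blast
  obtain d2 where d2: "d2 > 0" "\<And>x. dist x p < d2 \<Longrightarrow> dist (dird (dird g w) u x) (dird (dird g w) u p) < e"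
    using cont[of w u] e unfolding continuous_at_eps_delta by blast
  obtain d0 where d0: "d0 > 0" "ball p d0 \<subseteq> U" using U p openE by blast
  define d where "d = min d0 (min d1 d2)"
  \<comment> \<open>The parallelogram with sides \<open>h u\<close> and \<open>h w\<close> at \<open>p\<close> then lies within distance \<open>d\<close> of \<open>p\<close>.\<close>
  define h where "h = d / (2 * (norm u + norm w + 1))"
  have d: "d > 0" using d0 d1 d2 by (simp add: d_def)
  have nz: "norm u + norm w + 1 > 0" by (simp add: add_nonneg_pos)
  have h: "h > 0" using d nz by (simp add: h_def)
  have near: "dist (p + s *\<^sub>R u + t *\<^sub>R w) p < d" if "0 \<le> s" "s \<le> h" "0 \<le> t" "t \<le> h" for s t
  proof -
    have "dist (p + s *\<^sub>R u + t *\<^sub>R w) p = norm (s *\<^sub>R u + t *\<^sub>R w)"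
      by (simp add: dist_norm)
    also have "\<dots> \<le> s * norm u + t * norm w"
      using that by (metis abs_of_nonneg norm_scaleR norm_triangle_ineq)
    also have "\<dots> \<le> h * norm u + h * norm w"
      using that by (intro add_mono mult_right_mono) auto
    also have "\<dots> \<le> h * (norm u + norm w + 1)" using h by (simp add: algebra_simps)
    also have "\<dots> = d / 2" unfolding h_def using nz by (simp add: field_simps)
    finally show ?thesis using d by simp
  qed
  have box: "p + s *\<^sub>R u + t *\<^sub>R w \<in> U" "p + s *\<^sub>R w + t *\<^sub>R u \<in> U"
    if "0 \<le> s" "s \<le> h" "0 \<le> t" "t \<le> h" for s t
    using near[OF that] near[OF that(3,4,1,2)] d0(2) by (auto simp: d_def dist_commute add_ac)
  obtain s t where st: "0 \<le> s" "s \<le> h" "0 \<le> t" "t \<le> h"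
    "g (p + h *\<^sub>R u + h *\<^sub>R w) - g (p + h *\<^sub>R u) - g (p + h *\<^sub>R w) + g p
       = h * h * dird (dird g u) w (p + s *\<^sub>R u + t *\<^sub>R w)"
    using second_difference_mean_value[OF g h, of p u w] box(1) by blast
  obtain s' t' where st': "0 \<le> s'" "s' \<le> h" "0 \<le> t'" "t' \<le> h"
    "g (p + h *\<^sub>R w + h *\<^sub>R u) - g (p + h *\<^sub>R w) - g (p + h *\<^sub>R u) + g p
       = h * h * dird (dird g w) u (p + s' *\<^sub>R w + t' *\<^sub>R u)"
    using second_difference_mean_value[OF g h, of p w u] box(2) by blast
  have "g (p + h *\<^sub>R w + h *\<^sub>R u) = g (p + h *\<^sub>R u + h *\<^sub>R w)" by (simp add: add_ac)
  then have "h * h * dird (dird g u) w (p + s *\<^sub>R u + t *\<^sub>R w) = h * h * dird (dird g w) u (p + s' *\<^sub>R w + t' *\<^sub>R u)"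
    using st(5) st'(5) by linarith
  then have "dird (dird g u) w (p + s *\<^sub>R u + t *\<^sub>R w) = dird (dird g w) u (p + s' *\<^sub>R w + t' *\<^sub>R u)"
    using h by simp
  moreover have "dist (dird (dird g u) w (p + s *\<^sub>R u + t *\<^sub>R w)) (dird (dird g u) w p) < e"
    using near[OF st(1-4)] d1(2) by (simp add: d_def)
  moreover have "dist (dird (dird g w) u (p + s' *\<^sub>R w + t' *\<^sub>R u)) (dird (dird g w) u p) < e"
    using near[OF st'(3,4,1,2)] d2(2) by (simp add: d_def add_ac)
  ultimately have "\<bar>dird (dird g u) w p - dird (dird g w) u p\<bar> < 2 * e"
    unfolding dist_real_def by linarith
  then show False by (simp add: e_def)
qed

section \<open>Vanishing to third order\<close>

lemma smooth_real_Maclaurin: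
  fixes h :: "real \<Rightarrow> real"
  assumes h: "smooth_on {-\<epsilon><..<\<epsilon>} h" and \<epsilon>: "\<epsilon> > 0"
  obtains K where "K \<ge> 0" "\<forall>\<^sub>F t in at 0. \<bar>h t - (h 0 + dird h 1 0 * t + dird (dird h 1) 1 0 / 2 * t\<^sup>2)\<bar> \<le> K * \<bar>t\<bar> ^ 3"
proof -
  define D where "D n = ((\<lambda>f. dird f 1) ^^ n) h" for n
  have sm: "smooth_on {-\<epsilon><..<\<epsilon>} (D n)" for n
    by (induction n) (auto simp: D_def h smooth_on_dird)
  have DS: "D (Suc n) = dird (D n) 1" for n by (simp add: D_def)
  have der: "(D n has_real_derivative D (Suc n) t) (at t)" if "\<bar>t\<bar> < \<epsilon>" for n t
  proof -
    have t: "t \<in> {-\<epsilon><..<\<epsilon>}" using that by auto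
    have "dird (D n) v t = dird (D n) 1 t * v" for v
      using linear_scale[OF dird_linear[OF sm[of n] t], of v 1] by (simp add: mult.commute)
    then have "(\<lambda>v. dird (D n) v t) = (*) (dird (D n) 1 t)" by (rule ext)
    from has_derivative_eq_rhs[OF smooth_on_has_derivative[OF sm t] this]
    show ?thesis unfolding has_field_derivative_def DS .
  qed
  have "continuous_on {-\<epsilon>/2..\<epsilon>/2} (D 3)"
    using smooth_on_continuous_on[OF sm, of 3] \<epsilon> by (auto intro: continuous_on_subset)
  then have "bounded (D 3 ` {-\<epsilon>/2..\<epsilon>/2})"
    by (intro compact_imp_bounded compact_continuous_image) auto
  then obtain K where "\<forall>t\<in>{-\<epsilon>/2..\<epsilon>/2}. \<bar>D 3 t\<bar> \<le> K"
    unfolding bounded_iff by auto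
  then have K: "\<bar>D 3 t\<bar> \<le> K" if "t \<in> {-\<epsilon>/2..\<epsilon>/2}" for t using that by blast
  have K0: "K \<ge> 0" using K[of 0] \<epsilon> by auto
  have bd: "\<bar>h t - (h 0 + dird h 1 0 * t + dird (dird h 1) 1 0 / 2 * t\<^sup>2)\<bar> \<le> K * \<bar>t\<bar> ^ 3" if t: "\<bar>t\<bar> < \<epsilon>/2" for t
  proof -
    have "\<exists>s. \<bar>s\<bar> \<le> \<bar>t\<bar> \<and> h t = (\<Sum>m<3. D m 0 / fact m * t ^ m) + D 3 s / fact 3 * t ^ 3"
      by (rule Maclaurin_bi_le) (use t der in \<open>auto simp: D_def[of 0]\<close>)
    then obtain s where s: "\<bar>s\<bar> \<le> \<bar>t\<bar>" and e: "h t = (\<Sum>m<3. D m 0 / fact m * t ^ m) + D 3 s / fact 3 * t ^ 3"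
      by blast
    have "(\<Sum>m<3. D m 0 / fact m * t ^ m) = h 0 + dird h 1 0 * t + dird (dird h 1) 1 0 / 2 * t\<^sup>2"
      by (simp add: D_def numeral_3_eq_3 numeral_2_eq_2)
    then have "\<bar>h t - (h 0 + dird h 1 0 * t + dird (dird h 1) 1 0 / 2 * t\<^sup>2)\<bar> = \<bar>D 3 s\<bar> / 6 * \<bar>t\<bar> ^ 3"
      using e by (simp add: abs_mult power_abs fact_numeral)
    also have "\<dots> \<le> K * \<bar>t\<bar> ^ 3"
    proof (rule mult_right_mono)
      have "s \<in> {-\<epsilon>/2..\<epsilon>/2}" unfolding atLeastAtMost_iff using s t by linarith
      from K[OF this] have "\<bar>D 3 s\<bar> \<le> K" .
      then show "\<bar>D 3 s\<bar> / 6 \<le> K" using K0 by linarith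
    qed simp
    finally show ?thesis .
  qed
  have "\<forall>\<^sub>F t in at (0::real). \<bar>t\<bar> < \<epsilon>/2"
    unfolding eventually_at using \<epsilon> by (intro exI[of _ "\<epsilon>/2"]) auto
  then have "\<forall>\<^sub>F t in at 0. \<bar>h t - (h 0 + dird h 1 0 * t + dird (dird h 1) 1 0 / 2 * t\<^sup>2)\<bar> \<le> K * \<bar>t\<bar> ^ 3"
    by eventually_elim (rule bd)
  with K0 show ?thesis by (rule that)
qed

lemma quadratic_bigo_cubic_iff:
  fixes a b c :: real
  shows "(\<lambda>t. a + b * t + c * t\<^sup>2) \<in> O[at 0](\<lambda>t. t ^ 3) \<longleftrightarrow> a = 0 \<and> b = 0 \<and> c = 0"
proof
  assume "(\<lambda>t. a + b * t + c * t\<^sup>2) \<in> O[at 0](\<lambda>t. t ^ 3)"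
  then obtain K where "\<forall>\<^sub>F t in at 0. norm (a + b * t + c * t\<^sup>2) \<le> K * norm (t ^ 3)"
    by (rule landau_o.bigE)
  then have ev: "\<forall>\<^sub>F t in at 0. \<bar>a + b * t + c * t\<^sup>2\<bar> \<le> K * \<bar>t\<bar> ^ 3"
    by (simp add: power_abs)
  have lim0: "l = 0" if "\<forall>\<^sub>F t in at 0. \<bar>f t\<bar> \<le> r t" "(f \<longlongrightarrow> l) (at (0::real))" "(r \<longlongrightarrow> 0) (at 0)"
    for f r :: "real \<Rightarrow> real" and l
  proof -
    have "(f \<longlongrightarrow> 0) (at 0)" by (rule Lim_null_comparison[OF _ that(3)]) (use that(1) in simp)
    then show ?thesis using tendsto_unique[OF _ that(2)] by simp
  qed
  have nz: "\<forall>\<^sub>F t in at (0::real). t \<noteq> 0" by (simp add: eventually_at_filter)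
  have a: "a = 0"
    by (rule lim0[OF ev]) (auto intro!: tendsto_eq_intros)
  have "\<forall>\<^sub>F t in at 0. \<bar>b + c * t\<bar> \<le> K * \<bar>t\<bar> ^ 2"
    using ev nz
  proof eventually_elim
    case (elim t)
    have "\<bar>t\<bar> * \<bar>b + c * t\<bar> \<le> \<bar>t\<bar> * (K * \<bar>t\<bar> ^ 2)"
    proof -
      have "\<bar>t\<bar> * \<bar>b + c * t\<bar> = \<bar>a + b * t + c * t\<^sup>2\<bar>"
        unfolding abs_mult[symmetric] a by (rule arg_cong[where f = abs]) algebra
      also have "\<dots> \<le> K * \<bar>t\<bar> ^ 3" by (rule elim(1))
      also have "\<dots> = \<bar>t\<bar> * (K * \<bar>t\<bar> ^ 2)" by algebra
      finally show ?thesis .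
    qed
    then show ?case by (rule mult_left_le_imp_le) (use elim(2) in simp)
  qed
  note ev2 = this
  have b: "b = 0"
    by (rule lim0[OF ev2]) (auto intro!: tendsto_eq_intros)
  have "\<forall>\<^sub>F t in at 0. \<bar>c\<bar> \<le> K * \<bar>t\<bar>"
    using ev2 nz
  proof eventually_elim
    case (elim t)
    have "\<bar>t\<bar> * \<bar>c\<bar> \<le> \<bar>t\<bar> * (K * \<bar>t\<bar>)"
    proof -
      have "\<bar>t\<bar> * \<bar>c\<bar> = \<bar>b + c * t\<bar>"
        unfolding abs_mult[symmetric] b by (rule arg_cong[where f = abs]) algebra
      also have "\<dots> \<le> K * \<bar>t\<bar> ^ 2" by (rule elim(1))
      also have "\<dots> = \<bar>t\<bar> * (K * \<bar>t\<bar>)" by algebra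
      finally show ?thesis .
    qed
    then show ?case by (rule mult_left_le_imp_le) (use elim(2) in simp)
  qed
  note ev3 = this
  have "c = 0"
    by (rule lim0[OF ev3, of c]) (auto intro!: tendsto_eq_intros)
  with a b show "a = 0 \<and> b = 0 \<and> c = 0" by simp
qed simp

text \<open>By Taylor's formula the function differs from its quadratic Taylor polynomial by \<open>O(t\<^sup>3)\<close>, and a quadratic
polynomial is \<open>O(t\<^sup>3)\<close> only if it is zero.\<close>

lemma smooth_bigo_cubic_iff:
  fixes h :: "real \<Rightarrow> real"
  assumes h: "smooth_on {-\<epsilon><..<\<epsilon>} h" and \<epsilon>: "\<epsilon> > 0"
  shows "h \<in> O[at 0](\<lambda>t. t ^ 3) \<longleftrightarrow> h 0 = 0 \<and> dird h 1 0 = 0 \<and> dird (dird h 1) 1 0 = 0"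
proof -
  define P where "P t = h 0 + dird h 1 0 * t + dird (dird h 1) 1 0 / 2 * t\<^sup>2" for t
  obtain K where "K \<ge> 0" "\<forall>\<^sub>F t in at 0. \<bar>h t - P t\<bar> \<le> K * \<bar>t\<bar> ^ 3"
    unfolding P_def by (rule smooth_real_Maclaurin[OF assms])
  then have R: "(\<lambda>t. h t - P t) \<in> O[at 0](\<lambda>t. t ^ 3)"
    by (intro bigoI[of _ K]) (simp add: power_abs)
  have "h \<in> O[at 0](\<lambda>t. t ^ 3) \<longleftrightarrow> P \<in> O[at 0](\<lambda>t. t ^ 3)"
  proof
    assume "h \<in> O[at 0](\<lambda>t. t ^ 3)"
    from sum_in_bigo(2)[OF this R] show "P \<in> O[at 0](\<lambda>t. t ^ 3)" by simp
  next
    assume "P \<in> O[at 0](\<lambda>t. t ^ 3)"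
    from sum_in_bigo(1)[OF this R] show "h \<in> O[at 0](\<lambda>t. t ^ 3)" by simp
  qed
  also have "\<dots> \<longleftrightarrow> h 0 = 0 \<and> dird h 1 0 = 0 \<and> dird (dird h 1) 1 0 = 0"
    using quadratic_bigo_cubic_iff[of "h 0" "dird h 1 0" "dird (dird h 1) 1 0 / 2"]
    unfolding P_def by simp
  finally show ?thesis .
qed

section \<open>Hypersurfaces and their tangent vectors\<close>

lemma linear_kernel_subset:
  fixes \<phi> \<psi> :: "'a::real_vector \<Rightarrow> real"
  assumes "linear \<phi>" "linear \<psi>" "\<And>v. \<phi> v = 0 \<Longrightarrow> \<psi> v = 0" "\<phi> v0 \<noteq> 0"
  shows "\<psi> v = \<psi> v0 / \<phi> v0 * \<phi> v"
proof -
  have "\<phi> (v - (\<phi> v / \<phi> v0) *\<^sub>R v0) = 0"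
    using assms(1,4) by (simp add: linear_diff linear_scale)
  from assms(3)[OF this] show ?thesis
    using assms(2,4) by (simp add: linear_diff linear_scale)
qed

text \<open>Points with \<open>t\<close> small and \<open>\<bar>s\<bar> \<le> e t\<close> form a sector around the ray in direction \<open>u\<close>; points of a
hypersurface are searched for in such sectors.\<close>

lemma thin_sector_in_open:
  fixes p :: "'a::real_normed_vector"
  assumes "open U" "p \<in> U"
  shows "\<exists>\<delta>>0. \<forall>t s. 0 < t \<longrightarrow> t < \<delta> \<longrightarrow> \<bar>s\<bar> \<le> e * t \<longrightarrow> p + t *\<^sub>R u + s *\<^sub>R n \<in> U"
proof -
  obtain r where r: "r > 0" "ball p r \<subseteq> U" using assms openE by blast
  define c where "c = norm u + \<bar>e\<bar> * norm n + 1"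
  have c: "c > 0" unfolding c_def by (simp add: add_nonneg_pos)
  have "p + t *\<^sub>R u + s *\<^sub>R n \<in> U" if t: "0 < t" "t < r / c" and s: "\<bar>s\<bar> \<le> e * t" for t s
  proof -
    have "dist p (p + t *\<^sub>R u + s *\<^sub>R n) = norm (t *\<^sub>R u + s *\<^sub>R n)"
      by (metis add.assoc dist_commute dist_norm add_diff_cancel_left')
    also have "\<dots> \<le> t * norm u + \<bar>s\<bar> * norm n"
      using norm_triangle_ineq[of "t *\<^sub>R u" "s *\<^sub>R n"] t by simp
    also have "\<dots> \<le> t * norm u + (\<bar>e\<bar> * t) * norm n"
    proof -
      have "\<bar>s\<bar> \<le> \<bar>e\<bar> * t" using s t by (smt (verit) mult_right_mono)
      then show ?thesis by (simp add: mult_right_mono)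
    qed
    also have "\<dots> \<le> t * c" using t unfolding c_def by (simp add: algebra_simps)
    also have "\<dots> < r" using t c by (simp add: field_simps)
    finally show ?thesis using r by auto
  qed
  then show ?thesis using r c by (intro exI[of _ "r / c"]) auto
qed

text \<open>A substitute for the implicit function theorem: at distance \<open>t\<close> in the tangent direction \<open>u\<close> the function changes
sign between \<open>s = - e t\<close> and \<open>s = e t\<close>, so the intermediate value theorem gives a zero whose direction
from \<open>p\<close> tends to \<open>u\<close>.\<close>

lemma zero_near_tangent:
  fixes g :: "'a::real_normed_vector \<Rightarrow> real"
  assumes g: "smooth_on U g" and U: "open U" and p: "p \<in> U" "g p = 0"
    and u: "dird g u p = 0" and n: "dird g n p > 0" and e: "e > 0"
  shows "\<exists>\<delta>>0. \<forall>t. 0 < t \<longrightarrow> t < \<delta> \<longrightarrow>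
     (\<exists>s. \<bar>s\<bar> \<le> e * t \<and> p + t *\<^sub>R u + s *\<^sub>R n \<in> U \<and> g (p + t *\<^sub>R u + s *\<^sub>R n) = 0)"
proof -
  have lin: "linear (\<lambda>v. dird g v p)" by (rule dird_linear[OF g p(1)])
  have D: "((\<lambda>s. g (p + s *\<^sub>R (u + k *\<^sub>R n))) has_real_derivative k * dird g n p) (at 0)" for k
  proof -
    have "dird g (u + k *\<^sub>R n) p = k * dird g n p"
      using linear_add[OF lin] linear_scale[OF lin] u by simp
    then show ?thesis using dird_line_real[OF g, of p 0 "u + k *\<^sub>R n"] p by simp
  qed
  obtain d1 where d1: "d1 > 0" "\<And>t. 0 < t \<Longrightarrow> t < d1 \<Longrightarrow> g (p + t *\<^sub>R (u + e *\<^sub>R n)) > 0"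
    using DERIV_pos_inc_right[OF D[of e]] n e p(2) by auto
  obtain d2 where d2: "d2 > 0" "\<And>t. 0 < t \<Longrightarrow> t < d2 \<Longrightarrow> g (p + t *\<^sub>R (u + (-e) *\<^sub>R n)) < 0"
    using DERIV_neg_dec_right[OF D[of "-e"]] n e p(2) by auto
  obtain d0 where d0: "d0 > 0"
    "\<And>t s. 0 < t \<Longrightarrow> t < d0 \<Longrightarrow> \<bar>s\<bar> \<le> e * t \<Longrightarrow> p + t *\<^sub>R u + s *\<^sub>R n \<in> U"
    using thin_sector_in_open[OF U p(1), of e u n] by blast
  have "\<exists>s. \<bar>s\<bar> \<le> e * t \<and> p + t *\<^sub>R u + s *\<^sub>R n \<in> U \<and> g (p + t *\<^sub>R u + s *\<^sub>R n) = 0"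
    if t: "0 < t" "t < min d0 (min d1 d2)" for t
  proof -
    have "continuous_on {-(e*t)..e*t} (\<lambda>s. g (p + t *\<^sub>R u + s *\<^sub>R n))"
      by (rule continuous_on_compose2[OF smooth_on_continuous_on[OF g]])
        (use d0 t in \<open>auto intro!: continuous_intros\<close>)
    moreover have "g (p + t *\<^sub>R u + (-(e*t)) *\<^sub>R n) \<le> 0" "0 \<le> g (p + t *\<^sub>R u + (e*t) *\<^sub>R n)"
      using d1(2)[of t] d2(2)[of t] t by (simp_all add: algebra_simps)
    ultimately obtain s where "-(e*t) \<le> s" "s \<le> e*t" "g (p + t *\<^sub>R u + s *\<^sub>R n) = 0"
      using IVT'[of "\<lambda>s. g (p + t *\<^sub>R u + s *\<^sub>R n)" "-(e*t)" 0 "e*t"] t e by auto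
    then show ?thesis using d0(2)[of t s] t by (intro exI[of _ s]) auto
  qed
  then show ?thesis using d0(1) d1(1) d2(1) by (intro exI[of _ "min d0 (min d1 d2)"]) auto
qed

lemma local_defining_functionD:
  assumes "local_defining_function S p U g"
  shows "open U" "p \<in> U" "smooth_on U g" "S \<inter> U = {x\<in>U. g x = 0}"
    "\<And>x. x \<in> U \<Longrightarrow> \<exists>v. dird g v x \<noteq> 0"
  using assms unfolding local_defining_function_def by auto

lemma local_defining_function_at:
  "local_defining_function S p U g \<Longrightarrow> q \<in> U \<Longrightarrow> local_defining_function S q U g"
  unfolding local_defining_function_def by blast

lemma positive_normal_direction:
  assumes "smooth_on U g" "p \<in> U" "\<exists>v. dird g v p \<noteq> (0::real)"
  obtains n where "dird g n p > 0"
proof -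
  obtain v where v: "dird g v p \<noteq> 0" using assms(3) by blast
  have "dird g (dird g v p *\<^sub>R v) p > 0"
    using linear_scale[OF dird_linear[OF assms(1,2)]] v by (simp add: not_square_less_zero less_le)
  then show ?thesis by (rule that)
qed

text \<open>Two derivatives of the same map within \<open>S\<close> agree up to \<open>o(\<bar>q - p\<bar>)\<close> on the differences \<open>q - p\<close> with
\<open>q \<in> S\<close>, and every tangent vector is a limit of such directions.\<close>

lemma has_derivative_within_hypersurface_unique:
  assumes g: "local_defining_function S p U g" and p: "p \<in> S" and u: "dird g u p = 0"
    and D: "(f has_derivative D) (at p within S)" and D': "(f has_derivative D') (at p within S)"
  shows "D u = D' u"
proof (rule ccontr)
  note g = local_defining_functionD[OF g]
  define L where "L v = D v - D' v" for v
  assume "D u \<noteq> D' u"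
  then have Lu: "norm (L u) > 0" by (simp add: L_def)
  have "((\<lambda>x. f x - f x) has_derivative L) (at p within S)"
    unfolding L_def by (rule has_derivative_diff[OF D D'])
  then have L: "((\<lambda>x. 0) has_derivative L) (at p within S)" by simp
  then have lin: "linear L" by (rule has_derivative_linear)
  obtain n where n: "dird g n p > 0" by (rule positive_normal_direction[OF g(3,2) g(5)[OF g(2)]])
  define C where "C = norm u + norm n + norm (L n)"
  have C: "C \<ge> 0" by (simp add: C_def)
  \<comment> \<open>The sector of width \<open>e\<close> gives \<open>\<bar>L u\<bar> \<le> e C\<close>, which this \<open>e\<close> makes smaller than \<open>\<bar>L u\<bar>\<close>.\<close>
  define e where "e = min 1 (norm (L u) / (2 * (C + 1)))"
  have e: "e > 0" "e \<le> 1" using Lu C by (auto simp: e_def)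
  obtain d where d: "d > 0" "\<And>q. q \<in> S \<Longrightarrow> norm (q - p) < d \<Longrightarrow> norm (L (q - p)) \<le> e * norm (q - p)"
    using L e(1) unfolding has_derivative_within_alt by fastforce
  have gp: "g p = 0" using p g(2,4) by blast
  obtain d1 where d1: "d1 > 0" "\<And>t. 0 < t \<Longrightarrow> t < d1 \<Longrightarrow>
     \<exists>s. \<bar>s\<bar> \<le> e * t \<and> p + t *\<^sub>R u + s *\<^sub>R n \<in> U \<and> g (p + t *\<^sub>R u + s *\<^sub>R n) = 0"
    using zero_near_tangent[OF g(3,1,2) gp u n e(1)] by blast
  obtain d2 where d2: "d2 > 0"
    "\<And>t s. 0 < t \<Longrightarrow> t < d2 \<Longrightarrow> \<bar>s\<bar> \<le> e * t \<Longrightarrow> p + t *\<^sub>R u + s *\<^sub>R n \<in> ball p d"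
    using thin_sector_in_open[of "ball p d" p e u n] d(1) by auto
  define t where "t = min d1 d2 / 2"
  have t: "0 < t" "t < d1" "t < d2" using d1(1) d2(1) by (auto simp: t_def)
  obtain s where s: "\<bar>s\<bar> \<le> e * t" and q: "p + t *\<^sub>R u + s *\<^sub>R n \<in> U" "g (p + t *\<^sub>R u + s *\<^sub>R n) = 0"
    using d1(2)[OF t(1,2)] by blast
  have qS: "p + t *\<^sub>R u + s *\<^sub>R n \<in> S" using q g(4) by blast
  have eq: "p + t *\<^sub>R u + s *\<^sub>R n - p = t *\<^sub>R u + s *\<^sub>R n" by simp
  have "norm (p + t *\<^sub>R u + s *\<^sub>R n - p) < d"
    using d2(2)[OF t(1,3) s] by (simp add: dist_norm norm_minus_commute add.commute)
  from d(2)[OF qS this] have b: "norm (L (t *\<^sub>R u + s *\<^sub>R n)) \<le> e * norm (t *\<^sub>R u + s *\<^sub>R n)"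
    unfolding eq .
  have "t * norm (L u) = norm (L (t *\<^sub>R u + s *\<^sub>R n) - s *\<^sub>R L n)"
    using linear_add[OF lin] linear_scale[OF lin] t by simp
  also have "\<dots> \<le> norm (L (t *\<^sub>R u + s *\<^sub>R n)) + \<bar>s\<bar> * norm (L n)"
    using norm_triangle_ineq4[of "L (t *\<^sub>R u + s *\<^sub>R n)" "s *\<^sub>R L n"] by simp
  also have "\<dots> \<le> e * (t * norm u + \<bar>s\<bar> * norm n) + \<bar>s\<bar> * norm (L n)"
    using b norm_triangle_ineq[of "t *\<^sub>R u" "s *\<^sub>R n"] t e
    by (smt (verit, best) mult_left_mono norm_scaleR abs_of_pos)
  also have "\<dots> \<le> e * (t * norm u + t * norm n) + (e * t) * norm (L n)"
  proof -
    have "\<bar>s\<bar> \<le> t" using s e t by (smt (verit, best) mult_left_le_one_le)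
    then show ?thesis using s e by (intro add_mono mult_left_mono mult_right_mono) auto
  qed
  also have "\<dots> = t * (e * C)" by (simp add: C_def algebra_simps)
  finally have "norm (L u) \<le> e * C" using t by simp
  also have "\<dots> \<le> norm (L u) / (2 * (C + 1)) * C"
    using C by (intro mult_right_mono) (auto simp: e_def)
  also have "\<dots> < norm (L u)" using C Lu by (simp add: field_simps add_nonneg_pos)
  finally show False by simp
qed

lemma deriv_along_eq:
  assumes "local_defining_function S p U g" "p \<in> S" "dird g u p = 0"
    and "(f has_derivative D) (at p within S)"
  shows "deriv_along S f p u = D u"
  unfolding deriv_along_def
proof (rule the_equality)
  show "\<exists>D'. (f has_derivative D') (at p within S) \<and> D u = D' u" using assms(4) by blast
  show "w = D u" if "\<exists>D. (f has_derivative D) (at p within S) \<and> w = D u" for w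
    using that has_derivative_within_hypersurface_unique[OF assms(1-3) _ assms(4)] by auto
qed

text \<open>The tangent space contains the hyperplane \<open>ker dg\<close>, and by local convexity it is itself a hyperplane; hence
the two coincide.\<close>

lemma tangent_space_eq_kernel:
  assumes S: "locally_convex_hypersurface S" and p: "p \<in> S" and g: "local_defining_function S p U g"
  shows "tangent_space S p = {v. dird g v p = 0}"
proof
  show ker: "{v. dird g v p = 0} \<subseteq> tangent_space S p"
    unfolding tangent_space_def
  proof
    fix v assume "v \<in> {v. dird g v p = 0}"
    with g show "v \<in> {v. \<exists>U g. local_defining_function S p U g \<and> dird g v p = 0}"
      by (intro CollectI exI[of _ U] exI[of _ g]) simp
  qed
  obtain n where n: "n \<noteq> 0" "tangent_space S p = {v. n \<bullet> v = 0}"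
    using S p unfolding locally_convex_hypersurface_def by blast
  obtain v0 where v0: "dird g v0 p \<noteq> 0" using local_defining_functionD(5,2)[OF g] by blast
  have eq: "n \<bullet> v = (n \<bullet> v0) / dird g v0 p * dird g v p" for v
    by (rule linear_kernel_subset[OF dird_linear[OF local_defining_functionD(3,2)[OF g]], of "(\<bullet>) n"])
      (use ker n v0 in \<open>auto intro: bounded_linear.linear bounded_linear_inner_right\<close>)
  have "n \<bullet> n \<noteq> 0" using n(1) by simp
  then have nv0: "n \<bullet> v0 \<noteq> 0" using eq[of n] by auto
  show "tangent_space S p \<subseteq> {v. dird g v p = 0}"
  proof
    fix v assume "v \<in> tangent_space S p"
    then have "(n \<bullet> v0) / dird g v0 p * dird g v p = 0" unfolding n(2) using eq[of v] by simp
    then show "v \<in> {v. dird g v p = 0}" using nv0 v0 by simp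
  qed
qed

section \<open>Affine metric and conormal from a defining function\<close>

lemma smooth_along_has_derivative:
  assumes "smooth_along (S \<inter> V) Y" "open V" "p \<in> S \<inter> V"
  shows "\<exists>D. (Y has_derivative D) (at p within S)"
proof -
  obtain U f where U: "open U" "p \<in> U" "smooth_on U f" "\<And>x. x \<in> S \<inter> V \<inter> U \<Longrightarrow> f x = Y x"
    using assms(1)[unfolded smooth_along_def, rule_format, OF assms(3)] by metis
  obtain d where d: "d > 0" "ball p d \<subseteq> U \<inter> V"
    using assms(2,3) U(1,2) openE[of "U \<inter> V" p] by blast
  have "(f has_derivative (\<lambda>v. dird f v p)) (at p within S)"
    by (rule has_derivative_at_withinI[OF smooth_on_has_derivative[OF U(3,2)]])
  then have "(Y has_derivative (\<lambda>v. dird f v p)) (at p within S)"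
    by (rule has_derivative_transform_within[OF _ d(1)])
      (use assms(3) U(4) d(2) in \<open>auto simp: dist_commute subset_iff\<close>)
  then show ?thesis by blast
qed

text \<open>Differentiate \<open>dg(Y) = 0\<close>, which holds along \<open>S\<close>.\<close>

lemma tangent_field_second_form:
  assumes g: "local_defining_function S p U g" and p: "p \<in> S"
    and T: "\<And>q. q \<in> S \<inter> U \<Longrightarrow> tangent_space S q = {v. dird g v q = 0}"
    and u: "dird g u p = 0"
    and V: "open V" "p \<in> V" and Y: "smooth_along (S \<inter> V) Y" "\<And>q. q \<in> S \<inter> V \<Longrightarrow> Y q \<in> tangent_space S q"
  shows "dird g (deriv_along S Y p u) p = - dird (dird g (Y p)) u p"
proof -
  note gD = local_defining_functionD[OF g]
  obtain D where D: "(Y has_derivative D) (at p within S)"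
    using smooth_along_has_derivative[OF Y(1) V(1)] p V(2) by blast
  have 1: "((\<lambda>q. dird g (Y q) q) has_derivative
      (\<lambda>h. dird (dird g (Y p)) h p + dird g (D h) p)) (at p within S)"
    by (rule has_derivative_dird[OF gD(3,1,2) p has_derivative_ident D])
  obtain d where d: "d > 0" "ball p d \<subseteq> U \<inter> V"
    using V gD(1,2) openE[of "U \<inter> V" p] by blast
  have zero: "0 = dird g (Y q) q" if "q \<in> S" "dist q p < d" for q
    using Y(2)[of q] T[of q] that d(2) by (auto simp: dist_commute subset_iff)
  have 2: "((\<lambda>q. dird g (Y q) q) has_derivative (\<lambda>h. 0)) (at p within S)"
    by (rule has_derivative_transform_within[OF has_derivative_const d(1) p zero])
  have "dird (dird g (Y p)) u p + dird g (D u) p = 0"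
    using has_derivative_within_hypersurface_unique[OF g p u 1 2] .
  then show ?thesis using deriv_along_eq[OF g p u D] by simp
qed

text \<open>By \<open>tangent_field_second_form\<close> the component along \<open>\<xi>\<close> is the same for all tangent fields \<open>Y\<close> with
\<open>Y p = w\<close>. Such a field exists: from constant vectors \<open>w\<close> and \<open>k = \<xi> p\<close> form \<open>dg(k) w - dg(w) k\<close>, which
is annihilated by \<open>dg\<close> at every point and is a multiple of \<open>w\<close> at \<open>p\<close>.\<close>

lemma affine_metric_eq:
  assumes g: "local_defining_function S p U g" and p: "p \<in> S"
    and T: "\<And>q. q \<in> S \<inter> U \<Longrightarrow> tangent_space S q = {v. dird g v q = 0}"
    and \<xi>: "dird g (\<xi> p) p \<noteq> 0"
    and u: "dird g u p = 0" and w: "dird g w p = 0"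
  shows "affine_metric S \<xi> p u w = - dird (dird g w) u p / dird g (\<xi> p) p"
  unfolding affine_metric_def
proof (rule the_equality)
  note gD = local_defining_functionD[OF g]
  have lin: "linear (\<lambda>v. dird g v q)" if "q \<in> U" for q by (rule dird_linear[OF gD(3) that])
  have Tp: "tangent_space S p = {v. dird g v p = 0}" using T p gD(2) by blast
  define m where "m = dird g (\<xi> p) p"
  define r where "r = - dird (dird g w) u p / m"
  define Y where "Y q = (1/m) *\<^sub>R (dird g (\<xi> p) q *\<^sub>R w + (-1) *\<^sub>R (dird g w q *\<^sub>R \<xi> p))" for q
  have Ysm: "smooth_on U Y"
    unfolding smooth_on_def Y_def
    using smooth_on_dird[OF gD(3)] gD(1) unfolding smooth_on_def
    by (intro allI Ck_on_scaleR Ck_on_add Ck_on_const) auto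
  have Yp: "Y p = w" using w \<xi> by (simp add: Y_def m_def)
  have Yt: "Y q \<in> tangent_space S q" if "q \<in> S \<inter> U" for q
  proof -
    have q: "q \<in> U" using that by blast
    have "dird g (Y q) q = 0"
      unfolding Y_def using linear_diff[OF lin[OF q]] linear_scale[OF lin[OF q]] by simp
    then show ?thesis using T[OF that] by blast
  qed
  have val: "dird g (deriv_along S Y' p u - r' *\<^sub>R \<xi> p) p = (r - r') * m"
    if "open V" "p \<in> V" "smooth_along (S \<inter> V) Y'" "\<forall>q\<in>S \<inter> V. Y' q \<in> tangent_space S q" "Y' p = w" for V Y' r'
  proof -
    have "dird g (deriv_along S Y' p u) p = - dird (dird g w) u p"
      using tangent_field_second_form[OF g p T u that(1,2,3)] that(4,5) by blast
    moreover have "dird g (deriv_along S Y' p u - r' *\<^sub>R \<xi> p) p = dird g (deriv_along S Y' p u) p - r' * m"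
      using linear_diff[OF lin[OF gD(2)], of "deriv_along S Y' p u" "r' *\<^sub>R \<xi> p"]
        linear_scale[OF lin[OF gD(2)], of r' "\<xi> p"] unfolding m_def by simp
    moreover have "r * m = - dird (dird g w) u p" using \<xi> unfolding r_def m_def by simp
    ultimately show ?thesis by (simp add: left_diff_distrib)
  qed
  have sa: "smooth_along (S \<inter> U) Y" unfolding smooth_along_def using gD(1) Ysm by blast
  show "\<exists>V Y. open V \<and> p \<in> V \<and> smooth_along (S \<inter> V) Y \<and> (\<forall>q\<in>S \<inter> V. Y q \<in> tangent_space S q) \<and>
      Y p = w \<and> deriv_along S Y p u - (- dird (dird g w) u p / dird g (\<xi> p) p) *\<^sub>R \<xi> p \<in> tangent_space S p"
    using val[OF gD(1,2) sa _ Yp, of r] Yt Tp gD(1,2) sa Yp unfolding r_def m_def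
    by (intro exI[of _ U] exI[of _ Y]) auto
  fix r'
  assume "\<exists>V Y. open V \<and> p \<in> V \<and> smooth_along (S \<inter> V) Y \<and> (\<forall>q\<in>S \<inter> V. Y q \<in> tangent_space S q) \<and>
      Y p = w \<and> deriv_along S Y p u - r' *\<^sub>R \<xi> p \<in> tangent_space S p"
  then obtain V Y' where "open V" "p \<in> V" "smooth_along (S \<inter> V) Y'"
    "\<forall>q\<in>S \<inter> V. Y' q \<in> tangent_space S q" "Y' p = w" "deriv_along S Y' p u - r' *\<^sub>R \<xi> p \<in> tangent_space S p"
    by blast
  from val[OF this(1-5), of r'] this(6) have "(r - r') * m = 0" using Tp by auto
  then show "r' = - dird (dird g w) u p / dird g (\<xi> p) p" using \<xi> by (simp add: r_def m_def)
qed

lemma conormal_eq: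
  fixes S :: "(real^'n) set" and g :: "real^'n \<Rightarrow> real"
  assumes lin: "linear (\<lambda>v. dird g v p)" and T: "tangent_space S p = {v. dird g v p = 0}"
    and \<xi>: "dird g (\<xi> p) p \<noteq> 0"
  shows "conormal S \<xi> p = (\<lambda>v. dird g v p / dird g (\<xi> p) p)"
  unfolding conormal_def
proof (rule the_equality)
  show "linear (\<lambda>v. dird g v p / dird g (\<xi> p) p) \<and> dird g (\<xi> p) p / dird g (\<xi> p) p = 1 \<and>
     (\<forall>v\<in>tangent_space S p. dird g v p / dird g (\<xi> p) p = 0)"
    using \<xi> T linear_compose_scale_right[OF lin, of "1 / dird g (\<xi> p) p"] by auto
  fix \<nu> :: "real^'n \<Rightarrow> real"
  assume "linear \<nu> \<and> \<nu> (\<xi> p) = 1 \<and> (\<forall>v\<in>tangent_space S p. \<nu> v = 0)"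
  then show "\<nu> = (\<lambda>v. dird g v p / dird g (\<xi> p) p)"
    using linear_kernel_subset[OF lin, of \<nu> "\<xi> p"] T \<xi> by auto
qed

section \<open>Definiteness of the second fundamental form\<close>

text \<open>Up to the sign of \<open>\<sigma>\<close>, the function is positive at \<open>p + t u\<close> and negative at \<open>p + t (u - n)\<close>, so the
hypersurface passes the tangent ray strictly on the side of \<open>- n\<close>.\<close>

lemma zero_below_convex_line:
  fixes g :: "'a::real_normed_vector \<Rightarrow> real"
  assumes g: "smooth_on U g" and U: "open U" and p: "p \<in> U" "g p = 0"
    and u: "dird g u p = 0" and n: "\<sigma> * dird g n p > 0" and uu: "\<sigma> * dird (dird g u) u p > 0"
  shows "\<exists>\<delta>>0. \<forall>t. 0 < t \<longrightarrow> t < \<delta> \<longrightarrow>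
     (\<exists>s. s < 0 \<and> \<bar>s\<bar> \<le> t \<and> p + t *\<^sub>R u + s *\<^sub>R n \<in> U \<and> g (p + t *\<^sub>R u + s *\<^sub>R n) = 0)"
proof -
  have \<sigma>: "\<sigma> \<noteq> 0" using n by auto
  have lin: "linear (\<lambda>v. dird g v p)" by (rule dird_linear[OF g p(1)])
  obtain d0 where d0: "d0 > 0"
    "\<And>t s. 0 < t \<Longrightarrow> t < d0 \<Longrightarrow> \<bar>s\<bar> \<le> t \<Longrightarrow> p + t *\<^sub>R u + s *\<^sub>R n \<in> U"
    using thin_sector_in_open[OF U p(1), of 1 u n] by auto
  have line: "p + t *\<^sub>R u \<in> U" if "0 \<le> t" "t < d0" for t
    using d0(2)[of t 0] that p(1) by (cases "t = 0") auto
  have "((\<lambda>t. \<sigma> * dird g u (p + t *\<^sub>R u)) has_real_derivative \<sigma> * dird (dird g u) u p) (at 0)"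
    using DERIV_cmult[OF dird_line_real[OF smooth_on_dird[OF g], of p 0 u], of \<sigma>] p(1) by simp
  from DERIV_pos_inc_right[OF this uu] obtain d1 where d1: "d1 > 0"
    "\<And>t. 0 < t \<Longrightarrow> t < d1 \<Longrightarrow> \<sigma> * dird g u (p + t *\<^sub>R u) > 0"
    using u by auto
  have pos: "\<sigma> * g (p + t *\<^sub>R u) > 0" if t: "0 < t" "t < min d0 d1" for t
  proof -
    have "((\<lambda>s. \<sigma> * g (p + s *\<^sub>R u)) has_real_derivative \<sigma> * dird g u (p + s *\<^sub>R u)) (at s)"
      if "0 \<le> s" "s \<le> t" for s
      by (rule DERIV_cmult[OF dird_line_real[OF g]]) (use line that t in auto)
    from MVT2[OF t(1) this] obtain s where "0 < s" "s < t"
      "\<sigma> * g (p + t *\<^sub>R u) - \<sigma> * g (p + 0 *\<^sub>R u) = (t - 0) * (\<sigma> * dird g u (p + s *\<^sub>R u))"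
      by blast
    with p(2) have eq: "\<sigma> * g (p + t *\<^sub>R u) = t * (\<sigma> * dird g u (p + s *\<^sub>R u))"
      by (simp only: scaleR_zero_left add_0_right mult_zero_right diff_zero)
    have "0 < t * (\<sigma> * dird g u (p + s *\<^sub>R u))"
      by (rule mult_pos_pos[OF t(1) d1(2)]) (use t \<open>0 < s\<close> \<open>s < t\<close> in auto)
    then show ?thesis unfolding eq .
  qed
  have "dird g (u - n) p = - dird g n p"
    using linear_diff[OF lin] u by simp
  then have "((\<lambda>t. \<sigma> * g (p + t *\<^sub>R (u - n))) has_real_derivative - (\<sigma> * dird g n p)) (at 0)"
    using DERIV_cmult[OF dird_line_real[OF g, of p 0 "u - n"], of \<sigma>] p(1) by simp
  from DERIV_neg_dec_right[OF this] n obtain d2 where d2: "d2 > 0"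
    "\<And>t. 0 < t \<Longrightarrow> t < d2 \<Longrightarrow> \<sigma> * g (p + t *\<^sub>R (u - n)) < 0"
    using p(2) by auto
  have "\<exists>s. s < 0 \<and> \<bar>s\<bar> \<le> t \<and> p + t *\<^sub>R u + s *\<^sub>R n \<in> U \<and> g (p + t *\<^sub>R u + s *\<^sub>R n) = 0"
    if t: "0 < t" "t < min d0 (min d1 d2)" for t
  proof -
    have "continuous_on {-t..0} (\<lambda>s. \<sigma> * g (p + t *\<^sub>R u + s *\<^sub>R n))"
      by (intro continuous_on_mult_left continuous_on_compose2[OF smooth_on_continuous_on[OF g]])
        (use d0 t in \<open>auto intro!: continuous_intros\<close>)
    moreover have "\<sigma> * g (p + t *\<^sub>R u + (-t) *\<^sub>R n) \<le> 0" "0 \<le> \<sigma> * g (p + t *\<^sub>R u + 0 *\<^sub>R n)"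
      using pos[of t] d2(2)[of t] t by (simp_all add: algebra_simps)
    ultimately obtain s where s: "-t \<le> s" "s \<le> 0" "\<sigma> * g (p + t *\<^sub>R u + s *\<^sub>R n) = 0"
      using IVT'[of "\<lambda>s. \<sigma> * g (p + t *\<^sub>R u + s *\<^sub>R n)" "-t" 0 0] t by auto
    moreover have "s \<noteq> 0" using pos[of t] s(3) t by auto
    ultimately show ?thesis using d0(2)[of t s] t \<sigma> by (intro exI[of _ s]) auto
  qed
  then show ?thesis using d0(1) d1(1) d2(1) by (intro exI[of _ "min d0 (min d1 d2)"]) auto
qed

text \<open>Otherwise \<open>zero_below_convex_line\<close> would produce points of \<open>S\<close> on the wrong side of the tangent hyperplane.\<close>

lemma second_form_semidefinite:
  assumes S: "locally_convex_hypersurface S" and p: "p \<in> S" and g: "local_defining_function S p U g"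
  obtains \<sigma> :: real where "\<sigma> \<noteq> 0" "\<forall>u. dird g u p = 0 \<longrightarrow> \<sigma> * dird (dird g u) u p \<le> 0"
proof -
  note gD = local_defining_functionD[OF g]
  have gp: "g p = 0" using p gD(2,4) by blast
  have lin: "linear (\<lambda>v. dird g v p)" by (rule dird_linear[OF gD(3,2)])
  obtain V n where V: "open V" "p \<in> V" and n: "n \<noteq> 0" "tangent_space S p = {v. n \<bullet> v = 0}"
    and side: "\<And>q. q \<in> S \<inter> V \<Longrightarrow> n \<bullet> (q - p) \<ge> 0"
    using S p unfolding locally_convex_hypersurface_def by metis
  have ker: "n \<bullet> v = 0 \<longleftrightarrow> dird g v p = 0" for v
    using n(2) tangent_space_eq_kernel[OF S p g] by blast
  define \<sigma> where "\<sigma> = dird g n p"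
  have \<sigma>: "\<sigma> \<noteq> 0" using ker[of n] n(1) by (simp add: \<sigma>_def)
  have "\<sigma> * dird (dird g u) u p \<le> 0" if u: "dird g u p = 0" for u
  proof (rule ccontr)
    assume "\<not> ?thesis"
    then have uu: "\<sigma> * dird (dird g u) u p > 0" by simp
    have nn: "\<sigma> * dird g n p > 0" using \<sigma> unfolding \<sigma>_def by (simp add: less_le)
    obtain d1 where d1: "d1 > 0" "\<And>t. 0 < t \<Longrightarrow> t < d1 \<Longrightarrow>
       \<exists>s. s < 0 \<and> \<bar>s\<bar> \<le> t \<and> p + t *\<^sub>R u + s *\<^sub>R n \<in> U \<and> g (p + t *\<^sub>R u + s *\<^sub>R n) = 0"
      using zero_below_convex_line[OF gD(3,1,2) gp u nn uu] by blast
    obtain d2 where d2: "d2 > 0"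
      "\<And>t s. 0 < t \<Longrightarrow> t < d2 \<Longrightarrow> \<bar>s\<bar> \<le> t \<Longrightarrow> p + t *\<^sub>R u + s *\<^sub>R n \<in> V"
      using thin_sector_in_open[OF V, of 1 u n] by auto
    define t where "t = min d1 d2 / 2"
    have t: "0 < t" "t < d1" "t < d2" using d1(1) d2(1) by (auto simp: t_def)
    obtain s where s: "s < 0" "\<bar>s\<bar> \<le> t" and q: "p + t *\<^sub>R u + s *\<^sub>R n \<in> U" "g (p + t *\<^sub>R u + s *\<^sub>R n) = 0"
      using d1(2)[OF t(1,2)] by blast
    have "p + t *\<^sub>R u + s *\<^sub>R n \<in> S \<inter> V" using q gD(4) d2(2)[OF t(1,3) s(2)] by blast
    from side[OF this] have "n \<bullet> (t *\<^sub>R u + s *\<^sub>R n) \<ge> 0" by (simp add: add.assoc)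
    then have "s * (n \<bullet> n) \<ge> 0" using ker[of u] u by (simp add: inner_right_distrib)
    then show False using mult_neg_pos[OF s(1), of "n \<bullet> n"] n(1) by simp
  qed
  with \<sigma> show ?thesis by (intro that) auto
qed

text \<open>The Cauchy-Schwarz argument: if \<open>B(u, w) \<noteq> 0\<close>, the value at \<open>t u + w\<close> is a non-constant affine function of \<open>t\<close>,
and \<open>t\<close> can be chosen so that it has the forbidden sign.\<close>

lemma semidefinite_form_kernel:
  fixes B :: "'a::real_vector \<Rightarrow> 'a \<Rightarrow> real"
  assumes "bilinear B" "\<And>u w. B u w = B w u" "subspace T" "\<sigma> \<noteq> 0"
    and sd: "\<And>u. u \<in> T \<Longrightarrow> \<sigma> * B u u \<le> 0" and u: "u \<in> T" "B u u = 0" and w: "w \<in> T"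
  shows "B u w = 0"
proof (rule ccontr)
  assume ne: "B u w \<noteq> 0"
  \<comment> \<open>Chosen so that \<open>\<sigma> B\<close> takes the value \<open>1\<close> at \<open>t u + w\<close>.\<close>
  define t where "t = (1 - \<sigma> * B w w) / (2 * \<sigma> * B u w)"
  have "B (t *\<^sub>R u + w) (t *\<^sub>R u + w) = t * t * B u u + t * B u w + t * B w u + B w w"
    using assms(1) by (simp add: bilinear_ladd bilinear_radd bilinear_lmul bilinear_rmul algebra_simps)
  then have "\<sigma> * B (t *\<^sub>R u + w) (t *\<^sub>R u + w) = 2 * \<sigma> * B u w * t + \<sigma> * B w w"
    using u(2) assms(2)[of w u] by (simp add: algebra_simps)
  also have "\<dots> = 1" unfolding t_def using ne assms(4) by simp
  finally show False
    using sd[of "t *\<^sub>R u + w"] assms(3) u(1) w by (simp add: subspace_add subspace_scale)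
qed

lemma second_form_bilinear:
  fixes g :: "'a::real_normed_vector \<Rightarrow> real"
  assumes "smooth_on U g" "open U" "p \<in> U"
  shows "bilinear (\<lambda>u w. dird (dird g w) u p)"
  unfolding bilinear_def
  using dird_linear[OF smooth_on_dird[OF assms(1)] assms(3)] second_derivative_symmetric[OF assms]
  by (metis (no_types, lifting) ext)

text \<open>An isotropic vector of a semidefinite form lies in its kernel, and non-degeneracy makes the kernel trivial.\<close>

lemma second_form_definite:
  assumes S: "locally_convex_hypersurface S" and nd: "nondegenerate_hypersurface S \<xi>"
    and p: "p \<in> S" and g: "local_defining_function S p U g" and \<xi>: "dird g (\<xi> p) p \<noteq> 0"
    and u: "dird g u p = 0" "dird (dird g u) u p = 0"
  shows "u = 0"
proof -
  note gD = local_defining_functionD[OF g]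
  have T: "tangent_space S q = {v. dird g v q = 0}" if "q \<in> S \<inter> U" for q
    by (rule tangent_space_eq_kernel[OF S _ local_defining_function_at[OF g]]) (use that in auto)
  have lin: "linear (\<lambda>v. dird g v p)" by (rule dird_linear[OF gD(3,2)])
  have sub: "subspace {v. dird g v p = 0}" using lin by (rule linear_subspace_kernel)
  obtain \<sigma> :: real where \<sigma>: "\<sigma> \<noteq> 0" "\<forall>u. dird g u p = 0 \<longrightarrow> \<sigma> * dird (dird g u) u p \<le> 0"
    by (rule second_form_semidefinite[OF S p g])
  have "affine_metric S \<xi> p u w = 0" if w: "w \<in> tangent_space S p" for w
  proof -
    have w: "dird g w p = 0" using w T p gD(2) by blast
    have "dird (dird g w) u p = 0"
      using semidefinite_form_kernel[OF second_form_bilinear[OF gD(3,1,2)]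
        second_derivative_symmetric[OF gD(3,1,2)] sub \<sigma>(1), of u w] \<sigma>(2) u w by simp
    then show ?thesis using affine_metric_eq[OF g p T, of \<xi> u w] \<xi> u(1) w by simp
  qed
  then show ?thesis
    using nd p T[of p] gD(2) u(1) unfolding nondegenerate_hypersurface_def by auto
qed

section \<open>Contact of a curve with a hypersurface\<close>

lemma dird_real_cong:
  assumes "\<And>s. \<bar>s - t\<bar> < d \<Longrightarrow> f s = h s" "d > (0::real)"
  shows "dird f v t = dird h v t"
proof -
  have "frechet_derivative f (at t) = frechet_derivative h (at t)"
    by (rule frechet_derivative_cong_open[of "ball t d"])
      (use assms in \<open>auto simp: dist_real_def abs_minus_commute\<close>)
  then show ?thesis by simp
qed

text \<open>The value and the first two derivatives of \<open>g \<circ> c\<close> at \<open>0\<close>: this is how contact of order at least 3 enters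
the proof.\<close>

lemma smooth_curve_contact_iff:
  fixes c :: "real \<Rightarrow> 'a::euclidean_space" and g :: "'a \<Rightarrow> real"
  assumes g: "smooth_on U g" and U: "open U" "c 0 \<in> U"
    and c: "smooth_on {-\<epsilon><..<\<epsilon>} c" and \<epsilon>: "\<epsilon> > 0"
  shows "(\<lambda>t. g (c t)) \<in> O[at 0](\<lambda>t. t ^ 3) \<longleftrightarrow>
     g (c 0) = 0 \<and> dird g (dird c 1 0) (c 0) = 0 \<and>
     dird (dird g (dird c 1 0)) (dird c 1 0) (c 0) + dird g (dird (dird c 1) 1 0) (c 0) = 0"
proof -
  have c0: "(c has_derivative (\<lambda>v. dird c v 0)) (at 0)"
    by (rule smooth_on_has_derivative[OF c]) (use \<epsilon> in auto)
  have "\<forall>\<^sub>F t in at 0. c t \<in> U"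
    using has_derivative_continuous[OF c0] U unfolding continuous_within tendsto_def by blast
  then obtain d where d: "d > 0" "\<And>t. t \<noteq> 0 \<Longrightarrow> dist t 0 < d \<Longrightarrow> c t \<in> U"
    unfolding eventually_at by auto
  define r where "r = min d \<epsilon>"
  have r: "r > 0" using d(1) \<epsilon> by (simp add: r_def)
  have cU: "c t \<in> U" if "t \<in> {-r<..<r}" for t
    using d(2)[of t] that U(2) by (cases "t = 0") (auto simp: r_def)
  have cr: "smooth_on {-r<..<r} c" by (rule smooth_on_subset[OF c]) (auto simp: r_def)
  define h where "h t = g (c t)" for t
  have sm: "smooth_on {-r<..<r} h"
    unfolding h_def by (rule smooth_on_compose[OF _ g cr]) (use cU in auto)
  have h1: "dird h 1 t = dird g (dird c 1 t) (c t)" if t: "t \<in> {-r<..<r}" for t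
  proof -
    have "(h has_derivative (\<lambda>s. dird g (dird c s t) (c t))) (at t)"
      unfolding h_def
      by (rule has_derivative_compose[OF smooth_on_has_derivative[OF cr t] smooth_on_has_derivative[OF g cU[OF t]]])
    from fun_cong[OF frechet_derivative_at[OF this], of 1] show ?thesis by simp
  qed
  have "dird (dird h 1) 1 0 = dird (\<lambda>t. dird g (dird c 1 t) (c t)) 1 0"
    by (rule dird_real_cong[OF _ r]) (rule h1, auto)
  also have "\<dots> = dird (dird g (dird c 1 0)) (dird c 1 0) (c 0) + dird g (dird (dird c 1) 1 0) (c 0)"
  proof -
    have r0: "0 \<in> {-r<..<r}" using r by auto
    have "((\<lambda>t. dird g (dird c 1 t) (c t)) has_derivative
        (\<lambda>s. dird (dird g (dird c 1 0)) (dird c s 0) (c 0) + dird g (dird (dird c 1) s 0) (c 0))) (at 0)"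
      by (rule has_derivative_dird[OF g U(1) cU[OF r0] UNIV_I c0
            smooth_on_has_derivative[OF smooth_on_dird[OF cr] r0]])
    from fun_cong[OF frechet_derivative_at[OF this], of 1] show ?thesis by simp
  qed
  finally have h2: "dird (dird h 1) 1 0 = dird (dird g (dird c 1 0)) (dird c 1 0) (c 0) + dird g (dird (dird c 1) 1 0) (c 0)" .
  have heq: "(\<lambda>t. g (c t)) = h" by (simp add: h_def fun_eq_iff)
  show ?thesis
    unfolding heq h2[symmetric] using smooth_bigo_cubic_iff[OF sm r] h1[of 0] r by (simp add: h_def)
qed

section \<open>Derivative of the mid-hyperplane function\<close>

lemma transversal_field_nonzero:
  assumes "transversal_field S \<xi>" "q \<in> S" "tangent_space S q = {v. dird g v q = 0}"
  shows "dird g (\<xi> q) q \<noteq> 0"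
  using assms unfolding transversal_field_def by blast

lemma conormal_linear:
  assumes S: "locally_convex_hypersurface S" and \<xi>: "transversal_field S \<xi>" and p: "p \<in> S"
  shows "linear (conormal S \<xi> p)"
proof -
  obtain U g where g: "local_defining_function S p U g"
    using S p unfolding locally_convex_hypersurface_def hypersurface_def by blast
  note T = tangent_space_eq_kernel[OF S p g]
  note lin = dird_linear[OF local_defining_functionD(3,2)[OF g]]
  show ?thesis
    unfolding conormal_eq[of g p S \<xi>, OF lin T transversal_field_nonzero[OF \<xi> p T]]
    using linear_compose_scale_right[OF lin, of "1 / dird g (\<xi> p) p"] by simp
qed

text \<open>With \<open>\<beta>\<close> the conormal of the other hypersurface at the fixed point \<open>P\<close>, \<open>f\<close> is the mid-hyperplane function. Near
\<open>p\<close> it is \<open>G / m\<close>, where \<open>G\<close> is built from \<open>dg\<close> instead of the conormal and \<open>m = dg(\<xi>)\<close>. As \<open>G\<close> vanishes at \<open>p\<close>,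
the derivative of \<open>m\<close> contributes nothing.\<close>

lemma deriv_along_mid_hyperplane:
  fixes S :: "(real^'n) set" and P X p :: "real^'n" and \<beta> :: "real^'n \<Rightarrow> real"
  defines "C \<equiv> \<lambda>q. (1/2) *\<^sub>R (q - P)" and "E \<equiv> \<lambda>q. X - (1/2) *\<^sub>R (q + P)"
  assumes S: "locally_convex_hypersurface S" and \<xi>: "transversal_field S \<xi>" and p: "p \<in> S"
    and g: "local_defining_function S p U g"
    and \<beta>: "linear \<beta>"
    and f: "\<And>q. q \<in> S \<Longrightarrow> f q = \<beta> (C q) * conormal S \<xi> q (E q) + conormal S \<xi> q (C q) * \<beta> (E q)"
    and f0: "f p = 0" and u: "dird g u p = 0"
  shows "deriv_along S f p u =
    (dird (dird g (\<beta> (C p) *\<^sub>R E p + \<beta> (E p) *\<^sub>R C p)) u p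
      + \<beta> u * (dird g (E p) p - dird g (C p) p) / 2) / dird g (\<xi> p) p"
proof -
  note gD = local_defining_functionD[OF g]
  have T: "tangent_space S q = {v. dird g v q = 0}" if "q \<in> S \<inter> U" for q
    by (rule tangent_space_eq_kernel[OF S _ local_defining_function_at[OF g]]) (use that in auto)
  have lin: "linear (\<lambda>v. dird g v q)" if "q \<in> U" for q by (rule dird_linear[OF gD(3) that])
  define m where "m q = dird g (\<xi> q) q" for q
  have m: "m q \<noteq> 0" if "q \<in> S \<inter> U" for q
    unfolding m_def by (rule transversal_field_nonzero[OF \<xi> _ T]) (use that in auto)
  define G where "G q = \<beta> (C q) * dird g (E q) q + dird g (C q) q * \<beta> (E q)" for q
  have fG: "f q = G q / m q" if "q \<in> S \<inter> U" for q
  proof -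
    have "conormal S \<xi> q = (\<lambda>v. dird g v q / m q)"
      unfolding m_def
      by (rule conormal_eq[OF lin T]) (use that m[OF that] in \<open>auto simp: m_def\<close>)
    then show ?thesis using f[of q] that by (simp add: G_def add_divide_distrib)
  qed
  have pSU: "p \<in> S \<inter> U" using p gD(2) by blast
  have G0: "G p = 0" using fG[OF pSU] f0 m[OF pSU] by simp
  have dC: "(C has_derivative (\<lambda>h. (1/2) *\<^sub>R h)) (at p within S)"
    unfolding C_def by (auto intro!: derivative_eq_intros)
  have dE: "(E has_derivative (\<lambda>h. - ((1/2) *\<^sub>R h))) (at p within S)"
    unfolding E_def by (auto intro!: derivative_eq_intros)
  have bl: "bounded_linear \<beta>" using \<beta> by (simp add: linear_conv_bounded_linear)
  have dG: "(G has_derivative (\<lambda>h. \<beta> (C p) * (dird (dird g (E p)) h p + dird g (- ((1/2) *\<^sub>R h)) p)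
       + \<beta> ((1/2) *\<^sub>R h) * dird g (E p) p
       + (dird g (C p) p * \<beta> (- ((1/2) *\<^sub>R h)) + (dird (dird g (C p)) h p + dird g ((1/2) *\<^sub>R h) p) * \<beta> (E p))))
       (at p within S)"
    unfolding G_def
    by (intro has_derivative_add has_derivative_mult bounded_linear.has_derivative[OF bl] dC dE
        has_derivative_dird[OF gD(3,1,2) p has_derivative_ident dE]
        has_derivative_dird[OF gD(3,1,2) p has_derivative_ident dC])
  have "smooth_along (S \<inter> UNIV) \<xi>" using \<xi> unfolding transversal_field_def by simp
  then obtain D where D: "(\<xi> has_derivative D) (at p within S)"
    using smooth_along_has_derivative[of S UNIV \<xi> p] p by auto
  obtain m' where dm: "(m has_derivative m') (at p within S)"
    using has_derivative_dird[OF gD(3,1,2) p has_derivative_ident D] unfolding m_def by blast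
  have d: "((\<lambda>q. G q / m q) has_derivative (\<lambda>h. ((\<beta> (C p) * (dird (dird g (E p)) h p + dird g (- ((1/2) *\<^sub>R h)) p)
       + \<beta> ((1/2) *\<^sub>R h) * dird g (E p) p
       + (dird g (C p) p * \<beta> (- ((1/2) *\<^sub>R h)) + (dird (dird g (C p)) h p + dird g ((1/2) *\<^sub>R h) p) * \<beta> (E p)))
       * m p - G p * m' h) / (m p * m p))) (at p within S)"
    by (rule has_derivative_divide'[OF dG dm m[OF pSU]])
  obtain e where e: "e > 0" "ball p e \<subseteq> U" using gD(1,2) openE by blast
  have "(f has_derivative (\<lambda>h. ((\<beta> (C p) * (dird (dird g (E p)) h p + dird g (- ((1/2) *\<^sub>R h)) p)
       + \<beta> ((1/2) *\<^sub>R h) * dird g (E p) p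
       + (dird g (C p) p * \<beta> (- ((1/2) *\<^sub>R h)) + (dird (dird g (C p)) h p + dird g ((1/2) *\<^sub>R h) p) * \<beta> (E p)))
       * m p - G p * m' h) / (m p * m p))) (at p within S)"
    by (rule has_derivative_transform_within[OF d e(1) p])
      (rule fG[symmetric], use e(2) in \<open>auto simp: dist_commute subset_iff\<close>)
  note df = deriv_along_eq[OF g p u this]
  have g_neg: "dird g (- ((1/2) *\<^sub>R u)) p = 0" and g_pos: "dird g ((1/2) *\<^sub>R u) p = 0"
    using linear_neg[OF lin[OF gD(2)]] linear_scale[OF lin[OF gD(2)]] u by simp_all
  have b_neg: "\<beta> (- ((1/2) *\<^sub>R u)) = - \<beta> u / 2" and b_pos: "\<beta> ((1/2) *\<^sub>R u) = \<beta> u / 2"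
    using linear_neg[OF \<beta>] linear_scale[OF \<beta>] by simp_all
  note bil = second_form_bilinear[OF gD(3,1,2)]
  have B: "dird (dird g (\<beta> (C p) *\<^sub>R E p + \<beta> (E p) *\<^sub>R C p)) u p
      = \<beta> (C p) * dird (dird g (E p)) u p + \<beta> (E p) * dird (dird g (C p)) u p"
    using bilinear_radd[OF bil] bilinear_rmul[OF bil] by simp
  show ?thesis
    unfolding df g_neg g_pos b_neg b_pos B G0 m_def[of p, symmetric] using m[OF pSU]
    by (simp add: field_simps)
qed

section \<open>Algebra of the envelope equations\<close>

text \<open>The vector \<open>Z = n\<^sub>2(C) E + n\<^sub>2(E) C\<close> is tangent to the first hypersurface. If it is nonzero, the first equation at
\<open>u = Z\<close> reads \<open>B\<^sub>1(Z, Z) = - n\<^sub>2(C) n\<^sub>2(E) (n\<^sub>1(E) - n\<^sub>1(C))\<close>, and definiteness gives the claim. If it were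
zero, both equations together would give \<open>n\<^sub>1(C) = n\<^sub>2(C) = 0\<close>.\<close>

lemma envelope_nonzero:
  fixes n1 n2 :: "'a::real_vector \<Rightarrow> real"
  assumes n: "linear n1" "linear n2" and B: "bilinear B1" "bilinear B2"
    and def1: "\<And>u. n1 u = 0 \<Longrightarrow> B1 u u = 0 \<Longrightarrow> u = 0"
    and def2: "\<And>u. n2 u = 0 \<Longrightarrow> B2 u u = 0 \<Longrightarrow> u = 0"
    and t1: "\<exists>u. n1 u = 0 \<and> n2 u \<noteq> 0" and t2: "\<exists>u. n2 u = 0 \<and> n1 u \<noteq> 0"
    and mid: "n1 C \<noteq> 0 \<or> n2 C \<noteq> 0" and F: "n2 C * n1 E + n1 C * n2 E = 0"
    and F1: "\<And>u. n1 u = 0 \<Longrightarrow> B1 u (n2 C *\<^sub>R E + n2 E *\<^sub>R C) + n2 u * (n1 E - n1 C) / 2 = 0"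
    and F2: "\<And>u. n2 u = 0 \<Longrightarrow> B2 u (n1 C *\<^sub>R E + n1 E *\<^sub>R C) - n1 u * (n2 E + n2 C) / 2 = 0"
  shows "n2 C \<noteq> 0 \<and> n2 E \<noteq> 0 \<and> n1 E \<noteq> n1 C"
proof -
  define Z where "Z = n2 C *\<^sub>R E + n2 E *\<^sub>R C"
  define Z' where "Z' = n1 C *\<^sub>R E + n1 E *\<^sub>R C"
  have nZ: "n1 Z = 0" "n2 Z = 2 * n2 C * n2 E" "n2 Z' = 0" "n1 Z' = 2 * n1 C * n1 E"
    using F n unfolding Z_def Z'_def by (simp_all add: linear_add linear_scale mult.commute)
  have "Z \<noteq> 0"
  proof
    assume Z0: "Z = 0"
    then have zero: "n2 C * n2 E = 0" using nZ(2) linear_0[OF n(2)] by simp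
    obtain u where u: "n1 u = 0" "n2 u \<noteq> 0" using t1 by blast
    have eq: "n1 E = n1 C"
      using F1[OF u(1)] u(2) Z0 bilinear_rzero[OF B(1)] unfolding Z_def by simp
    show False
    proof (cases "n1 C = 0")
      case True
      then have a2: "n2 C \<noteq> 0" using mid by blast
      with zero have x2: "n2 E = 0" by simp
      have "Z' = 0" unfolding Z'_def using True eq by simp
      obtain v where v: "n2 v = 0" "n1 v \<noteq> 0" using t2 by blast
      show False
        using F2[OF v(1)] v(2) \<open>Z' = 0\<close> bilinear_rzero[OF B(2)] x2 a2 unfolding Z'_def by simp
    next
      case False
      with F eq have "n1 C * (n2 C + n2 E) = 0" by (simp add: algebra_simps)
      with False have "n2 E = - n2 C" by simp
      then have "n2 C = 0" "n2 E = 0" using zero by auto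
      then have "B2 Z' Z' = 0" using F2[OF nZ(3)] unfolding Z'_def by simp
      then have "Z' = 0" using def2 nZ(3) by blast
      then show False using nZ(4) linear_0[OF n(1)] eq False by simp
    qed
  qed
  then have "B1 Z Z \<noteq> 0" using def1 nZ(1) by blast
  moreover have "B1 Z Z + n2 Z * (n1 E - n1 C) / 2 = 0" using F1[OF nZ(1)] unfolding Z_def .
  ultimately have "n2 C * n2 E * (n1 E - n1 C) \<noteq> 0" using nZ(2) by auto
  then show ?thesis by auto
qed

text \<open>\<open>envelope_nonzero\<close> for both orders of the two hypersurfaces; exchanging them changes the sign of \<open>C\<close> and
keeps \<open>E\<close>.\<close>

lemma envelope_ratio:
  fixes n1 n2 :: "'a::real_vector \<Rightarrow> real"
  assumes n: "linear n1" "linear n2" and B: "bilinear B1" "bilinear B2"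
    and def1: "\<And>u. n1 u = 0 \<Longrightarrow> B1 u u = 0 \<Longrightarrow> u = 0"
    and def2: "\<And>u. n2 u = 0 \<Longrightarrow> B2 u u = 0 \<Longrightarrow> u = 0"
    and t1: "\<exists>u. n1 u = 0 \<and> n2 u \<noteq> 0" and t2: "\<exists>u. n2 u = 0 \<and> n1 u \<noteq> 0"
    and mid: "n1 C \<noteq> 0 \<or> n2 C \<noteq> 0" and F: "n2 C * n1 E + n1 C * n2 E = 0"
    and F1: "\<And>u. n1 u = 0 \<Longrightarrow> B1 u (n2 C *\<^sub>R E + n2 E *\<^sub>R C) + n2 u * (n1 E - n1 C) / 2 = 0"
    and F2: "\<And>u. n2 u = 0 \<Longrightarrow> B2 u (n1 C *\<^sub>R E + n1 E *\<^sub>R C) - n1 u * (n2 E + n2 C) / 2 = 0"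
  obtains l where "l \<noteq> 0" "l \<noteq> 1" "n1 C \<noteq> 0" "n2 C \<noteq> 0" "n1 E = l * n1 C" "n2 E = - l * n2 C"
proof -
  have 1: "n2 C \<noteq> 0 \<and> n2 E \<noteq> 0 \<and> n1 E \<noteq> n1 C"
    by (rule envelope_nonzero[OF n B def1 def2 t1 t2 mid F F1 F2])
  have neg: "n1 (-C) = - n1 C" "n2 (-C) = - n2 C" using n by (simp_all add: linear_neg)
  have 2: "n1 (-C) \<noteq> 0 \<and> n1 E \<noteq> 0 \<and> n2 E \<noteq> n2 (-C)"
  proof (rule envelope_nonzero[OF n(2,1) B(2,1) def2 def1 t2 t1])
    show "n2 (-C) \<noteq> 0 \<or> n1 (-C) \<noteq> 0" "n1 (-C) * n2 E + n2 (-C) * n1 E = 0"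
      using mid F unfolding neg by auto
    show "B2 u (n1 (-C) *\<^sub>R E + n1 E *\<^sub>R - C) + n1 u * (n2 E - n2 (-C)) / 2 = 0" if "n2 u = 0" for u
    proof -
      have "n1 (-C) *\<^sub>R E + n1 E *\<^sub>R - C = - (n1 C *\<^sub>R E + n1 E *\<^sub>R C)" unfolding neg by simp
      then have "B2 u (n1 (-C) *\<^sub>R E + n1 E *\<^sub>R - C) = - B2 u (n1 C *\<^sub>R E + n1 E *\<^sub>R C)"
        by (simp only: bilinear_rneg[OF B(2)])
      then show ?thesis using F2[OF that] by (simp only: neg) simp
    qed
    show "B1 u (n2 (-C) *\<^sub>R E + n2 E *\<^sub>R - C) - n2 u * (n1 E + n1 (-C)) / 2 = 0" if "n1 u = 0" for u
    proof -
      have "n2 (-C) *\<^sub>R E + n2 E *\<^sub>R - C = - (n2 C *\<^sub>R E + n2 E *\<^sub>R C)" unfolding neg by simp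
      then have "B1 u (n2 (-C) *\<^sub>R E + n2 E *\<^sub>R - C) = - B1 u (n2 C *\<^sub>R E + n2 E *\<^sub>R C)"
        by (simp only: bilinear_rneg[OF B(1)])
      then show ?thesis using F1[OF that] by (simp only: neg) simp
    qed
  qed
  have "n2 E = - (n1 E / n1 C) * n2 C" using F 2 unfolding neg by (simp add: field_simps)
  then show ?thesis using 1 2 by (intro that[of "n1 E / n1 C"]) (auto simp: neg)
qed

text \<open>Here \<open>n\<^sub>2(C) E + n\<^sub>2(E) C\<close> is the multiple \<open>n\<^sub>2(C) (E - l C)\<close> of the tangent direction of the conic. The first
envelope equation is used on the intersection of the tangent spaces and at \<open>u = E - l C\<close>.\<close>

lemma envelope_direction:
  fixes n1 n2 :: "'a::real_vector \<Rightarrow> real"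
  assumes n: "linear n1" "linear n2" and B: "bilinear B1"
    and l: "n2 C \<noteq> 0" "n1 E = l * n1 C" "n2 E = - l * n2 C"
    and F1: "\<And>u. n1 u = 0 \<Longrightarrow> B1 u (n2 C *\<^sub>R E + n2 E *\<^sub>R C) + n2 u * (n1 E - n1 C) / 2 = 0"
  shows "n1 (E - l *\<^sub>R C) = 0"
    and "\<And>u. n1 u = 0 \<Longrightarrow> n2 u = 0 \<Longrightarrow> B1 u (E - l *\<^sub>R C) = 0"
    and "B1 (E - l *\<^sub>R C) (E - l *\<^sub>R C) + l * (1 - l) * n1 C = 0"
proof -
  define d where "d = E - l *\<^sub>R C"
  have Z: "n2 C *\<^sub>R E + n2 E *\<^sub>R C = n2 C *\<^sub>R d" unfolding d_def l(3) by (simp add: algebra_simps)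
  have nd: "n1 d = 0" "n2 d = - 2 * l * n2 C"
    unfolding d_def using n l by (simp_all add: linear_diff linear_scale)
  then show "n1 (E - l *\<^sub>R C) = 0" by (simp add: d_def)
  have F: "n2 C * B1 u d + n2 u * ((l - 1) * n1 C) / 2 = 0" if "n1 u = 0" for u
    using F1[OF that] bilinear_rmul[OF B] unfolding Z l(2) by (simp add: left_diff_distrib)
  show "B1 u (E - l *\<^sub>R C) = 0" if "n1 u = 0" "n2 u = 0" for u
    using F[OF that(1)] that(2) l(1) by (simp add: d_def)
  have "n2 C * (B1 d d + l * (1 - l) * n1 C) = 0"
  proof -
    have "n2 C * (B1 d d + l * (1 - l) * n1 C) = n2 C * B1 d d + n2 d * ((l - 1) * n1 C) / 2"
      unfolding nd(2) by (simp add: field_simps)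
    then show ?thesis using F[OF nd(1)] by simp
  qed
  then show "B1 (E - l *\<^sub>R C) (E - l *\<^sub>R C) + l * (1 - l) * n1 C = 0"
    using l(1) by (simp add: d_def)
qed

section \<open>Tangent hyperplanes of a central conic\<close>

text \<open>The plane is spanned by \<open>q\<close> and the tangent direction \<open>v\<close>, and both \<open>n\<close> and the polar form \<open>Q(q, _)\<close>
vanish at \<open>v\<close>.\<close>

lemma conormal_proportional_polar:
  fixes P :: "'a::euclidean_space set" and Q :: "'a \<Rightarrow> 'a \<Rightarrow> real" and n :: "'a \<Rightarrow> real"
  assumes P: "subspace P" "dim P = 2" and Q: "bilinear Q" and n: "linear n"
    and q: "q \<in> P" "Q q q = 1" and v: "v \<in> P" "v \<noteq> 0" "Q q v = 0" "n v = 0"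
    and y: "y \<in> P"
  shows "n y = n q * Q q y" and "Q q y = 0 \<Longrightarrow> \<exists>\<beta>. y = \<beta> *\<^sub>R v"
proof -
  have ne: "q \<noteq> v" using q v by auto
  have nin: "q \<notin> span {v}"
  proof
    assume "q \<in> span {v}"
    then obtain k where k: "q = k *\<^sub>R v" by (auto simp: span_singleton)
    have "Q q q = k * Q q v"
      using bilinear_rmul[OF Q, of q k v] unfolding k[symmetric] by simp
    then show False using q v by simp
  qed
  have ind: "independent {q, v}"
    using nin v(2) by (simp add: independent_insert)
  have "card {q, v} = 2" using ne by simp
  then have "P \<subseteq> span {q, v}"
    using card_ge_dim_independent[of "{q, v}" P] ind P(2) q(1) v(1) by simp
  then obtain k where "y - k *\<^sub>R q \<in> span {v}" using y span_breakdown_eq[of y q "{v}"] by blast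
  then obtain m where m: "y - k *\<^sub>R q = m *\<^sub>R v" by (auto simp: span_singleton)
  then have y: "y = k *\<^sub>R q + m *\<^sub>R v" by (simp add: algebra_simps)
  have Qy: "Q q y = k"
    unfolding y using q v bilinear_radd[OF Q] bilinear_rmul[OF Q] by simp
  show "n y = n q * Q q y"
    unfolding Qy unfolding y using v n by (simp add: linear_add linear_scale)
  show "\<exists>\<beta>. y = \<beta> *\<^sub>R v" if "Q q y = 0" using y that Qy by auto
qed

text \<open>The conic \<open>Q(y, y) = 1\<close> in the plane \<open>P\<close> with centre \<open>0\<close>, its points \<open>q\<^sub>i\<close> and tangent directions \<open>v\<^sub>i\<close>, and
hyperplanes \<open>ker n\<^sub>i\<close> that are tangent to it at \<open>q\<^sub>i\<close>. With the centre moved to \<open>0\<close> the vectors \<open>C\<close> and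
\<open>X - M\<close> of the envelope equations are \<open>(q\<^sub>1 - q\<^sub>2)/2\<close> and \<open>- (q\<^sub>1 + q\<^sub>2)/2\<close>.\<close>

locale two_conic_tangents =
  fixes P :: "'a::euclidean_space set" and Q :: "'a \<Rightarrow> 'a \<Rightarrow> real" and n1 n2 :: "'a \<Rightarrow> real"
    and q1 v1 q2 v2 :: 'a
  assumes P: "subspace P" "dim P = 2" and Q: "bilinear Q" "\<And>u w. Q u w = Q w u"
    and n: "linear n1" "linear n2"
    and q1: "q1 \<in> P" "Q q1 q1 = 1" and v1: "v1 \<in> P" "v1 \<noteq> 0" "Q q1 v1 = 0" "n1 v1 = 0"
    and q2: "q2 \<in> P" "Q q2 q2 = 1" and v2: "v2 \<in> P" "v2 \<noteq> 0" "Q q2 v2 = 0" "n2 v2 = 0"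
    and nv1: "n2 v1 \<noteq> 0" and nv2: "n1 v2 \<noteq> 0"
begin

abbreviation "s \<equiv> Q q1 q2"
abbreviation "C \<equiv> (1/2) *\<^sub>R (q1 - q2)"
abbreviation "E \<equiv> - ((1/2) *\<^sub>R (q1 + q2))"

lemma n1_polar: "y \<in> P \<Longrightarrow> n1 y = n1 q1 * Q q1 y"
  by (rule conormal_proportional_polar(1)[OF P Q(1) n(1) q1 v1])

lemma n2_polar: "y \<in> P \<Longrightarrow> n2 y = n2 q2 * Q q2 y"
  by (rule conormal_proportional_polar(1)[OF P Q(1) n(2) q2 v2])

lemma parallel_v1: "y \<in> P \<Longrightarrow> Q q1 y = 0 \<Longrightarrow> \<exists>\<beta>. y = \<beta> *\<^sub>R v1"
  by (rule conormal_proportional_polar(2)[OF P Q(1) n(1) q1 v1])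

lemma cross_values: "n1 q2 = n1 q1 * s" "n2 q1 = n2 q2 * s"
  using n1_polar[OF q2(1)] n2_polar[OF q1(1)] Q(2)[of q2 q1] by simp_all

lemma half_values:
  "n1 C = n1 q1 * (1 - s) / 2" "n2 C = n2 q2 * (s - 1) / 2"
  "n1 E = - n1 q1 * (1 + s) / 2" "n2 E = - n2 q2 * (1 + s) / 2"
  using n cross_values
  by (simp_all add: linear_neg linear_add linear_diff linear_scale algebra_simps)

lemma mid_hyperplane_equation: "n2 C * n1 E + n1 C * n2 E = 0"
  unfolding half_values by (simp add: field_simps)

text \<open>If \<open>s = 1\<close>, then \<open>q\<^sub>1 - q\<^sub>2\<close> is tangent at both points, hence zero; but then the two hyperplanes would have
the same trace in the plane.\<close>

lemma n1_C_nonzero: "n1 C \<noteq> 0"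
proof -
  have n1q1: "n1 q1 \<noteq> 0" using n1_polar[OF v2(1)] nv2 by auto
  have "s \<noteq> 1"
  proof
    assume s: "s = 1"
    have yP: "q1 - q2 \<in> P" using P(1) q1(1) q2(1) by (rule subspace_diff)
    have "Q q1 (q1 - q2) = 0" using s q1(2) Q(1) by (simp add: bilinear_rsub)
    then obtain \<beta> where \<beta>: "q1 - q2 = \<beta> *\<^sub>R v1" using parallel_v1[OF yP] by blast
    have "n2 (q1 - q2) = 0" using cross_values(2) s n by (simp add: linear_diff)
    then have "\<beta> = 0" unfolding \<beta> using nv1 n by (simp add: linear_scale)
    then have "q1 = q2" using \<beta> by simp
    then show False using n2_polar[OF v1(1)] v1(3) nv1 by simp
  qed
  then show ?thesis using n1q1 unfolding half_values by simp
qed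

text \<open>The vector \<open>n\<^sub>2(C) E + n\<^sub>2(E) C\<close> is a multiple of \<open>v\<^sub>1\<close>, being in the plane and polar to \<open>q\<^sub>1\<close>. On the intersection of
the hyperplanes the equation is therefore the orthogonality of \<open>v\<^sub>1\<close>, and at \<open>v\<^sub>1\<close> it follows from
\<open>B\<^sub>1(v\<^sub>1, v\<^sub>1) = n\<^sub>1(q\<^sub>1) Q(v\<^sub>1, v\<^sub>1)\<close>, which expresses contact of order 3.\<close>

lemma envelope_equation:
  assumes B1: "bilinear B1"
    and k1: "k1 \<in> P" "Q v1 v1 + Q q1 k1 = 0" "B1 v1 v1 + n1 k1 = 0"
    and orth: "\<And>u. n1 u = 0 \<Longrightarrow> n2 u = 0 \<Longrightarrow> B1 u v1 = 0"
    and u: "n1 u = 0"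
  shows "B1 u (n2 C *\<^sub>R E + n2 E *\<^sub>R C) + n2 u * (n1 E - n1 C) / 2 = 0"
proof -
  define Z where "Z = (n2 q2 / 2) *\<^sub>R (q2 - s *\<^sub>R q1)"
  have comb: "\<alpha> *\<^sub>R E + \<beta> *\<^sub>R C = (- (\<alpha> + - \<beta>) / 2) *\<^sub>R q1 + (- (\<alpha> + \<beta>) / 2) *\<^sub>R q2" for \<alpha> \<beta>
    by (simp add: scaleR_left_diff_distrib scaleR_left_distrib scaleR_right_distrib
        scaleR_right_diff_distrib diff_divide_distrib add_divide_distrib)
  have "n2 C *\<^sub>R E + n2 E *\<^sub>R C = (- (n2 C + - n2 E) / 2) *\<^sub>R q1 + (- (n2 C + n2 E) / 2) *\<^sub>R q2"
    by (rule comb)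
  also have "- (n2 C + - n2 E) / 2 = (n2 q2 / 2) * (- s)" unfolding half_values by (simp add: field_simps)
  also have "- (n2 C + n2 E) / 2 = n2 q2 / 2" unfolding half_values by (simp add: field_simps)
  also have "((n2 q2 / 2) * (- s)) *\<^sub>R q1 + (n2 q2 / 2) *\<^sub>R q2 = Z" by (simp add: Z_def algebra_simps)
  finally have Z: "n2 C *\<^sub>R E + n2 E *\<^sub>R C = Z" .
  have ZP: "Z \<in> P" unfolding Z_def using P(1) q1(1) q2(1) by (intro subspace_scale subspace_diff)
  have QZ: "Q w Z = n2 q2 / 2 * (Q w q2 - s * Q w q1)" for w
    unfolding Z_def using Q(1) by (simp add: bilinear_rmul bilinear_rsub)
  have "Q q1 Z = 0" using QZ[of q1] q1(2) by simp
  then obtain \<mu> where \<mu>: "Z = \<mu> *\<^sub>R v1" using parallel_v1[OF ZP] by blast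
  have Bv: "B1 v1 v1 = n1 q1 * Q v1 v1"
  proof -
    have "Q q1 k1 = - Q v1 v1" using k1(2) by linarith
    then show ?thesis using n1_polar[OF k1(1)] k1(3) by simp
  qed
  define \<beta> where "\<beta> = n2 u / n2 v1"
  have w: "n1 (u - \<beta> *\<^sub>R v1) = 0" "n2 (u - \<beta> *\<^sub>R v1) = 0"
    using u v1(4) nv1 n by (simp_all add: \<beta>_def linear_diff linear_scale)
  have "B1 u v1 = B1 (u - \<beta> *\<^sub>R v1) v1 + \<beta> * B1 v1 v1"
    using B1 by (simp add: bilinear_lsub bilinear_lmul)
  then have "B1 u Z = \<beta> * (n1 q1 * (\<mu> * Q v1 v1))"
    unfolding \<mu> using orth[OF w] Bv bilinear_rmul[OF B1] by simp
  also have "\<mu> * Q v1 v1 = Q v1 Z" unfolding \<mu> using bilinear_rmul[OF Q(1)] by simp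
  also have "Q v1 Z = n2 q2 / 2 * Q q2 v1" using QZ[of v1] Q(2) v1(3) by simp
  also have "\<dots> = n2 v1 / 2" using n2_polar[OF v1(1)] by simp
  also have "\<beta> * (n1 q1 * (n2 v1 / 2)) = n2 u * n1 q1 / 2" using nv1 by (simp add: \<beta>_def)
  finally have "B1 u Z = n2 u * n1 q1 / 2" .
  moreover have "n1 E - n1 C = - n1 q1" unfolding half_values by (simp add: field_simps)
  ultimately show ?thesis unfolding Z by simp
qed

end

section \<open>The conic attached to a solution of the envelope equations\<close>

lemma independent_pairI:
  assumes "\<And>\<alpha> \<beta>. \<alpha> *\<^sub>R x + \<beta> *\<^sub>R y = 0 \<Longrightarrow> \<alpha> = 0 \<and> \<beta> = 0"
  shows "x \<noteq> y \<and> independent {x, y}"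
proof -
  have y: "y \<noteq> 0" using assms[of 0 1] by auto
  have "x \<noteq> k *\<^sub>R y" for k using assms[of 1 "-k"] by auto
  then have "x \<notin> span {y}" by (auto simp: span_singleton)
  moreover have "x \<noteq> y" using assms[of 1 "-1"] by auto
  ultimately show ?thesis using y by (simp add: independent_insert)
qed

text \<open>Hyperbolic functions for \<open>l > 0\<close> and trigonometric ones for \<open>l < 0\<close>, so that hyperbolas and ellipses are
parameterized by the same formula.\<close>

lemma hyperbolic_pair:
  assumes "l \<noteq> 0"
  obtains f g :: "real \<Rightarrow> real"
  where "\<And>t. (f has_real_derivative l * g t) (at t)" "\<And>t. (g has_real_derivative f t) (at t)"
    "f 0 = 1" "g 0 = 0" "\<And>t. (f t)\<^sup>2 - l * (g t)\<^sup>2 = 1"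
proof (cases "l > 0")
  case True
  define w where "w = sqrt l"
  have w: "w > 0" "w\<^sup>2 = l" using True by (auto simp: w_def)
  have "((\<lambda>t. cosh (w * t)) has_real_derivative l * (sinh (w * t) / w)) (at t)" for t
    using w by (auto intro!: derivative_eq_intros simp: power2_eq_square)
  moreover have "((\<lambda>t. sinh (w * t) / w) has_real_derivative cosh (w * t)) (at t)" for t
    using w by (auto intro!: derivative_eq_intros)
  moreover have "(cosh (w * t))\<^sup>2 - l * (sinh (w * t) / w)\<^sup>2 = 1" for t
    using w assms cosh_square_eq[of "w * t"] by (simp add: power_divide)
  ultimately show ?thesis by (intro that[of "\<lambda>t. cosh (w * t)" "\<lambda>t. sinh (w * t) / w"]) auto
next
  case False
  define w where "w = sqrt (-l)"
  have w: "w > 0" "w\<^sup>2 = -l" using False assms by (auto simp: w_def)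
  have l: "l = - (w * w)" using w(2) by (simp add: power2_eq_square)
  have "((\<lambda>t. cos (w * t)) has_real_derivative l * (sin (w * t) / w)) (at t)" for t
    using w(1) unfolding l by (auto intro!: derivative_eq_intros)
  moreover have "((\<lambda>t. sin (w * t) / w) has_real_derivative cos (w * t)) (at t)" for t
    using w by (auto intro!: derivative_eq_intros)
  moreover have "(cos (w * t))\<^sup>2 - l * (sin (w * t) / w)\<^sup>2 = 1" for t
    using w(1) unfolding l by (simp add: power_divide power2_eq_square[of w])
  ultimately show ?thesis by (intro that[of "\<lambda>t. cos (w * t)" "\<lambda>t. sin (w * t) / w"]) auto
qed

text \<open>The derivative is written as a curve of the same form, with \<open>A\<close> and \<open>B\<close> replaced, so that it can be iterated.\<close>

lemma hyperbolic_curve_derivative: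
  fixes A B :: "'a::real_normed_vector"
  assumes "\<And>t. (f has_real_derivative l * g t) (at t)" "\<And>t. (g has_real_derivative f t) (at t)"
  shows "((\<lambda>t. X + f t *\<^sub>R A + g t *\<^sub>R B) has_derivative
           (\<lambda>h. 0 + f t *\<^sub>R (h *\<^sub>R B) + g t *\<^sub>R (h *\<^sub>R (l *\<^sub>R A)))) (at t)"
proof -
  have "((\<lambda>t. X + f t *\<^sub>R A + g t *\<^sub>R B) has_derivative
           (\<lambda>h. 0 + (l * g t * h) *\<^sub>R A + (f t * h) *\<^sub>R B)) (at t)"
    using assms[of t] unfolding has_field_derivative_def
    by (intro has_derivative_add has_derivative_const has_derivative_scaleR_left)
  then show ?thesis by (rule has_derivative_eq_rhs) (auto simp: algebra_simps)
qed

lemma hyperbolic_curve_smooth: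
  fixes A B :: "'a::real_normed_vector"
  assumes "\<And>t. (f has_real_derivative l * g t) (at t)" "\<And>t. (g has_real_derivative f t) (at t)"
  shows "smooth_on UNIV (\<lambda>t. X + f t *\<^sub>R A + g t *\<^sub>R B)"
proof -
  have "Ck_on k (\<lambda>t. X + f t *\<^sub>R A + g t *\<^sub>R B) UNIV" for k
  proof (induction k arbitrary: X A B)
    case 0
    show ?case
      using has_derivative_continuous[OF hyperbolic_curve_derivative[OF assms]]
      by (auto intro!: continuous_at_imp_continuous_on)
  next
    case (Suc k)
    show ?case
      by (rule Ck_on_SucI[OF open_UNIV hyperbolic_curve_derivative[OF assms]]) (rule Suc.IH)
  qed
  then show ?thesis by (simp add: smooth_on_def)
qed

text \<open>The conic is parameterized by \<open>X + f(t) q + h(t) d\<close> with the conjugate directions \<open>q = C - E\<close> and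
\<open>d = E - l C\<close>. Its velocity at \<open>p\<close> is \<open>d\<close> and its acceleration \<open>l q\<close>, on which \<open>dg\<close> takes the value
\<open>l (1 - l) dg(C)\<close>; this matches the last hypothesis. The other point of contact is obtained with \<open>- C\<close> in
place of \<open>C\<close>.\<close>

lemma mid_conic_contact3:
  fixes S :: "(real^'n) set"
  assumes g: "local_defining_function S p U g" and p: "p \<in> S"
    and l: "l \<noteq> 0" "l \<noteq> 1" and pX: "p = X + C - E"
    and \<Gamma>: "\<And>x y. x\<^sup>2 - l * y\<^sup>2 = 1 - l \<Longrightarrow> X + x *\<^sub>R C + y *\<^sub>R E \<in> \<Gamma>"
    and nE: "dird g E p = l * dird g C p"
    and ind: "\<And>\<alpha> \<beta>. \<alpha> *\<^sub>R C + \<beta> *\<^sub>R E = 0 \<Longrightarrow> \<alpha> = 0 \<and> \<beta> = 0"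
    and nd: "dird g (E - l *\<^sub>R C) p = 0"
    and Bd: "dird (dird g (E - l *\<^sub>R C)) (E - l *\<^sub>R C) p + l * (1 - l) * dird g C p = 0"
  shows "contact3 \<Gamma> S p (E - l *\<^sub>R C)"
proof -
  note gD = local_defining_functionD[OF g]
  obtain f h where fh: "\<And>t. (f has_real_derivative l * h t) (at t)" "\<And>t. (h has_real_derivative f t) (at t)"
    "f 0 = 1" "h 0 = 0" "\<And>t. (f t)\<^sup>2 - l * (h t)\<^sup>2 = 1"
    using hyperbolic_pair[OF l(1)] by metis
  define q where "q = C - E"
  define d where "d = E - l *\<^sub>R C"
  define c where "c t = X + f t *\<^sub>R q + h t *\<^sub>R d" for t
  note der = hyperbolic_curve_derivative[OF fh(1,2)]
  have c': "dird c 1 t = 0 + f t *\<^sub>R d + h t *\<^sub>R (l *\<^sub>R q)" for t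
    using fun_cong[OF frechet_derivative_at[OF der[of X q d t]], of 1] by (simp add: c_def[abs_def])
  then have c'f: "dird c 1 = (\<lambda>t. 0 + f t *\<^sub>R d + h t *\<^sub>R (l *\<^sub>R q))" by (rule ext)
  have "0 + f 0 *\<^sub>R (1 *\<^sub>R (l *\<^sub>R q)) + h 0 *\<^sub>R (1 *\<^sub>R (l *\<^sub>R d)) = dird (dird c 1) 1 0"
    unfolding c'f by (rule fun_cong[OF frechet_derivative_at[OF der[of 0 d "l *\<^sub>R q" 0]]])
  then have c'': "dird (dird c 1) 1 0 = l *\<^sub>R q" using fh(3,4) by simp
  have c0: "c 0 = p" "dird c 1 0 = d" using c' fh(3,4) pX by (auto simp: c_def q_def)
  have sm: "smooth_on {-1<..<1} c"
    unfolding c_def[abs_def] by (rule smooth_on_subset[OF hyperbolic_curve_smooth[OF fh(1,2)]]) simp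
  have vd: "vector_derivative c (at t) = dird c 1 t" for t
  proof -
    have "c differentiable (at t)" using der[of X q d t] unfolding c_def[abs_def] differentiable_def by blast
    then show ?thesis using frechet_derivative_eq_vector_derivative[of c t] by simp
  qed
  have c\<Gamma>: "c t \<in> \<Gamma>" for t
  proof -
    have "(f t - l * h t)\<^sup>2 - l * (h t - f t)\<^sup>2 = (1 - l) * ((f t)\<^sup>2 - l * (h t)\<^sup>2)"
      by (simp add: power2_eq_square algebra_simps)
    then have "X + (f t - l * h t) *\<^sub>R C + (h t - f t) *\<^sub>R E \<in> \<Gamma>" using \<Gamma> fh(5) by simp
    then show ?thesis unfolding c_def q_def d_def by (simp add: algebra_simps)
  qed
  have nz: "dird c 1 t \<noteq> 0" for t
  proof
    assume "dird c 1 t = 0"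
    then have "(l * (h t - f t)) *\<^sub>R C + (f t - l * h t) *\<^sub>R E = 0"
      unfolding c' q_def d_def by (simp add: algebra_simps)
    then have eqs: "l * (h t - f t) = 0" "f t - l * h t = 0" using ind by blast+
    then have "h t = f t" using l by simp
    then have "(1 - l) * f t = 0" using eqs(2) by (simp add: algebra_simps)
    then have "f t = 0" "h t = 0" using l \<open>h t = f t\<close> by auto
    then show False using fh(5)[of t] by simp
  qed
  have gp: "g p = 0" using p gD(2,4) by blast
  have lin: "linear (\<lambda>v. dird g v p)" by (rule dird_linear[OF gD(3,2)])
  have "dird g (l *\<^sub>R q) p = l * (1 - l) * dird g C p"
    unfolding q_def linear_scale[OF lin] linear_diff[OF lin] nE by (simp add: algebra_simps)
  then have "(\<lambda>t. g (c t)) \<in> O[at 0](\<lambda>t. t ^ 3)"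
    using smooth_curve_contact_iff[OF gD(3,1) _ sm] gD(2) gp nd Bd unfolding c0 c'' d_def by simp
  moreover have "p \<in> \<Gamma>" using c\<Gamma>[of 0] c0 by simp
  moreover have "d \<noteq> 0" using nz[of 0] c0 by simp
  moreover have "vector_derivative c (at 0) = 1 *\<^sub>R d" using vd c0 by simp
  ultimately show ?thesis
    unfolding contact3_def d_def[symmetric]
    using sm c\<Gamma> nz vd c0(1) g
    by (intro conjI exI[of _ "1::real"] exI[of _ c] exI[of _ U] exI[of _ g]) auto
qed

section \<open>Central conics and curves on them\<close>

text \<open>A translation of the coordinates keeps the determinant of the conic.\<close>

lemma quadratic_shift_det:
  fixes a b c d e f x y :: real
  defines "d' \<equiv> a * x + b * y + d" and "e' \<equiv> b * x + c * y + e"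
    and "f' \<equiv> a * x\<^sup>2 + 2 * b * x * y + c * y\<^sup>2 + 2 * d * x + 2 * e * y + f"
  shows "a * (c * f' - e' * e') - b * (b * f' - e' * d') + d' * (b * e' - c * d')
       = a * (c * f - e * e) - b * (b * f - e * d) + d * (b * e - c * d)"
  unfolding assms by (simp add: power2_eq_square algebra_simps)

lemma finite_square_roots: "finite {s::real. s\<^sup>2 = r}"
proof -
  have "{s::real. s\<^sup>2 = r} \<subseteq> {sqrt r, - sqrt r}"
  proof
    fix s :: real assume "s \<in> {s. s\<^sup>2 = r}"
    then have "\<bar>s\<bar> = sqrt r" using real_sqrt_abs[of s] by simp
    then show "s \<in> {sqrt r, - sqrt r}" by auto
  qed
  then show ?thesis by (rule finite_subset) simp
qed

lemma point_reflection_coordinates: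
  fixes w e1 e2 :: "'a::real_vector"
  shows "2 *\<^sub>R (w + x0 *\<^sub>R e1 + y0 *\<^sub>R e2) - (w + (x0 + u) *\<^sub>R e1 + (y0 + v) *\<^sub>R e2)
     = w + (x0 + - u) *\<^sub>R e1 + (y0 + - v) *\<^sub>R e2"
  by (simp only: scaleR_2 scaleR_left_distrib scaleR_minus_left) (simp add: algebra_simps)

text \<open>In coordinates centred at \<open>X\<close> the equation is \<open>K + 2 L + f' = 0\<close> with a quadratic form \<open>K\<close> and a linear form
\<open>L = d' x + e' y\<close>. Symmetry about \<open>X\<close> makes \<open>L\<close> vanish at all points of the conic. If \<open>L \<noteq> 0\<close>, the conic lies on a
line through \<open>X\<close>, where an infinite set of solutions is possible only if \<open>K\<close> and \<open>f'\<close> vanish on it, contrary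
to the determinant condition. So \<open>L = 0\<close>, and then \<open>f' \<noteq> 0\<close> by the same condition.\<close>

lemma infinite_central_conic_form:
  fixes \<Gamma> :: "(real^'n) set"
  assumes pc: "planar_conic \<Gamma>" and cc: "conic_center \<Gamma> X" and inf: "infinite \<Gamma>"
  obtains P and Q :: "real^'n \<Rightarrow> real^'n \<Rightarrow> real" where "subspace P" "dim P = 2" "bilinear Q" "\<forall>u w. Q u w = Q w u"
    "\<forall>q\<in>\<Gamma>. q - X \<in> P \<and> Q (q - X) (q - X) = 1"
proof -
  obtain w e1 e2 a b c d e f where ne: "e1 \<noteq> e2" and ind: "independent {e1, e2}"
    and det: "a * (c * f - e * e) - b * (b * f - e * d) + d * (b * e - c * d) \<noteq> 0"
    and \<Gamma>: "\<Gamma> = {w + x *\<^sub>R e1 + y *\<^sub>R e2 | x y.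
               a * x\<^sup>2 + 2 * b * x * y + c * y\<^sup>2 + 2 * d * x + 2 * e * y + f = 0}"
    using pc unfolding planar_conic_def by (elim exE conjE) (rule that)
  obtain \<phi> :: "real^'n \<Rightarrow> real" where \<phi>: "linear \<phi>" "\<phi> e1 = 1" "\<phi> e2 = 0"
    using linear_independent_extend[OF ind, of "\<lambda>v. if v = e1 then 1 else 0"] ne by auto
  obtain \<psi> :: "real^'n \<Rightarrow> real" where \<psi>: "linear \<psi>" "\<psi> e1 = 0" "\<psi> e2 = 1"
    using linear_independent_extend[OF ind, of "\<lambda>v. if v = e2 then 1 else 0"] ne by auto
  have co: "\<phi> (x *\<^sub>R e1 + y *\<^sub>R e2) = x" "\<psi> (x *\<^sub>R e1 + y *\<^sub>R e2) = y" for x y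
    using \<phi> \<psi> by (simp_all add: linear_add linear_scale)
  define R where "R x y = a * x\<^sup>2 + 2 * b * x * y + c * y\<^sup>2 + 2 * d * x + 2 * e * y + f" for x y
  have \<Gamma>R: "\<exists>x y. q = w + x *\<^sub>R e1 + y *\<^sub>R e2 \<and> R x y = 0" if "q \<in> \<Gamma>" for q
    using that unfolding \<Gamma> R_def by blast
  have R0: "R x y = 0" if mem: "w + x *\<^sub>R e1 + y *\<^sub>R e2 \<in> \<Gamma>" for x y
  proof -
    obtain x' y' where e: "w + x *\<^sub>R e1 + y *\<^sub>R e2 = w + x' *\<^sub>R e1 + y' *\<^sub>R e2" "R x' y' = 0"
      using \<Gamma>R[OF mem] by blast
    then have "x *\<^sub>R e1 + y *\<^sub>R e2 = x' *\<^sub>R e1 + y' *\<^sub>R e2" by (simp add: add.assoc)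
    then have "x = x'" "y = y'" using co by metis+
    then show ?thesis using e(2) by simp
  qed
  obtain p where p: "p \<in> \<Gamma>" using inf by fastforce
  have p': "2 *\<^sub>R X - p \<in> \<Gamma>" using cc p unfolding conic_center_def by blast
  obtain x1 y1 where 1: "p = w + x1 *\<^sub>R e1 + y1 *\<^sub>R e2" using \<Gamma>R[OF p] by blast
  obtain x2 y2 where 2: "2 *\<^sub>R X - p = w + x2 *\<^sub>R e1 + y2 *\<^sub>R e2" using \<Gamma>R[OF p'] by blast
  define x0 where "x0 = (x1 + x2) / 2"
  define y0 where "y0 = (y1 + y2) / 2"
  have X: "X = w + x0 *\<^sub>R e1 + y0 *\<^sub>R e2"
  proof -
    have "2 *\<^sub>R X = p + (2 *\<^sub>R X - p)" by simp
    also have "\<dots> = 2 *\<^sub>R (w + x0 *\<^sub>R e1 + y0 *\<^sub>R e2)"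
      unfolding 2 unfolding 1 x0_def y0_def by (simp add: algebra_simps add_divide_distrib scaleR_2)
    finally show ?thesis by simp
  qed
  define d' where "d' = a * x0 + b * y0 + d"
  define e' where "e' = b * x0 + c * y0 + e"
  define f' where "f' = R x0 y0"
  define K where "K x y = a * x\<^sup>2 + 2 * b * x * y + c * y\<^sup>2" for x y
  have RK: "R (x0 + x) (y0 + y) = K x y + 2 * (d' * x + e' * y) + f'" for x y
    unfolding R_def K_def d'_def e'_def f'_def by (simp add: power2_eq_square algebra_simps)
  have det': "a * (c * f' - e' * e') - b * (b * f' - e' * d') + d' * (b * e' - c * d') \<noteq> 0"
    using det quadratic_shift_det[of a c x0 b y0 d e f] unfolding d'_def e'_def f'_def R_def
    by (simp add: mult_ac)
  have pts: "\<exists>x y. q = X + x *\<^sub>R e1 + y *\<^sub>R e2 \<and> d' * x + e' * y = 0 \<and> K x y + f' = 0" if q: "q \<in> \<Gamma>" for q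
  proof -
    obtain x y where e: "q = w + x *\<^sub>R e1 + y *\<^sub>R e2" using \<Gamma>R[OF q] by blast
    define u where "u = x - x0"
    define v where "v = y - y0"
    have qe: "q = w + (x0 + u) *\<^sub>R e1 + (y0 + v) *\<^sub>R e2" unfolding e u_def v_def by simp
    have "2 *\<^sub>R X - q = w + (x0 + - u) *\<^sub>R e1 + (y0 + - v) *\<^sub>R e2"
      unfolding qe X by (rule point_reflection_coordinates)
    moreover have "2 *\<^sub>R X - q \<in> \<Gamma>" using cc q unfolding conic_center_def by blast
    ultimately have "R (x0 + - u) (y0 + - v) = 0" using R0 by metis
    moreover have "R (x0 + u) (y0 + v) = 0" using R0 q qe by metis
    ultimately have "K u v + 2 * (d' * u + e' * v) + f' = 0" "K u v - 2 * (d' * u + e' * v) + f' = 0"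
      unfolding RK by (simp_all add: K_def algebra_simps)
    then have "d' * u + e' * v = 0 \<and> K u v + f' = 0" by argo
    moreover have "q = X + u *\<^sub>R e1 + v *\<^sub>R e2" unfolding qe X by (simp add: algebra_simps)
    ultimately show ?thesis by blast
  qed
  have lin0: "d' = 0 \<and> e' = 0"
  proof (rule ccontr)
    assume "\<not> ?thesis"
    then have N: "d'\<^sup>2 + e'\<^sup>2 \<noteq> 0" by (simp add: sum_power2_eq_zero_iff)
    define k where "k = K e' (- d')"
    have par: "\<exists>s. q = X + s *\<^sub>R (e' *\<^sub>R e1 - d' *\<^sub>R e2) \<and> s\<^sup>2 * k + f' = 0" if q: "q \<in> \<Gamma>" for q
    proof -
      obtain x y where e: "q = X + x *\<^sub>R e1 + y *\<^sub>R e2" "d' * x + e' * y = 0" "K x y + f' = 0"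
        using pts[OF q] by blast
      \<comment> \<open>The coordinate of \<open>(x, y)\<close> along \<open>(e', - d')\<close>, which spans the kernel of the linear form.\<close>
      define s where "s = (x * e' - y * d') / (d'\<^sup>2 + e'\<^sup>2)"
      have x: "x = s * e'"
      proof -
        have "x * (d'\<^sup>2 + e'\<^sup>2) = (x * e' - y * d') * e'" using e(2) by algebra
        then show ?thesis unfolding s_def using N by (simp add: field_simps)
      qed
      have y: "y = - s * d'"
      proof -
        have "y * (d'\<^sup>2 + e'\<^sup>2) = - (x * e' - y * d') * d'" using e(2) by algebra
        then show ?thesis unfolding s_def using N by (simp add: field_simps)
      qed
      have "K x y = s\<^sup>2 * k" unfolding x y k_def K_def by (simp add: power2_eq_square algebra_simps)
      moreover have "q = X + s *\<^sub>R (e' *\<^sub>R e1 - d' *\<^sub>R e2)" unfolding e(1) x y by (simp add: algebra_simps)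
      ultimately show ?thesis using e(3) by auto
    qed
    show False
    proof (cases "k = 0")
      case True
      then have "f' = 0" using par[OF p] by auto
      moreover have "a * e'\<^sup>2 - 2 * b * e' * d' + c * d'\<^sup>2 = 0" using True by (simp add: k_def K_def)
      ultimately show False using det' by (simp add: power2_eq_square algebra_simps)
    next
      case False
      have "\<Gamma> \<subseteq> (\<lambda>s. X + s *\<^sub>R (e' *\<^sub>R e1 - d' *\<^sub>R e2)) ` {s. s\<^sup>2 = - f' / k}"
      proof
        fix q assume "q \<in> \<Gamma>"
        then obtain s where s: "q = X + s *\<^sub>R (e' *\<^sub>R e1 - d' *\<^sub>R e2)" "s\<^sup>2 * k + f' = 0" using par by blast
        then have "s\<^sup>2 = - f' / k" using False by (simp add: field_simps)
        then show "q \<in> (\<lambda>s. X + s *\<^sub>R (e' *\<^sub>R e1 - d' *\<^sub>R e2)) ` {s. s\<^sup>2 = - f' / k}" using s(1) by blast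
      qed
      then show False using inf finite_subset finite_imageI[OF finite_square_roots] by metis
    qed
  qed
  then have f': "f' \<noteq> 0" using det' by auto
  define Q where "Q u v = (a * \<phi> u * \<phi> v + b * (\<phi> u * \<psi> v + \<psi> u * \<phi> v) + c * \<psi> u * \<psi> v) / (- f')" for u v
  have lf: "linear (\<lambda>u. (x * \<phi> u + y * \<psi> u) / k)" for x y k
    by (rule linearI) (use \<phi>(1) \<psi>(1) in \<open>simp_all add: linear_add linear_scale algebra_simps add_divide_distrib\<close>)
  have "linear (Q u)" for u
  proof -
    have "Q u = (\<lambda>v. ((a * \<phi> u + b * \<psi> u) * \<phi> v + (b * \<phi> u + c * \<psi> u) * \<psi> v) / (- f'))"
      unfolding Q_def by (simp add: fun_eq_iff algebra_simps)
    then show ?thesis by (simp only: lf)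
  qed
  moreover have sym: "Q u v = Q v u" for u v unfolding Q_def by (simp add: algebra_simps)
  ultimately have "bilinear Q" unfolding bilinear_def using ext[OF sym] by (metis (no_types, lifting) ext)
  moreover have "\<forall>q\<in>\<Gamma>. q - X \<in> span {e1, e2} \<and> Q (q - X) (q - X) = 1"
  proof
    fix q assume "q \<in> \<Gamma>"
    then obtain x y where e: "q = X + x *\<^sub>R e1 + y *\<^sub>R e2" "K x y + f' = 0" using pts by blast
    have qX: "q - X = x *\<^sub>R e1 + y *\<^sub>R e2" unfolding e(1) by simp
    have "K x y = - f'" using e(2) by simp
    then have "Q (q - X) (q - X) = 1"
      unfolding qX Q_def co using f' by (simp add: K_def power2_eq_square algebra_simps)
    moreover have "q - X \<in> span {e1, e2}"
      unfolding qX by (intro span_add span_scale span_base) auto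
    ultimately show "q - X \<in> span {e1, e2} \<and> Q (q - X) (q - X) = 1" by blast
  qed
  moreover have "dim (span {e1, e2}) = 2"
    using dim_eq_card_independent[OF ind] ne by simp
  ultimately show ?thesis using that[of "span {e1, e2}" Q] sym by simp
qed

lemma derivative_of_constant_on:
  fixes F :: "'a::real_normed_vector \<Rightarrow> real"
  assumes "open I" "t \<in> I" "\<And>s. s \<in> I \<Longrightarrow> F s = k" "(F has_derivative D) (at t)"
  shows "D v = 0"
proof -
  have "(F has_derivative (\<lambda>_. 0)) (at t)"
    by (rule has_derivative_transform_within_open[OF has_derivative_const[of k] assms(1,2)])
      (simp add: assms(3))
  from has_derivative_unique[OF assms(4) this] show ?thesis by simp
qed

text \<open>The component of the derivative that is orthogonal to the subspace is the derivative of a vanishing function.\<close>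

lemma derivative_in_subspace:
  fixes \<gamma> :: "'b::real_normed_vector \<Rightarrow> 'a::euclidean_space"
  assumes P: "subspace P" and \<gamma>: "(\<gamma> has_derivative D) (at t)"
    and I: "open I" "t \<in> I" and mem: "\<And>s. s \<in> I \<Longrightarrow> \<gamma> s \<in> P"
  shows "D v \<in> P"
proof -
  obtain y z where y: "y \<in> span P" and z: "\<And>w. w \<in> span P \<Longrightarrow> orthogonal z w" and e: "D v = y + z"
    using orthogonal_subspace_decomp_exists[of P "D v"] by metis
  have sP: "span P = P" using P by (simp add: span_eq_iff)
  have "((\<lambda>s. z \<bullet> \<gamma> s) has_derivative (\<lambda>v. z \<bullet> D v)) (at t)"
    by (rule has_derivative_inner_right[OF \<gamma>])
  then have "z \<bullet> D v = 0"
    by (rule derivative_of_constant_on[OF I, rotated]) (use z mem sP in \<open>auto simp: orthogonal_def\<close>)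
  then have "z \<bullet> z = 0" using z[OF y] unfolding e by (simp add: inner_right_distrib orthogonal_def)
  then show ?thesis using y sP e by simp
qed

text \<open>Differentiate \<open>Q(c - X, c - X) = 1\<close> twice.\<close>

lemma conic_curve_relations:
  fixes c :: "real \<Rightarrow> 'a::euclidean_space" and Q :: "'a \<Rightarrow> 'a \<Rightarrow> real"
  assumes P: "subspace P" and Q: "bilinear Q" "\<And>u w. Q u w = Q w u"
    and c: "smooth_on {-\<epsilon><..<\<epsilon>} c" and \<epsilon>: "\<epsilon> > 0"
    and on: "\<And>t. t \<in> {-\<epsilon><..<\<epsilon>} \<Longrightarrow> c t - X \<in> P \<and> Q (c t - X) (c t - X) = 1"
  shows "dird c 1 0 \<in> P" "dird (dird c 1) 1 0 \<in> P" "Q (c 0 - X) (dird c 1 0) = 0"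
    "Q (dird c 1 0) (dird c 1 0) + Q (c 0 - X) (dird (dird c 1) 1 0) = 0"
proof -
  let ?I = "{-\<epsilon><..<\<epsilon>}"
  define \<gamma> where "\<gamma> t = c t + - X" for t
  have \<gamma>: "smooth_on ?I \<gamma>"
    using c unfolding smooth_on_def \<gamma>_def by (intro allI Ck_on_add Ck_on_const) auto
  have on': "\<gamma> t \<in> P" "Q (\<gamma> t) (\<gamma> t) = 1" if "t \<in> ?I" for t
    using on[OF that] by (auto simp: \<gamma>_def)
  have c': "dird c 1 t = dird \<gamma> 1 t" if "t \<in> ?I" for t
  proof -
    have "(\<gamma> has_derivative (\<lambda>v. dird c v t + 0)) (at t)"
      unfolding \<gamma>_def by (rule has_derivative_add[OF smooth_on_has_derivative[OF c that] has_derivative_const])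
    from fun_cong[OF frechet_derivative_at[OF this], of 1] show ?thesis by simp
  qed
  have 0: "0 \<in> ?I" using \<epsilon> by auto
  have c'': "dird (dird c 1) 1 0 = dird (dird \<gamma> 1) 1 0"
    by (rule dird_real_cong[OF _ \<epsilon>]) (rule c', auto)
  have \<gamma>'P: "dird \<gamma> 1 t \<in> P" if "t \<in> ?I" for t
    by (rule derivative_in_subspace[OF P smooth_on_has_derivative[OF \<gamma> that] _ that on'(1)]) simp
  show "dird c 1 0 \<in> P" using \<gamma>'P[OF 0] c'[OF 0] by simp
  show "dird (dird c 1) 1 0 \<in> P"
    unfolding c'' by (rule derivative_in_subspace[OF P smooth_on_has_derivative[OF smooth_on_dird[OF \<gamma>] 0] _ 0 \<gamma>'P]) simp
  have bb: "bounded_bilinear Q" using Q(1) by (simp add: bilinear_conv_bounded_bilinear)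
  have oI: "open ?I" by simp
  note const0 = derivative_of_constant_on[OF oI]
  have 1: "Q (\<gamma> t) (dird \<gamma> 1 t) = 0" if t: "t \<in> ?I" for t
  proof -
    have "((\<lambda>t. Q (\<gamma> t) (\<gamma> t)) has_derivative (\<lambda>s. Q (\<gamma> t) (dird \<gamma> s t) + Q (dird \<gamma> s t) (\<gamma> t))) (at t)"
      by (rule bounded_bilinear.FDERIV[OF bb smooth_on_has_derivative[OF \<gamma> t] smooth_on_has_derivative[OF \<gamma> t]])
    from const0[OF t on'(2) this, of 1] show ?thesis using Q(2)[of "\<gamma> t"] by simp
  qed
  then show "Q (c 0 - X) (dird c 1 0) = 0" using 0 c'[OF 0] by (simp add: \<gamma>_def)
  have "((\<lambda>t. Q (\<gamma> t) (dird \<gamma> 1 t)) has_derivative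
      (\<lambda>s. Q (\<gamma> 0) (dird (dird \<gamma> 1) s 0) + Q (dird \<gamma> s 0) (dird \<gamma> 1 0))) (at 0)"
    by (rule bounded_bilinear.FDERIV[OF bb smooth_on_has_derivative[OF \<gamma> 0]
          smooth_on_has_derivative[OF smooth_on_dird[OF \<gamma>] 0]])
  from const0[OF 0 1 this, of 1]
  show "Q (dird c 1 0) (dird c 1 0) + Q (c 0 - X) (dird (dird c 1) 1 0) = 0"
    unfolding c'' c'[OF 0] by (simp add: \<gamma>_def)
qed

text \<open>The image of a regular curve is connected and is not a single point.\<close>

lemma contact3_infinite:
  assumes "contact3 \<Gamma> S p Y"
  shows "infinite \<Gamma>"
proof
  assume fin: "finite \<Gamma>"
  obtain \<epsilon> c where \<epsilon>: "\<epsilon> > 0" and c: "smooth_on {-\<epsilon><..<\<epsilon>} c"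
    "\<And>t. t \<in> {-\<epsilon><..<\<epsilon>} \<Longrightarrow> c t \<in> \<Gamma> \<and> vector_derivative c (at t) \<noteq> 0"
    using assms unfolding contact3_def by blast
  let ?I = "{-\<epsilon><..<\<epsilon>}"
  have "connected (c ` ?I)" by (rule connected_continuous_image[OF smooth_on_continuous_on[OF c(1)]]) simp
  moreover have "finite (c ` ?I)" by (rule finite_subset[OF _ fin]) (use c(2) in auto)
  ultimately have "c ` ?I = {} \<or> (\<exists>x. c ` ?I = {x})" by (simp add: connected_finite_iff_sing)
  then obtain x where "c ` ?I = {x}" using \<epsilon> by fastforce
  then have x: "c t = x" if "t \<in> ?I" for t using that by blast
  have "(c has_vector_derivative 0) (at 0)"
    by (rule has_vector_derivative_transform_within_open[OF has_vector_derivative_const[of x], of ?I])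
      (use x \<epsilon> in auto)
  then show False using c(2)[of 0] \<epsilon> vector_derivative_at by fastforce
qed

text \<open>All that is needed of a contact of order at least 3 with a central conic: the velocity \<open>v\<close> and the acceleration
\<open>k\<close> of one curve satisfy the second-order equations of the conic and of the hypersurface.\<close>

lemma contact3_conic_data:
  fixes \<Gamma> S :: "(real^'n) set" and Q :: "real^'n \<Rightarrow> real^'n \<Rightarrow> real"
  assumes ct: "contact3 \<Gamma> S p Y" and P: "subspace P" and Q: "bilinear Q" "\<forall>u w. Q u w = Q w u"
    and \<Gamma>: "\<forall>q\<in>\<Gamma>. q - X \<in> P \<and> Q (q - X) (q - X) = 1"
  obtains U g v k where "local_defining_function S p U g" "v \<noteq> 0" "\<exists>r. v = r *\<^sub>R Y"
    "dird g v p = 0" "dird (dird g v) v p + dird g k p = 0"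
    "p - X \<in> P" "Q (p - X) (p - X) = 1" "v \<in> P" "Q (p - X) v = 0" "k \<in> P" "Q v v + Q (p - X) k = 0"
proof -
  obtain \<epsilon> c U g where \<epsilon>: "\<epsilon> > 0" and c: "smooth_on {-\<epsilon><..<\<epsilon>} c"
    and on: "\<And>t. t \<in> {-\<epsilon><..<\<epsilon>} \<Longrightarrow> c t \<in> \<Gamma> \<and> vector_derivative c (at t) \<noteq> 0"
    and c0: "c 0 = p" and dir: "\<exists>r. vector_derivative c (at 0) = r *\<^sub>R Y"
    and g: "local_defining_function S p U g" and O: "(\<lambda>t. g (c t)) \<in> O[at 0](\<lambda>t::real. t ^ 3)"
    using ct unfolding contact3_def by blast
  note gD = local_defining_functionD[OF g]
  have 0: "0 \<in> {-\<epsilon><..<\<epsilon>}" using \<epsilon> by simp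
  have "c differentiable (at 0)"
    using smooth_on_has_derivative[OF c 0] unfolding differentiable_def by blast
  then have vd: "dird c 1 0 = vector_derivative c (at 0)"
    using frechet_derivative_eq_vector_derivative[of c 0] by simp
  have on': "\<And>t. t \<in> {-\<epsilon><..<\<epsilon>} \<Longrightarrow> c t - X \<in> P \<and> Q (c t - X) (c t - X) = 1"
    using on \<Gamma> by blast
  note rel = conic_curve_relations[OF P Q(1) Q(2)[rule_format] c \<epsilon> on', unfolded c0]
  have contact: "dird g (dird c 1 0) p = 0"
     "dird (dird g (dird c 1 0)) (dird c 1 0) p + dird g (dird (dird c 1) 1 0) p = 0"
    using O smooth_curve_contact_iff[OF gD(3,1) _ c \<epsilon>] gD(2) unfolding c0 by auto
  have "p - X \<in> P \<and> Q (p - X) (p - X) = 1" using on'[OF 0] c0 by simp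
  moreover have "dird c 1 0 \<noteq> 0" "\<exists>r. dird c 1 0 = r *\<^sub>R Y" unfolding vd using on[OF 0] dir by auto
  ultimately show ?thesis using that[OF g _ _ contact _ _ rel(1,3,2,4)] by blast
qed

section \<open>The envelope equations of a pair of hypersurfaces\<close>

locale surface_chart =
  fixes S :: "(real^'n) set" and \<xi> :: "real^'n \<Rightarrow> real^'n" and p :: "real^'n"
    and U :: "(real^'n) set" and g :: "real^'n \<Rightarrow> real"
  assumes convex: "locally_convex_hypersurface S" and field: "transversal_field S \<xi>"
    and nondegenerate: "nondegenerate_hypersurface S \<xi>"
    and point: "p \<in> S" and chart: "local_defining_function S p U g"
begin

abbreviation "n v \<equiv> dird g v p"
abbreviation "B u w \<equiv> dird (dird g w) u p"

lemmas chartD = local_defining_functionD[OF chart]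

lemma n_linear: "linear n"
  by (rule dird_linear[OF chartD(3,2)])

lemma tangent_iff: "u \<in> tangent_space S p \<longleftrightarrow> n u = 0"
  using tangent_space_eq_kernel[OF convex point chart] by simp

lemma n_normal: "n (\<xi> p) \<noteq> 0"
  using transversal_field_nonzero[OF field point] tangent_space_eq_kernel[OF convex point chart] by blast

lemma B_bilinear: "bilinear B"
  by (rule second_form_bilinear[OF chartD(3,1,2)])

lemma B_sym: "B u w = B w u"
  by (rule second_derivative_symmetric[OF chartD(3,1,2)])

lemma B_definite: "n u = 0 \<Longrightarrow> B u u = 0 \<Longrightarrow> u = 0"
  by (rule second_form_definite[OF convex nondegenerate point chart n_normal])

lemma metric_zero_iff:
  assumes "n u = 0" "n w = 0"
  shows "affine_metric S \<xi> p u w = 0 \<longleftrightarrow> B u w = 0"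
proof -
  have T: "tangent_space S q = {v. dird g v q = 0}" if "q \<in> S \<inter> U" for q
    by (rule tangent_space_eq_kernel[OF convex _ local_defining_function_at[OF chart]]) (use that in auto)
  show ?thesis using affine_metric_eq[of S p U g \<xi> u w, OF chart point T n_normal assms] n_normal by simp
qed

lemma conormal: "conormal S \<xi> p v = n v / n (\<xi> p)"
  using fun_cong[OF conormal_eq[of g p S \<xi>, OF n_linear _ n_normal], of v]
    tangent_space_eq_kernel[OF convex point chart] by simp

end

locale surface_pair =
  s1: surface_chart S1 \<xi>1 p1 U1 g1 + s2: surface_chart S2 \<xi>2 p2 U2 g2
  for S1 S2 :: "(real^'n) set" and \<xi>1 \<xi>2 p1 p2 U1 U2 g1 g2 +
  assumes transversal: "transversal_hypersurfaces S1 S2"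
begin

abbreviation "C \<equiv> (1/2) *\<^sub>R (p1 - p2)"
abbreviation "E X \<equiv> X - (1/2) *\<^sub>R (p1 + p2)"
abbreviation "m \<equiv> s1.n (\<xi>1 p1) * s2.n (\<xi>2 p2)"

text \<open>By transversality, a functional that vanishes on both tangent spaces is zero.\<close>

lemma tangent_not_subset: "\<exists>u. s1.n u = 0 \<and> s2.n u \<noteq> 0" "\<exists>u. s2.n u = 0 \<and> s1.n u \<noteq> 0"
proof -
  have sum: "\<exists>u v. x = u + v \<and> s1.n u = 0 \<and> s2.n v = 0" for x
  proof -
    have "x \<in> {u + v | u v. u \<in> tangent_space S1 p1 \<and> v \<in> tangent_space S2 p2}"
      using transversal s1.point s2.point unfolding transversal_hypersurfaces_def by blast
    then show ?thesis unfolding s1.tangent_iff s2.tangent_iff by blast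
  qed
  obtain u v where "\<xi>2 p2 = u + v" "s1.n u = 0" "s2.n v = 0" using sum by blast
  then show "\<exists>u. s1.n u = 0 \<and> s2.n u \<noteq> 0"
    using s2.n_normal linear_add[OF s2.n_linear, of u v] by auto
  obtain u v where "\<xi>1 p1 = u + v" "s1.n u = 0" "s2.n v = 0" using sum by blast
  then show "\<exists>u. s2.n u = 0 \<and> s1.n u \<noteq> 0"
    using s1.n_normal linear_add[OF s1.n_linear, of u v] by auto
qed

lemma has_mid_hyperplane_iff: "has_mid_hyperplane S1 S2 p1 p2 \<longleftrightarrow> s1.n C \<noteq> 0 \<or> s2.n C \<noteq> 0"
proof -
  have aff: "x \<in> affine_tangent_space S p \<longleftrightarrow> x - p \<in> tangent_space S p" for x p and S :: "(real^'n) set"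
    unfolding affine_tangent_space_def by (auto intro: exI[of _ "x - p"])
  have half: "(1/2) *\<^sub>R x + (1/2) *\<^sub>R x = x" for x :: "real^'n"
    by (simp add: scaleR_left_distrib[symmetric])
  have e1: "(1/2) *\<^sub>R (p1 + p2) - p1 = - C" and e2: "(1/2) *\<^sub>R (p1 + p2) - p2 = C"
    using half[of p1] half[of p2] by (simp_all add: algebra_simps)
  show ?thesis
    unfolding has_mid_hyperplane_def aff e1 e2 Int_iff s1.tangent_iff s2.tangent_iff
      linear_neg[OF s1.n_linear] by auto
qed

lemma mid_hyperplane_fun_eq:
  "mid_hyperplane_fun S1 \<xi>1 S2 \<xi>2 p1 p2 X = (s2.n C * s1.n (E X) + s1.n C * s2.n (E X)) / m"
  unfolding mid_hyperplane_fun_def Let_def s1.conormal s2.conormal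
  using s1.n_normal s2.n_normal by (simp add: field_simps)

lemma deriv_mid_hyperplane_1:
  assumes F: "s2.n C * s1.n (E X) + s1.n C * s2.n (E X) = 0" and u: "s1.n u = 0"
  shows "deriv_along S1 (\<lambda>q. mid_hyperplane_fun S1 \<xi>1 S2 \<xi>2 q p2 X) p1 u =
    (s1.B u (s2.n C *\<^sub>R E X + s2.n (E X) *\<^sub>R C) + s2.n u * (s1.n (E X) - s1.n C) / 2) / m"
proof -
  define k where "k = s2.n (\<xi>2 p2)"
  have k: "k \<noteq> 0" using s2.n_normal by (simp add: k_def)
  have \<beta>: "conormal S2 \<xi>2 p2 v = s2.n v / k" for v using s2.conormal k_def by simp
  have "deriv_along S1 (\<lambda>q. mid_hyperplane_fun S1 \<xi>1 S2 \<xi>2 q p2 X) p1 u =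
    (s1.B u (conormal S2 \<xi>2 p2 C *\<^sub>R E X + conormal S2 \<xi>2 p2 (E X) *\<^sub>R C)
      + conormal S2 \<xi>2 p2 u * (s1.n (E X) - s1.n C) / 2) / s1.n (\<xi>1 p1)"
    by (rule deriv_along_mid_hyperplane[OF s1.convex s1.field s1.point s1.chart
          conormal_linear[OF s2.convex s2.field s2.point] _ _ u])
      (use F in \<open>simp_all add: mid_hyperplane_fun_def Let_def mid_hyperplane_fun_eq[unfolded mid_hyperplane_fun_def Let_def]\<close>)
  also have "conormal S2 \<xi>2 p2 C *\<^sub>R E X + conormal S2 \<xi>2 p2 (E X) *\<^sub>R C
     = (1/k) *\<^sub>R (s2.n C *\<^sub>R E X + s2.n (E X) *\<^sub>R C)"
    unfolding \<beta> by (simp add: scaleR_right_distrib)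
  also have "s1.B u \<dots> = s1.B u (s2.n C *\<^sub>R E X + s2.n (E X) *\<^sub>R C) / k"
    using bilinear_rmul[OF s1.B_bilinear] by simp
  finally have eq: "deriv_along S1 (\<lambda>q. mid_hyperplane_fun S1 \<xi>1 S2 \<xi>2 q p2 X) p1 u =
    (s1.B u (s2.n C *\<^sub>R E X + s2.n (E X) *\<^sub>R C) / k + s2.n u / k * (s1.n (E X) - s1.n C) / 2) / s1.n (\<xi>1 p1)"
    unfolding \<beta> .
  have "(b / k + a / k * d / 2) / m' = (b + a * d / 2) / (m' * k)" for a b d m' :: real
    using k by (simp add: field_simps)
  then show ?thesis unfolding eq k_def .
qed

text \<open>The mid-hyperplane function changes sign when the two hypersurfaces are exchanged, because \<open>C\<close> does. Hence
\<open>deriv_along_mid_hyperplane\<close> applies with \<open>\<beta> = - \<nu>\<^sub>1\<close>.\<close>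

lemma deriv_mid_hyperplane_2:
  assumes F: "s2.n C * s1.n (E X) + s1.n C * s2.n (E X) = 0" and u: "s2.n u = 0"
  shows "deriv_along S2 (\<lambda>q. mid_hyperplane_fun S1 \<xi>1 S2 \<xi>2 p1 q X) p2 u =
    (s2.B u (s1.n C *\<^sub>R E X + s1.n (E X) *\<^sub>R C) - s1.n u * (s2.n (E X) + s2.n C) / 2) / m"
proof -
  define k where "k = s1.n (\<xi>1 p1)"
  define \<beta> where "\<beta> v = - conormal S1 \<xi>1 p1 v" for v
  have k: "k \<noteq> 0" using s1.n_normal by (simp add: k_def)
  have \<beta>e: "\<beta> v = - s1.n v / k" for v using s1.conormal k_def by (simp add: \<beta>_def)
  note lin1 = conormal_linear[OF s1.convex s1.field s1.point]
  have \<beta>lin: "linear \<beta>" unfolding \<beta>_def using linear_compose_neg[OF lin1] by simp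
  have Cq: "(1/2) *\<^sub>R (q - p1) = - ((1/2) *\<^sub>R (p1 - q))" for q by (simp add: algebra_simps)
  have f: "mid_hyperplane_fun S1 \<xi>1 S2 \<xi>2 p1 q X = \<beta> ((1/2) *\<^sub>R (q - p1)) * conormal S2 \<xi>2 q (X - (1/2) *\<^sub>R (q + p1))
      + conormal S2 \<xi>2 q ((1/2) *\<^sub>R (q - p1)) * \<beta> (X - (1/2) *\<^sub>R (q + p1))" if "q \<in> S2" for q
    unfolding mid_hyperplane_fun_def Let_def Cq \<beta>_def linear_neg[OF lin1]
      linear_neg[OF conormal_linear[OF s2.convex s2.field that]] add.commute[of q p1]
    by simp
  have "deriv_along S2 (\<lambda>q. mid_hyperplane_fun S1 \<xi>1 S2 \<xi>2 p1 q X) p2 u =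
    (s2.B u (\<beta> ((1/2) *\<^sub>R (p2 - p1)) *\<^sub>R (X - (1/2) *\<^sub>R (p2 + p1)) + \<beta> (X - (1/2) *\<^sub>R (p2 + p1)) *\<^sub>R ((1/2) *\<^sub>R (p2 - p1)))
      + \<beta> u * (s2.n (X - (1/2) *\<^sub>R (p2 + p1)) - s2.n ((1/2) *\<^sub>R (p2 - p1))) / 2) / s2.n (\<xi>2 p2)"
    by (rule deriv_along_mid_hyperplane[OF s2.convex s2.field s2.point s2.chart \<beta>lin f _ u])
      (use F mid_hyperplane_fun_eq[of X] in auto)
  also have "\<beta> ((1/2) *\<^sub>R (p2 - p1)) *\<^sub>R (X - (1/2) *\<^sub>R (p2 + p1)) + \<beta> (X - (1/2) *\<^sub>R (p2 + p1)) *\<^sub>R ((1/2) *\<^sub>R (p2 - p1))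
     = (1/k) *\<^sub>R (s1.n C *\<^sub>R E X + s1.n (E X) *\<^sub>R C)"
    unfolding Cq \<beta>e linear_neg[OF s1.n_linear] add.commute[of p2 p1] by (simp add: scaleR_right_distrib)
  also have "s2.B u \<dots> = s2.B u (s1.n C *\<^sub>R E X + s1.n (E X) *\<^sub>R C) / k"
    using bilinear_rmul[OF s2.B_bilinear] by simp
  finally have eq: "deriv_along S2 (\<lambda>q. mid_hyperplane_fun S1 \<xi>1 S2 \<xi>2 p1 q X) p2 u =
    (s2.B u (s1.n C *\<^sub>R E X + s1.n (E X) *\<^sub>R C) / k + - s1.n u / k * (s2.n (E X) - - s2.n C) / 2) / s2.n (\<xi>2 p2)"
    unfolding Cq linear_neg[OF s2.n_linear] \<beta>e add.commute[of p2 p1] .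
  have "(b / k + - a / k * (d - - d') / 2) / m' = (b - a * (d + d') / 2) / (k * m')" for a b d d' m' :: real
    using k by (simp add: field_simps)
  then show ?thesis unfolding eq k_def .
qed

text \<open>The conditions that the envelope imposes on the pair of points, freed from the common factor \<open>1 / m\<close> and
expressed by derivatives of the defining functions only.\<close>

definition envelope_equations :: "real^'n \<Rightarrow> bool" where
  "envelope_equations X \<longleftrightarrow>
     (s1.n C \<noteq> 0 \<or> s2.n C \<noteq> 0) \<and> s2.n C * s1.n (E X) + s1.n C * s2.n (E X) = 0 \<and>
     (\<forall>u. s1.n u = 0 \<longrightarrow>
        s1.B u (s2.n C *\<^sub>R E X + s2.n (E X) *\<^sub>R C) + s2.n u * (s1.n (E X) - s1.n C) / 2 = 0) \<and>
     (\<forall>u. s2.n u = 0 \<longrightarrow>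
        s2.B u (s1.n C *\<^sub>R E X + s1.n (E X) *\<^sub>R C) - s1.n u * (s2.n (E X) + s2.n C) / 2 = 0)"

lemma envelope_equations_iff:
  "envelope_equations X \<longleftrightarrow>
     has_mid_hyperplane S1 S2 p1 p2 \<and> mid_hyperplane_fun S1 \<xi>1 S2 \<xi>2 p1 p2 X = 0 \<and>
     (\<forall>u\<in>tangent_space S1 p1. deriv_along S1 (\<lambda>q. mid_hyperplane_fun S1 \<xi>1 S2 \<xi>2 q p2 X) p1 u = 0) \<and>
     (\<forall>u\<in>tangent_space S2 p2. deriv_along S2 (\<lambda>q. mid_hyperplane_fun S1 \<xi>1 S2 \<xi>2 p1 q X) p2 u = 0)"
proof -
  have m: "m \<noteq> 0" using s1.n_normal s2.n_normal by simp
  show ?thesis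
  proof (cases "s2.n C * s1.n (E X) + s1.n C * s2.n (E X) = 0")
    case True
    show ?thesis
      unfolding envelope_equations_def has_mid_hyperplane_iff mid_hyperplane_fun_eq[of X]
      using deriv_mid_hyperplane_1[OF True] deriv_mid_hyperplane_2[OF True] m True
      by (simp add: Ball_def s1.tangent_iff s2.tangent_iff)
  next
    case False
    then show ?thesis unfolding envelope_equations_def mid_hyperplane_fun_eq[of X] using m by simp
  qed
qed

text \<open>Exchanging the hypersurfaces replaces \<open>C\<close> by \<open>- C\<close> and carries the second envelope equation into the form
of the first.\<close>

lemma second_equation_swap:
  "s2.B u (s1.n (- C) *\<^sub>R Z + s1.n Z *\<^sub>R (- C)) + s1.n u * (s2.n Z - s2.n (- C)) / 2
     = - (s2.B u (s1.n C *\<^sub>R Z + s1.n Z *\<^sub>R C) - s1.n u * (s2.n Z + s2.n C) / 2)"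
proof -
  have "s1.n (- C) *\<^sub>R Z + s1.n Z *\<^sub>R (- C) = - (s1.n C *\<^sub>R Z + s1.n Z *\<^sub>R C)"
    unfolding linear_neg[OF s1.n_linear] by simp
  then have "s2.B u (s1.n (- C) *\<^sub>R Z + s1.n Z *\<^sub>R (- C)) = - s2.B u (s1.n C *\<^sub>R Z + s1.n Z *\<^sub>R C)"
    by (simp only: bilinear_rneg[OF s2.B_bilinear])
  then show ?thesis by (simp only: linear_neg[OF s2.n_linear]) simp
qed

lemma conic_center_satisfies_envelope_equations:
  fixes Q :: "real^'n \<Rightarrow> real^'n \<Rightarrow> real"
  assumes P: "subspace P" "dim P = 2" and Q: "bilinear Q" "\<And>u w. Q u w = Q w u"
    and q1: "p1 - X \<in> P" "Q (p1 - X) (p1 - X) = 1"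
    and v1: "v1 \<in> P" "v1 \<noteq> 0" "Q (p1 - X) v1 = 0" "s1.n v1 = 0"
    and k1: "k1 \<in> P" "Q v1 v1 + Q (p1 - X) k1 = 0" "s1.B v1 v1 + s1.n k1 = 0"
    and q2: "p2 - X \<in> P" "Q (p2 - X) (p2 - X) = 1"
    and v2: "v2 \<in> P" "v2 \<noteq> 0" "Q (p2 - X) v2 = 0" "s2.n v2 = 0"
    and k2: "k2 \<in> P" "Q v2 v2 + Q (p2 - X) k2 = 0" "s2.B v2 v2 + s2.n k2 = 0"
    and orth1: "\<And>u. s1.n u = 0 \<Longrightarrow> s2.n u = 0 \<Longrightarrow> s1.B u v1 = 0"
    and orth2: "\<And>u. s1.n u = 0 \<Longrightarrow> s2.n u = 0 \<Longrightarrow> s2.B u v2 = 0"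
  shows "envelope_equations X"
proof -
  \<comment> \<open>A contact direction in the intersection of the tangent spaces would be orthogonal to itself.\<close>
  have nv: "s2.n v1 \<noteq> 0" "s1.n v2 \<noteq> 0"
    using orth1[OF v1(4)] s1.B_definite[OF v1(4)] v1(2) orth2[OF _ v2(4)] s2.B_definite[OF v2(4)] v2(2) by auto
  interpret c: two_conic_tangents P Q s1.n s2.n "p1 - X" v1 "p2 - X" v2
    by (rule two_conic_tangents.intro[OF P Q s1.n_linear s2.n_linear q1 v1 q2 v2 nv])
  interpret c': two_conic_tangents P Q s2.n s1.n "p2 - X" v2 "p1 - X" v1
    by (rule two_conic_tangents.intro[OF P Q s2.n_linear s1.n_linear q2 v2 q1 v1 nv(2,1)])
  have C1: "c.C = C" and C2: "c'.C = - C"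
    by (simp_all add: algebra_simps)
  have X2: "X = (1/2) *\<^sub>R X + (1/2) *\<^sub>R X" by (simp add: scaleR_left_distrib[symmetric])
  have E1: "c.E = E X" and E2: "c'.E = E X"
    using X2 by (simp_all add: algebra_simps)
  have "s1.B u (s2.n C *\<^sub>R E X + s2.n (E X) *\<^sub>R C) + s2.n u * (s1.n (E X) - s1.n C) / 2 = 0"
    if "s1.n u = 0" for u
    using c.envelope_equation[OF s1.B_bilinear k1 orth1 that] unfolding C1 E1 .
  moreover have "s2.B u (s1.n C *\<^sub>R E X + s1.n (E X) *\<^sub>R C) - s1.n u * (s2.n (E X) + s2.n C) / 2 = 0"
    if "s2.n u = 0" for u
    using c'.envelope_equation[OF s2.B_bilinear k2 orth2 that] unfolding C2 E2 second_equation_swap by simp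
  moreover have "s1.n C \<noteq> 0" "s2.n C * s1.n (E X) + s1.n C * s2.n (E X) = 0"
    using c.n1_C_nonzero c.mid_hyperplane_equation unfolding C1 E1 by auto
  ultimately show ?thesis unfolding envelope_equations_def by blast
qed

lemma envelope_equations_imp_conic_center:
  assumes "envelope_equations X"
  obtains \<Gamma> Y1 Y2 where "planar_conic \<Gamma>" "conic_center \<Gamma> X"
    "s1.n Y1 = 0" "s2.n Y2 = 0"
    "\<forall>u. s1.n u = 0 \<longrightarrow> s2.n u = 0 \<longrightarrow> s1.B u Y1 = 0"
    "\<forall>u. s1.n u = 0 \<longrightarrow> s2.n u = 0 \<longrightarrow> s2.B u Y2 = 0"
    "contact3 \<Gamma> S1 p1 Y1" "contact3 \<Gamma> S2 p2 Y2"
proof -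
  define Z where "Z = E X"
  have eqs: "s1.n C \<noteq> 0 \<or> s2.n C \<noteq> 0" "s2.n C * s1.n Z + s1.n C * s2.n Z = 0"
    and F1: "\<And>u. s1.n u = 0 \<Longrightarrow> s1.B u (s2.n C *\<^sub>R Z + s2.n Z *\<^sub>R C) + s2.n u * (s1.n Z - s1.n C) / 2 = 0"
    and F2: "\<And>u. s2.n u = 0 \<Longrightarrow> s2.B u (s1.n C *\<^sub>R Z + s1.n Z *\<^sub>R C) - s1.n u * (s2.n Z + s2.n C) / 2 = 0"
    using assms unfolding envelope_equations_def Z_def by blast+
  obtain l where l: "l \<noteq> 0" "l \<noteq> 1" and a: "s1.n C \<noteq> 0" "s2.n C \<noteq> 0"
    and Zl: "s1.n Z = l * s1.n C" "s2.n Z = - l * s2.n C"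
    by (rule envelope_ratio[OF s1.n_linear s2.n_linear s1.B_bilinear s2.B_bilinear s1.B_definite s2.B_definite
          tangent_not_subset eqs F1 F2])
  have neg: "s1.n (- C) = - s1.n C" "s2.n (- C) = - s2.n C"
    by (rule linear_neg[OF s1.n_linear], rule linear_neg[OF s2.n_linear])
  note d1 = envelope_direction[OF s1.n_linear s2.n_linear s1.B_bilinear a(2) Zl F1]
  have a': "s1.n (- C) \<noteq> 0" and Zl': "s2.n Z = l * s2.n (- C)" "s1.n Z = - l * s1.n (- C)"
    using a Zl unfolding neg by auto
  have F2': "s2.B u (s1.n (- C) *\<^sub>R Z + s1.n Z *\<^sub>R (- C)) + s1.n u * (s2.n Z - s2.n (- C)) / 2 = 0"
    if "s2.n u = 0" for u
    using F2[OF that] unfolding second_equation_swap by simp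
  note d2 = envelope_direction[OF s2.n_linear s1.n_linear s2.B_bilinear a' Zl' F2']
  define \<Gamma> where "\<Gamma> = {X + x *\<^sub>R C + y *\<^sub>R Z | x y. x\<^sup>2 - l * y\<^sup>2 = 1 - l}"
  have ind: "\<alpha> = 0 \<and> \<beta> = 0" if "\<alpha> *\<^sub>R C + \<beta> *\<^sub>R Z = 0" for \<alpha> \<beta>
  proof -
    have "\<alpha> * s1.n C + \<beta> * s1.n Z = 0" "\<alpha> * s2.n C + \<beta> * s2.n Z = 0"
      using arg_cong[OF that, of s1.n] arg_cong[OF that, of s2.n]
        linear_0[OF s1.n_linear] linear_0[OF s2.n_linear]
      by (simp_all add: linear_add[OF s1.n_linear] linear_scale[OF s1.n_linear]
          linear_add[OF s2.n_linear] linear_scale[OF s2.n_linear])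
    then have "(\<alpha> + l * \<beta>) * s1.n C = 0" "(\<alpha> - l * \<beta>) * s2.n C = 0"
      unfolding Zl by (simp_all add: algebra_simps)
    then have "\<alpha> + l * \<beta> = 0" "\<alpha> - l * \<beta> = 0" using a by auto
    then have "\<alpha> = 0 \<and> l * \<beta> = 0" by argo
    then show ?thesis using l by simp
  qed
  have "planar_conic \<Gamma>"
    unfolding planar_conic_def
  proof (intro exI conjI)
    show "C \<noteq> Z" "independent {C, Z}" using independent_pairI[of C Z, OF ind] by auto
    show "1 * ((- l) * (- (1 - l)) - 0 * 0) - 0 * (0 * (- (1 - l)) - 0 * 0) + 0 * (0 * 0 - (- l) * 0) \<noteq> 0"
      using l by simp
    show "\<Gamma> = {X + x *\<^sub>R C + y *\<^sub>R Z | x y. 1 * x\<^sup>2 + 2 * 0 * x * y + (- l) * y\<^sup>2 + 2 * 0 * x + 2 * 0 * y + (- (1 - l)) = 0}"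
      unfolding \<Gamma>_def by (simp add: algebra_simps)
  qed
  moreover have "conic_center \<Gamma> X"
    unfolding conic_center_def
  proof
    fix q assume "q \<in> \<Gamma>"
    then obtain x y where "q = X + x *\<^sub>R C + y *\<^sub>R Z" "x\<^sup>2 - l * y\<^sup>2 = 1 - l" unfolding \<Gamma>_def by blast
    then have "2 *\<^sub>R X - q = X + (- x) *\<^sub>R C + (- y) *\<^sub>R Z" "(- x)\<^sup>2 - l * (- y)\<^sup>2 = 1 - l"
      by (simp_all add: scaleR_2)
    then show "2 *\<^sub>R X - q \<in> \<Gamma>" unfolding \<Gamma>_def by blast
  qed
  moreover have "contact3 \<Gamma> S1 p1 (Z - l *\<^sub>R C)"
  proof (rule mid_conic_contact3[OF s1.chart s1.point l _ _ Zl(1) ind d1(1) d1(3)])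
    have "p1 = (1/2) *\<^sub>R p1 + (1/2) *\<^sub>R p1" by (simp add: scaleR_left_distrib[symmetric])
    then show "p1 = X + C - Z" unfolding Z_def by (simp add: algebra_simps)
    show "X + x *\<^sub>R C + y *\<^sub>R Z \<in> \<Gamma>" if "x\<^sup>2 - l * y\<^sup>2 = 1 - l" for x y
      unfolding \<Gamma>_def using that by blast
  qed
  moreover have "contact3 \<Gamma> S2 p2 (Z - l *\<^sub>R (- C))"
  proof (rule mid_conic_contact3[OF s2.chart s2.point l _ _ Zl'(1) _ d2(1) d2(3)])
    have "p2 = (1/2) *\<^sub>R p2 + (1/2) *\<^sub>R p2" by (simp add: scaleR_left_distrib[symmetric])
    then show "p2 = X + - C - Z" unfolding Z_def by (simp add: algebra_simps)
    show "X + x *\<^sub>R (- C) + y *\<^sub>R Z \<in> \<Gamma>" if "x\<^sup>2 - l * y\<^sup>2 = 1 - l" for x y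
    proof -
      have "X + x *\<^sub>R (- C) + y *\<^sub>R Z = X + (- x) *\<^sub>R C + y *\<^sub>R Z" "(- x)\<^sup>2 - l * y\<^sup>2 = 1 - l"
        using that by simp_all
      then show ?thesis unfolding \<Gamma>_def by blast
    qed
    show "\<alpha> = 0 \<and> \<beta> = 0" if "\<alpha> *\<^sub>R (- C) + \<beta> *\<^sub>R Z = 0" for \<alpha> \<beta>
      using ind[of "- \<alpha>" \<beta>] that by simp
  qed
  ultimately show ?thesis using that d1(1,2) d2(1,2) by blast
qed

lemma h_orthogonal_1_iff:
  assumes "s1.n Y = 0"
  shows "h_orthogonal S1 \<xi>1 p1 Y (tangent_space S1 p1 \<inter> tangent_space S2 p2) \<longleftrightarrow>
     (\<forall>u. s1.n u = 0 \<longrightarrow> s2.n u = 0 \<longrightarrow> s1.B u Y = 0)"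
  unfolding h_orthogonal_def Ball_def Int_iff s1.tangent_iff s2.tangent_iff
  using s1.metric_zero_iff[OF assms] s1.B_sym[of Y] by auto

lemma h_orthogonal_2_iff:
  assumes "s2.n Y = 0"
  shows "h_orthogonal S2 \<xi>2 p2 Y (tangent_space S1 p1 \<inter> tangent_space S2 p2) \<longleftrightarrow>
     (\<forall>u. s1.n u = 0 \<longrightarrow> s2.n u = 0 \<longrightarrow> s2.B u Y = 0)"
  unfolding h_orthogonal_def Ball_def Int_iff s1.tangent_iff s2.tangent_iff
  using s2.metric_zero_iff[OF assms] s2.B_sym[of Y] by auto

end

section \<open>Centres of conics of third-order contact\<close>

theorem proposition4p3:
  fixes S1 S2 :: "(real^'n) set" and \<xi>1 \<xi>2 :: "real^'n \<Rightarrow> real^'n"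
  assumes "locally_convex_hypersurface S1" and "locally_convex_hypersurface S2"
    and "affine_normal_field S1 \<xi>1" and "affine_normal_field S2 \<xi>2"
    and "nondegenerate_hypersurface S1 \<xi>1" and "nondegenerate_hypersurface S2 \<xi>2"
    and "transversal_hypersurfaces S1 S2"
  shows "conic_centers S1 \<xi>1 S2 \<xi>2 = EMH S1 \<xi>1 S2 \<xi>2"
proof
  have pair: "surface_pair S1 S2 \<xi>1 \<xi>2 p1 p2 U1 U2 g1 g2"
    if "p1 \<in> S1" "p2 \<in> S2" "local_defining_function S1 p1 U1 g1" "local_defining_function S2 p2 U2 g2"
    for p1 p2 U1 U2 g1 g2
    using assms that unfolding affine_normal_field_def
    by (intro surface_pair.intro surface_chart.intro surface_pair_axioms.intro) auto
  show "conic_centers S1 \<xi>1 S2 \<xi>2 \<subseteq> EMH S1 \<xi>1 S2 \<xi>2"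
  proof
    fix X assume "X \<in> conic_centers S1 \<xi>1 S2 \<xi>2"
    then obtain \<Gamma> p1 p2 Y1 Y2 where pc: "planar_conic \<Gamma>" and cc: "conic_center \<Gamma> X"
      and p: "p1 \<in> S1" "p2 \<in> S2" and Y: "Y1 \<in> tangent_space S1 p1" "Y2 \<in> tangent_space S2 p2"
      and h1: "h_orthogonal S1 \<xi>1 p1 Y1 (tangent_space S1 p1 \<inter> tangent_space S2 p2)"
      and h2: "h_orthogonal S2 \<xi>2 p2 Y2 (tangent_space S1 p1 \<inter> tangent_space S2 p2)"
      and ct: "contact3 \<Gamma> S1 p1 Y1" "contact3 \<Gamma> S2 p2 Y2"
      unfolding conic_centers_def by blast
    obtain P and Q :: "real^'n \<Rightarrow> real^'n \<Rightarrow> real" where P: "subspace P" "dim P = 2"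
      and Q: "bilinear Q" "\<forall>u w. Q u w = Q w u"
      and \<Gamma>: "\<forall>q\<in>\<Gamma>. q - X \<in> P \<and> Q (q - X) (q - X) = 1"
      by (rule infinite_central_conic_form[OF pc cc contact3_infinite[OF ct(1)]])
    obtain U1 g1 v1 k1 where g1: "local_defining_function S1 p1 U1 g1"
      and v1: "v1 \<noteq> 0" "\<exists>r. v1 = r *\<^sub>R Y1" and c1: "dird g1 v1 p1 = 0" "dird (dird g1 v1) v1 p1 + dird g1 k1 p1 = 0"
      and Q1: "p1 - X \<in> P" "Q (p1 - X) (p1 - X) = 1" "v1 \<in> P" "Q (p1 - X) v1 = 0" "k1 \<in> P" "Q v1 v1 + Q (p1 - X) k1 = 0"
      by (rule contact3_conic_data[OF ct(1) P(1) Q \<Gamma>])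
    obtain U2 g2 v2 k2 where g2: "local_defining_function S2 p2 U2 g2"
      and v2: "v2 \<noteq> 0" "\<exists>r. v2 = r *\<^sub>R Y2" and c2: "dird g2 v2 p2 = 0" "dird (dird g2 v2) v2 p2 + dird g2 k2 p2 = 0"
      and Q2: "p2 - X \<in> P" "Q (p2 - X) (p2 - X) = 1" "v2 \<in> P" "Q (p2 - X) v2 = 0" "k2 \<in> P" "Q v2 v2 + Q (p2 - X) k2 = 0"
      by (rule contact3_conic_data[OF ct(2) P(1) Q \<Gamma>])
    interpret surface_pair S1 S2 \<xi>1 \<xi>2 p1 p2 U1 U2 g1 g2 by (rule pair[OF p g1 g2])
    have orth1: "s1.B u v1 = 0" if "s1.n u = 0" "s2.n u = 0" for u
    proof -
      obtain r where r: "v1 = r *\<^sub>R Y1" using v1(2) by blast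
      have "s1.B u Y1 = 0" using h1 h_orthogonal_1_iff[of Y1] Y(1) s1.tangent_iff that by blast
      then show ?thesis unfolding r using bilinear_rmul[OF s1.B_bilinear] by simp
    qed
    have orth2: "s2.B u v2 = 0" if "s1.n u = 0" "s2.n u = 0" for u
    proof -
      obtain r where r: "v2 = r *\<^sub>R Y2" using v2(2) by blast
      have "s2.B u Y2 = 0" using h2 h_orthogonal_2_iff[of Y2] Y(2) s2.tangent_iff that by blast
      then show ?thesis unfolding r using bilinear_rmul[OF s2.B_bilinear] by simp
    qed
    have "envelope_equations X"
      by (rule conic_center_satisfies_envelope_equations[OF P Q(1) Q(2)[rule_format]
            Q1(1-3) v1(1) Q1(4) c1(1) Q1(5,6) c1(2) Q2(1-3) v2(1) Q2(4) c2(1) Q2(5,6) c2(2) orth1 orth2])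
    then show "X \<in> EMH S1 \<xi>1 S2 \<xi>2" unfolding envelope_equations_iff EMH_def using p by blast
  qed
  show "EMH S1 \<xi>1 S2 \<xi>2 \<subseteq> conic_centers S1 \<xi>1 S2 \<xi>2"
  proof
    fix X assume "X \<in> EMH S1 \<xi>1 S2 \<xi>2"
    then obtain p1 p2 where p: "p1 \<in> S1" "p2 \<in> S2" and emh: "has_mid_hyperplane S1 S2 p1 p2"
      "mid_hyperplane_fun S1 \<xi>1 S2 \<xi>2 p1 p2 X = 0"
      "\<forall>u\<in>tangent_space S1 p1. deriv_along S1 (\<lambda>q. mid_hyperplane_fun S1 \<xi>1 S2 \<xi>2 q p2 X) p1 u = 0"
      "\<forall>u\<in>tangent_space S2 p2. deriv_along S2 (\<lambda>q. mid_hyperplane_fun S1 \<xi>1 S2 \<xi>2 p1 q X) p2 u = 0"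
      unfolding EMH_def by blast
    obtain U1 g1 where g1: "local_defining_function S1 p1 U1 g1"
      using assms(1) p(1) unfolding locally_convex_hypersurface_def hypersurface_def by blast
    obtain U2 g2 where g2: "local_defining_function S2 p2 U2 g2"
      using assms(2) p(2) unfolding locally_convex_hypersurface_def hypersurface_def by blast
    interpret surface_pair S1 S2 \<xi>1 \<xi>2 p1 p2 U1 U2 g1 g2 by (rule pair[OF p g1 g2])
    have "envelope_equations X" using emh envelope_equations_iff by blast
    then obtain \<Gamma> Y1 Y2 where c: "planar_conic \<Gamma>" "conic_center \<Gamma> X" and Y: "s1.n Y1 = 0" "s2.n Y2 = 0"
      and orth: "\<forall>u. s1.n u = 0 \<longrightarrow> s2.n u = 0 \<longrightarrow> s1.B u Y1 = 0"
        "\<forall>u. s1.n u = 0 \<longrightarrow> s2.n u = 0 \<longrightarrow> s2.B u Y2 = 0"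
      and ct: "contact3 \<Gamma> S1 p1 Y1" "contact3 \<Gamma> S2 p2 Y2"
      by (rule envelope_equations_imp_conic_center)
    have "h_orthogonal S1 \<xi>1 p1 Y1 (tangent_space S1 p1 \<inter> tangent_space S2 p2)"
      "h_orthogonal S2 \<xi>2 p2 Y2 (tangent_space S1 p1 \<inter> tangent_space S2 p2)"
      using h_orthogonal_1_iff[OF Y(1)] h_orthogonal_2_iff[OF Y(2)] orth by blast+
    moreover have "Y1 \<in> tangent_space S1 p1" "Y2 \<in> tangent_space S2 p2"
      using Y s1.tangent_iff s2.tangent_iff by auto
    ultimately show "X \<in> conic_centers S1 \<xi>1 S2 \<xi>2"
      unfolding conic_centers_def using c ct p by blast
  qed
qed

end
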